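(* Let the ALISE filter (defined in the context) be uniformly asymptotically stable and let $\breve A:=\overline A-LC_2$ be bounded. Then the state estimate bias $\mathbb E[\tilde x]:=\mathbb E[x-\hat x]$ decays exponentially, i.e. $$\|\mathbb E[\tilde x]\|\le\beta e^{-\gamma(t-t_0)}\quad\text{for all } t\ge t_0,$$ where, with initial state estimate bias $\mathbb E[\tilde x(t_0)]$, $$\beta=\sqrt{\frac{\mathbb E[\tilde x(t_0)]^\top S(t_0)\,\mathbb E[\tilde x(t_0)]}{\underline\lambda_{min}(S)}},\qquad\gamma=\frac1{2\overline\lambda_{max}(S)},$$ and $\overline\lambda_{max}(S)$ and $\underline\lambda_{min}(S)$ are the supremum and infimum over $t\ge t_0$ of the largest and smallest eigenvalue of $$S(t)=\lim_{T\to\infty}\int_t^T\Phi_{\breve A(t)}(t,s)\,\Phi_{\breve A(t)}^\top(t,s)\,ds\succ0,$$ with $\Phi_{\breve A(t)}(\cdot)$ denoting the transition matrix associated with the state dynamics $\dot x=\breve Ax$.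
   Context: **System.** All matrices and signals depend on time $t\ge t_0$ (argument omitted). $\dot x=Ax+Bu+Gd+Ww$, $y=Cx+Du+Hd+v$, with state $x\in\mathbb R^n$, known input $u\in\mathbb R^m$, unknown input $d\in\mathbb R^p$, output $y\in\mathbb R^l$, noises $w\in\mathbb R^q$, $v\in\mathbb R^l$; $A,B,G,C,D,W$ smooth, bounded, known; $H$ analytic and known; $n\ge l\ge1$, $l\ge p\ge0$, $m\ge0$. $x(t_0)$ is independent of $v,w$; an initial estimate $\hat x_0$ with covariance $\mathcal P_0^x$ is given. **Decoupling.** $p_H={\rm rk}(H)$ is taken constant. $H=[U_1\ U_2]\begin{bmatrix}\Sigma&0\\ 0&0\end{bmatrix}[V_1\ V_2]^\top$ is a differentiable singular value decomposition, $\Sigma\in\mathbb R^{p_H\times p_H}$ diagonal of full rank, $[U_1\ U_2]$, $[V_1\ V_2]$ unitary, with factors evolving as $\dot U_1=U_1E$, $\dot U_2=0$, $\dot V_1=V_1F$, $\dot V_2=0$ ($E,F$ skew-symmetric). $d_i=V_i^\top d$, $G_i=GV_i$; $T_1=U_1^\top-U_1^\top RU_2(U_2^\top RU_2)^{-1}U_2^\top$, $T_2=U_2^\top$; $z_i=T_iy$, $C_i=T_iC$, $D_i=T_iD$, $v_i=T_iv$ ($i=1,2$). **Standing assumption.** (i) $\dot w+A_ww=B_ww_G$ and $\ddot v+A_{\dot v}\dot v+A_vv=B_vv_G$, with $w_G,v_G$ mutually uncorrelated zero-mean white noises with time-invariant intensities $Q_G\succeq0$, $R_G\succ0$; the correlation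 times of $w,v$ are short compared to times of interest. With $\underline v=[v^\top\ \dot v^\top]^\top$, $\dot{\underline v}=\underline A_v\underline v+\underline B_vv_G$, $\underline A_v=\begin{bmatrix}0&I\\ -A_v&-A_{\dot v}\end{bmatrix}$, $\underline B_v=\begin{bmatrix}0\\ B_v\end{bmatrix}$. $A_w,A_v,A_{\dot v}$ are positive semidefinite diagonal; $-A_w$ and $\underline A_v$ are time-invariant and stable; $B_w,B_v,Q_G,R_G$ are time-invariant and bounded; $w(t_0),\underline v(t_0)$ have known covariances $\mathcal P_0^w,\mathcal P_0^v$. (ii) $u$ is twice and $d$ once differentiable; $u,\dot u,\ddot u,d,\dot d$ are bounded; the norms of the system state vectors, matrices and matrix derivatives are bounded. The output derivative $\dot y$ exists but is not measured. **Noise covariances.** $\dot P^w=-A_wP^w-P^wA_w^\top+B_wQ_GB_w^\top$, $P^w(t_0)=\mathcal P_0^w$; $\dot P^v=\underline A_vP^v+P^v\underline A_v^\top+\underline B_vR_G\underline B_v^\top$, $P^v(t_0)=\mathcal P_0^v$; $R=[I\ 0]P^v[I\ 0]^\top$, $R_1=[T_1\ 0]P^v[T_1\ 0]^\top$, $R_2=[T_2\ 0]P^v[T_2\ 0]^\top$, $\overline R_2=[0\ T_2]P^v[0\ T_2]^\top$, $\grave R_2=[T_2\ 0]P^v[0\ T_2]^\top$, $\grave R_{12}=[T_1\ 0]P^v[0\ T_2]^\top$. **ALISE filter** (with ${\rm rk}(C_2G_2)=p-p_H$). $M_1=\Sigma^{-1}$, $\hat A=A-G_1M_1C_1$, $\hat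 Q=WP^wW^\top+G_1M_1R_1M_1^\top G_1^\top$, $\tilde R_2=(C_2\hat A+T_2\dot C)P^x(C_2\hat A+T_2\dot C)^\top+C_2\hat QC_2^\top+\overline R_2-\grave R_{12}^\top M_1^\top G_1^\top C_2^\top-C_2G_1M_1\grave R_{12}$, $M_2=(G_2^\top C_2^\top\tilde R_2^{-1}C_2G_2)^{-1}G_2^\top C_2^\top\tilde R_2^{-1}$, $\overline A=(I-G_2M_2C_2)\hat A-G_2M_2T_2\dot C$, $\overline B=(I-G_2M_2C_2)(B-G_1M_1D_1)-G_2M_2T_2\dot D$, $\overline G=(I-G_2M_2C_2)G_1$, $\overline Q=(I-G_2M_2C_2)\hat Q(I-G_2M_2C_2)^\top$, $L=(P^xC_2^\top-G_2M_2\grave R_2^\top)R_2^{-1}$, $\dot P^x=\overline AP^x+P^x\overline A^\top+\overline Q-LR_2L^\top$, $P^x(t_0)=\mathcal P_0^x$. With $\Phi_1=G_2M_2T_2$ and $\Phi_2=-G_2M_2D_2$, the state estimate is $\hat x=G_2M_2z_2-G_2M_2D_2u+\theta$, $\dot\theta=(\overline A-LC_2)(G_2M_2z_2-G_2M_2D_2u+\theta)+(\overline B-LD_2)u+\overline GM_1z_1+Lz_2-\dot\Phi_1y-\dot\Phi_2u$, $\theta(t_0)=\hat x_0-G_2M_2z_2(t_0)+G_2M_2D_2u(t_0)$. The input estimate is $\hat d=V_1\hat d_1+V_2\hat d_2$, with $\hat d_1=M_1(z_1-C_1\hat x-D_1u)$ and, for a chosen $\mathfrak dt>0$, $\hat d_2=M_2\big(\frac{z_2(t)-z_2(t-\mathfrak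 dt)}{\mathfrak dt}-(C_2A+T_2\dot C)\hat x-C_2Bu-C_2G_1\hat d_1-D_2\dot u-T_2\dot Du\big)$. **Stability.** Uniform asymptotic stability of the filter means that of its homogeneous dynamics $\dot\xi=(\overline A-LC_2)\xi$.
   Formalization: The integrand of S(t) is read as Ψ(s,t)ᵀΨ(s,t), with Ψ(s,t) the usual transition matrix from t to s (the printed integral diverges under the usual convention), and the initial noises w(t₀), v(t₀), v̇(t₀) are assumed zero-mean, without which the bound fails. *)

theory Defs
  imports
    "HOL-Probability.Probability"
    "Jordan_Normal_Form.Char_Poly"
    "Jordan_Normal_Form.DL_Rank"
    "Jordan_Normal_Form.Gauss_Jordan_Elimination"
begin

text \<open>
  Matrices and vectors are those of Jordan_Normal_Form, whose dimensions are natural numbers and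
  may be zero: the dimensions \<open>m\<close>, \<open>p\<close>, \<open>p\<^sub>H\<close>, \<open>p - p\<^sub>H\<close> and \<open>l - p\<^sub>H\<close> are all allowed to vanish.
  All signals live on the half line from the initial time; derivatives are componentwise and, at
  the initial time, one-sided.
\<close>

type_synonym rvec = "real Matrix.vec"
type_synonym rmat = "real Matrix.mat"

subsection \<open>Linear algebra\<close>

definition vnorm :: "rvec \<Rightarrow> real" where
  "vnorm v = sqrt (scalar_prod v v)"

definition fnorm :: "rmat \<Rightarrow> real" where
  "fnorm A = sqrt (\<Sum>i<dim_row A. \<Sum>j<dim_col A. (A $$ (i,j))\<^sup>2)"

definition minv :: "rmat \<Rightarrow> rmat" where
  "minv A = the (mat_inverse A)"

definition hcat :: "rmat \<Rightarrow> rmat \<Rightarrow> rmat" where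
  "hcat A B = four_block_mat A B (0\<^sub>m 0 (dim_col A)) (0\<^sub>m 0 (dim_col B))"

definition orthogonal_matrix :: "nat \<Rightarrow> rmat \<Rightarrow> bool" where
  "orthogonal_matrix n A \<longleftrightarrow> A \<in> carrier_mat n n \<and> A\<^sup>T * A = 1\<^sub>m n \<and> A * A\<^sup>T = 1\<^sub>m n"

definition skew_symmetric :: "nat \<Rightarrow> rmat \<Rightarrow> bool" where
  "skew_symmetric n A \<longleftrightarrow> A \<in> carrier_mat n n \<and> A\<^sup>T = - A"

definition pos_semidef :: "nat \<Rightarrow> rmat \<Rightarrow> bool" where
  "pos_semidef n A \<longleftrightarrow> A \<in> carrier_mat n n \<and> A\<^sup>T = A \<and>
     (\<forall>v\<in>carrier_vec n. 0 \<le> scalar_prod v (A *\<^sub>v v))"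

definition pos_def :: "nat \<Rightarrow> rmat \<Rightarrow> bool" where
  "pos_def n A \<longleftrightarrow> A \<in> carrier_mat n n \<and> A\<^sup>T = A \<and>
     (\<forall>v\<in>carrier_vec n. v \<noteq> 0\<^sub>v n \<longrightarrow> 0 < scalar_prod v (A *\<^sub>v v))"

definition hurwitz :: "rmat \<Rightarrow> bool" where
  "hurwitz A \<longleftrightarrow> (\<forall>k. eigenvalue (map_mat complex_of_real A) k \<longrightarrow> Re k < 0)"

definition mrank :: "nat \<Rightarrow> rmat \<Rightarrow> nat" where
  "mrank nr A = vec_space.rank nr A"

definition lam_max :: "rmat \<Rightarrow> real" where
  "lam_max A = Max {k. eigenvalue A k}"

definition lam_min :: "rmat \<Rightarrow> real" where
  "lam_min A = Min {k. eigenvalue A k}"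


subsection \<open>Time-dependent vectors and matrices\<close>

definition has_mderiv :: "real \<Rightarrow> (real \<Rightarrow> rmat) \<Rightarrow> rmat \<Rightarrow> real \<Rightarrow> bool" where
  "has_mderiv a F F' t \<longleftrightarrow> dim_row F' = dim_row (F t) \<and> dim_col F' = dim_col (F t) \<and>
     (\<forall>i<dim_row (F t). \<forall>j<dim_col (F t).
        ((\<lambda>s. F s $$ (i,j)) has_real_derivative F' $$ (i,j)) (at t within {a..}))"

definition has_vderiv :: "real \<Rightarrow> (real \<Rightarrow> rvec) \<Rightarrow> rvec \<Rightarrow> real \<Rightarrow> bool" where
  "has_vderiv a f f' t \<longleftrightarrow> dim_vec f' = dim_vec (f t) \<and>
     (\<forall>i<dim_vec (f t). ((\<lambda>s. f s $ i) has_real_derivative f' $ i) (at t within {a..}))"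

definition mdifferentiable :: "real \<Rightarrow> (real \<Rightarrow> rmat) \<Rightarrow> bool" where
  "mdifferentiable a F \<longleftrightarrow> (\<forall>t\<ge>a. \<exists>F'. has_mderiv a F F' t)"

definition vdifferentiable :: "real \<Rightarrow> (real \<Rightarrow> rvec) \<Rightarrow> bool" where
  "vdifferentiable a f \<longleftrightarrow> (\<forall>t\<ge>a. \<exists>f'. has_vderiv a f f' t)"

definition mderiv :: "real \<Rightarrow> (real \<Rightarrow> rmat) \<Rightarrow> real \<Rightarrow> rmat" where
  "mderiv a F t = Matrix.mat (dim_row (F t)) (dim_col (F t))
     (\<lambda>(i,j). vector_derivative (\<lambda>s. F s $$ (i,j)) (at t within {a..}))"

definition vderiv :: "real \<Rightarrow> (real \<Rightarrow> rvec) \<Rightarrow> real \<Rightarrow> rvec" where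
  "vderiv a f t = Matrix.vec (dim_vec (f t))
     (\<lambda>i. vector_derivative (\<lambda>s. f s $ i) (at t within {a..}))"

definition mbounded :: "real \<Rightarrow> (real \<Rightarrow> rmat) \<Rightarrow> bool" where
  "mbounded a F \<longleftrightarrow> (\<exists>K. \<forall>t\<ge>a. fnorm (F t) \<le> K)"

definition vbounded :: "real \<Rightarrow> (real \<Rightarrow> rvec) \<Rightarrow> bool" where
  "vbounded a f \<longleftrightarrow> (\<exists>K. \<forall>t\<ge>a. vnorm (f t) \<le> K)"

definition matrix_fun :: "real \<Rightarrow> nat \<Rightarrow> nat \<Rightarrow> (real \<Rightarrow> rmat) \<Rightarrow> bool" where
  "matrix_fun a r c F \<longleftrightarrow> (\<forall>t\<ge>a. F t \<in> carrier_mat r c)"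

definition vector_fun :: "real \<Rightarrow> nat \<Rightarrow> (real \<Rightarrow> rvec) \<Rightarrow> bool" where
  "vector_fun a r f \<longleftrightarrow> (\<forall>t\<ge>a. f t \<in> carrier_vec r)"

text \<open>Here \<open>D k\<close> is the \<open>k\<close>-th derivative of \<open>F\<close>.\<close>

definition smooth_matrix :: "real \<Rightarrow> (real \<Rightarrow> rmat) \<Rightarrow> bool" where
  "smooth_matrix a F \<longleftrightarrow>
     (\<exists>D. D 0 = F \<and> (\<forall>k. \<forall>t\<ge>a. has_mderiv a (D k) (D (Suc k) t) t))"

definition analytic_matrix :: "real \<Rightarrow> nat \<Rightarrow> nat \<Rightarrow> (real \<Rightarrow> rmat) \<Rightarrow> bool" where
  "analytic_matrix a r c F \<longleftrightarrow> (\<forall>i<r. \<forall>j<c. \<forall>t\<ge>a. \<exists>\<rho>>0. \<exists>coef :: nat \<Rightarrow> real.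
     \<forall>s\<ge>a. \<bar>s - t\<bar> < \<rho> \<longrightarrow> (\<lambda>k. coef k * (s - t) ^ k) sums (F s $$ (i,j)))"


subsection \<open>Linear time-varying homogeneous dynamics\<close>

definition homogeneous_solution :: "nat \<Rightarrow> (real \<Rightarrow> rmat) \<Rightarrow> real \<Rightarrow> (real \<Rightarrow> rvec) \<Rightarrow> bool" where
  "homogeneous_solution n A s \<xi> \<longleftrightarrow>
     (\<forall>t\<ge>s. \<xi> t \<in> carrier_vec n \<and> has_vderiv s \<xi> (A t *\<^sub>v \<xi> t) t)"

definition uniformly_stable :: "real \<Rightarrow> nat \<Rightarrow> (real \<Rightarrow> rmat) \<Rightarrow> bool" where
  "uniformly_stable a n A \<longleftrightarrow> (\<forall>\<epsilon>>0. \<exists>\<delta>>0. \<forall>s\<ge>a. \<forall>\<xi>.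
     homogeneous_solution n A s \<xi> \<and> vnorm (\<xi> s) < \<delta> \<longrightarrow> (\<forall>t\<ge>s. vnorm (\<xi> t) < \<epsilon>))"

definition uniformly_attractive :: "real \<Rightarrow> nat \<Rightarrow> (real \<Rightarrow> rmat) \<Rightarrow> bool" where
  "uniformly_attractive a n A \<longleftrightarrow> (\<exists>c>0. \<forall>\<epsilon>>0. \<exists>T>0. \<forall>s\<ge>a. \<forall>\<xi>.
     homogeneous_solution n A s \<xi> \<and> vnorm (\<xi> s) < c \<longrightarrow> (\<forall>t\<ge>s + T. vnorm (\<xi> t) < \<epsilon>))"

definition uniformly_asymptotically_stable :: "real \<Rightarrow> nat \<Rightarrow> (real \<Rightarrow> rmat) \<Rightarrow> bool" where
  "uniformly_asymptotically_stable a n A \<longleftrightarrow>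
     uniformly_stable a n A \<and> uniformly_attractive a n A"

text \<open>\<open>\<Psi> t s\<close> maps the state at time \<open>s\<close> to the state at time \<open>t\<close>.\<close>

definition transition_matrix ::
    "real \<Rightarrow> nat \<Rightarrow> (real \<Rightarrow> rmat) \<Rightarrow> (real \<Rightarrow> real \<Rightarrow> rmat) \<Rightarrow> bool" where
  "transition_matrix a n A \<Psi> \<longleftrightarrow> (\<forall>s\<ge>a. \<Psi> s s = 1\<^sub>m n \<and>
     (\<forall>t\<ge>a. \<Psi> t s \<in> carrier_mat n n \<and> has_mderiv a (\<lambda>r. \<Psi> r s) (A t * \<Psi> t s) t))"

text \<open>
  The Gramian \<open>S(t) = lim\<^bsub>T\<rightarrow>\<infinity>\<^esub> \<integral>\<^sub>t\<^sup>T \<Phi>(t,s) \<Phi>(t,s)\<^sup>T ds\<close>. For \<open>s \<ge> t\<close> the factor \<open>\<Phi>(t,s)\<close> is the transition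
  from time \<open>t\<close> to the later time \<open>s\<close> acting on row vectors, \<open>\<xi>(s)\<^sup>T = \<xi>(t)\<^sup>T \<Phi>(t,s)\<close>, that is
  \<open>\<Phi>(t,s) = \<Psi>(s,t)\<^sup>T\<close> in terms of the transition matrix above, so that
  \<open>\<xi>(t)\<^sup>T S(t) \<xi>(t) = \<integral>\<^sub>t\<^sup>\<infinity> \<bar>\<xi>(s)\<bar>\<^sup>2 ds\<close> along solutions. With \<open>\<Psi>(t,s)\<close> in place of \<open>\<Phi>(t,s)\<close> the
  integral would diverge for every exponentially stable system.
\<close>

definition gramian_integrand :: "(real \<Rightarrow> real \<Rightarrow> rmat) \<Rightarrow> real \<Rightarrow> real \<Rightarrow> rmat" where
  "gramian_integrand \<Psi> t s = (let \<Phi> = (\<lambda>t s. (\<Psi> s t)\<^sup>T) in \<Phi> t s * (\<Phi> t s)\<^sup>T)"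

definition gramian_upto :: "nat \<Rightarrow> (real \<Rightarrow> real \<Rightarrow> rmat) \<Rightarrow> real \<Rightarrow> real \<Rightarrow> rmat" where
  "gramian_upto n \<Psi> t T =
     Matrix.mat n n (\<lambda>(i,j). integral {t..T} (\<lambda>s. gramian_integrand \<Psi> t s $$ (i,j)))"

definition gramian :: "nat \<Rightarrow> (real \<Rightarrow> real \<Rightarrow> rmat) \<Rightarrow> real \<Rightarrow> rmat" where
  "gramian n \<Psi> t = Matrix.mat n n (\<lambda>(i,j). Lim at_top (\<lambda>T. gramian_upto n \<Psi> t T $$ (i,j)))"

definition sup_lam_max :: "real \<Rightarrow> (real \<Rightarrow> rmat) \<Rightarrow> real" where
  "sup_lam_max a S = (SUP t\<in>{a..}. lam_max (S t))"

definition inf_lam_min :: "real \<Rightarrow> (real \<Rightarrow> rmat) \<Rightarrow> real" where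
  "inf_lam_min a S = (INF t\<in>{a..}. lam_min (S t))"


subsection \<open>Deterministic data of the system and of the filter\<close>

text \<open>
  \<open>nx, nu, nd, ny, nw\<close> are the dimensions \<open>n, m, p, l, q\<close>, \<open>pH\<close> is the rank of \<open>H\<close>, and \<open>nwG, nvG\<close>
  are the dimensions of the white noises \<open>w\<^sub>G, v\<^sub>G\<close>.
\<close>

record alise =
  ti :: real
  nx :: nat
  nu :: nat
  nd :: nat
  ny :: nat
  nw :: nat
  pH :: nat
  nwG :: nat
  nvG :: nat
  mA :: "real \<Rightarrow> rmat"
  mB :: "real \<Rightarrow> rmat"
  mG :: "real \<Rightarrow> rmat"
  mC :: "real \<Rightarrow> rmat"
  mD :: "real \<Rightarrow> rmat"
  mW :: "real \<Rightarrow> rmat"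
  mH :: "real \<Rightarrow> rmat"
  inp :: "real \<Rightarrow> rvec"
  unk :: "real \<Rightarrow> rvec"
  U1 :: "real \<Rightarrow> rmat"
  U2 :: "real \<Rightarrow> rmat"
  V1 :: "real \<Rightarrow> rmat"
  V2 :: "real \<Rightarrow> rmat"
  Sig :: "real \<Rightarrow> rmat"
  Aw :: rmat
  Av :: rmat
  Avd :: rmat
  Bw :: rmat
  Bv :: rmat
  QG :: rmat
  RG :: rmat
  P0w :: rmat
  P0v :: rmat
  P0x :: rmat
  Pw :: "real \<Rightarrow> rmat"
  Pv :: "real \<Rightarrow> rmat"
  Px :: "real \<Rightarrow> rmat"

definition plant :: "alise \<Rightarrow> bool" where
  "plant Z \<longleftrightarrow>
     ny Z \<le> nx Z \<and> 1 \<le> ny Z \<and> nd Z \<le> ny Z \<and>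
     matrix_fun (ti Z) (nx Z) (nx Z) (mA Z) \<and>
     matrix_fun (ti Z) (nx Z) (nu Z) (mB Z) \<and>
     matrix_fun (ti Z) (nx Z) (nd Z) (mG Z) \<and>
     matrix_fun (ti Z) (ny Z) (nx Z) (mC Z) \<and>
     matrix_fun (ti Z) (ny Z) (nu Z) (mD Z) \<and>
     matrix_fun (ti Z) (nx Z) (nw Z) (mW Z) \<and>
     matrix_fun (ti Z) (ny Z) (nd Z) (mH Z) \<and>
     (\<forall>F\<in>{mA Z, mB Z, mG Z, mC Z, mD Z, mW Z}. smooth_matrix (ti Z) F) \<and>
     analytic_matrix (ti Z) (ny Z) (nd Z) (mH Z) \<and>
     (\<forall>F\<in>{mA Z, mB Z, mG Z, mC Z, mD Z, mW Z, mH Z}.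
        mbounded (ti Z) F \<and> mbounded (ti Z) (mderiv (ti Z) F)) \<and>
     vector_fun (ti Z) (nu Z) (inp Z) \<and>
     vdifferentiable (ti Z) (inp Z) \<and>
     vdifferentiable (ti Z) (vderiv (ti Z) (inp Z)) \<and>
     vbounded (ti Z) (inp Z) \<and>
     vbounded (ti Z) (vderiv (ti Z) (inp Z)) \<and>
     vbounded (ti Z) (vderiv (ti Z) (vderiv (ti Z) (inp Z))) \<and>
     vector_fun (ti Z) (nd Z) (unk Z) \<and>
     vdifferentiable (ti Z) (unk Z) \<and>
     vbounded (ti Z) (unk Z) \<and>
     vbounded (ti Z) (vderiv (ti Z) (unk Z))"

definition decoupling :: "alise \<Rightarrow> bool" where
  "decoupling Z \<longleftrightarrow>
     (\<forall>t\<ge>ti Z. mrank (ny Z) (mH Z t) = pH Z) \<and>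
     matrix_fun (ti Z) (ny Z) (pH Z) (U1 Z) \<and>
     matrix_fun (ti Z) (ny Z) (ny Z - pH Z) (U2 Z) \<and>
     matrix_fun (ti Z) (nd Z) (pH Z) (V1 Z) \<and>
     matrix_fun (ti Z) (nd Z) (nd Z - pH Z) (V2 Z) \<and>
     matrix_fun (ti Z) (pH Z) (pH Z) (Sig Z) \<and>
     mdifferentiable (ti Z) (Sig Z) \<and>
     (\<forall>t\<ge>ti Z.
        orthogonal_matrix (ny Z) (hcat (U1 Z t) (U2 Z t)) \<and>
        orthogonal_matrix (nd Z) (hcat (V1 Z t) (V2 Z t)) \<and>
        diagonal_mat (Sig Z t) \<and> invertible_mat (Sig Z t) \<and>
        mH Z t = hcat (U1 Z t) (U2 Z t) *
          four_block_mat (Sig Z t) (0\<^sub>m (pH Z) (nd Z - pH Z))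
            (0\<^sub>m (ny Z - pH Z) (pH Z)) (0\<^sub>m (ny Z - pH Z) (nd Z - pH Z)) *
          (hcat (V1 Z t) (V2 Z t))\<^sup>T \<and>
        (\<exists>E. skew_symmetric (pH Z) E \<and> has_mderiv (ti Z) (U1 Z) (U1 Z t * E) t) \<and>
        has_mderiv (ti Z) (U2 Z) (0\<^sub>m (ny Z) (ny Z - pH Z)) t \<and>
        (\<exists>F. skew_symmetric (pH Z) F \<and> has_mderiv (ti Z) (V1 Z) (V1 Z t * F) t) \<and>
        has_mderiv (ti Z) (V2 Z) (0\<^sub>m (nd Z) (nd Z - pH Z)) t)"

definition Av_stack :: "alise \<Rightarrow> rmat" where
  "Av_stack Z = four_block_mat (0\<^sub>m (ny Z) (ny Z)) (1\<^sub>m (ny Z)) (- Av Z) (- Avd Z)"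

definition Bv_stack :: "alise \<Rightarrow> rmat" where
  "Bv_stack Z = 0\<^sub>m (ny Z) (nvG Z) @\<^sub>r Bv Z"

definition noise_model :: "alise \<Rightarrow> bool" where
  "noise_model Z \<longleftrightarrow>
     pos_semidef (nw Z) (Aw Z) \<and> diagonal_mat (Aw Z) \<and>
     pos_semidef (ny Z) (Av Z) \<and> diagonal_mat (Av Z) \<and>
     pos_semidef (ny Z) (Avd Z) \<and> diagonal_mat (Avd Z) \<and>
     hurwitz (- Aw Z) \<and> hurwitz (Av_stack Z) \<and>
     Bw Z \<in> carrier_mat (nw Z) (nwG Z) \<and> Bv Z \<in> carrier_mat (ny Z) (nvG Z) \<and>
     pos_semidef (nwG Z) (QG Z) \<and> pos_def (nvG Z) (RG Z)"

definition noise_covariances :: "alise \<Rightarrow> bool" where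
  "noise_covariances Z \<longleftrightarrow>
     matrix_fun (ti Z) (nw Z) (nw Z) (Pw Z) \<and>
     matrix_fun (ti Z) (2 * ny Z) (2 * ny Z) (Pv Z) \<and>
     Pw Z (ti Z) = P0w Z \<and> Pv Z (ti Z) = P0v Z \<and>
     (\<forall>t\<ge>ti Z.
        has_mderiv (ti Z) (Pw Z)
          (- Aw Z * Pw Z t - Pw Z t * (Aw Z)\<^sup>T + Bw Z * QG Z * (Bw Z)\<^sup>T) t \<and>
        has_mderiv (ti Z) (Pv Z)
          (Av_stack Z * Pv Z t + Pv Z t * (Av_stack Z)\<^sup>T
             + Bv_stack Z * RG Z * (Bv_stack Z)\<^sup>T) t)"


subsection \<open>The filter matrices\<close>

definition Rn :: "alise \<Rightarrow> real \<Rightarrow> rmat" where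
  "Rn Z t = (let S = hcat (1\<^sub>m (ny Z)) (0\<^sub>m (ny Z) (ny Z)) in S * Pv Z t * S\<^sup>T)"

definition T1 :: "alise \<Rightarrow> real \<Rightarrow> rmat" where
  "T1 Z t = (U1 Z t)\<^sup>T - (U1 Z t)\<^sup>T * Rn Z t * U2 Z t
     * minv ((U2 Z t)\<^sup>T * Rn Z t * U2 Z t) * (U2 Z t)\<^sup>T"

definition T2 :: "alise \<Rightarrow> real \<Rightarrow> rmat" where "T2 Z t = (U2 Z t)\<^sup>T"

definition G1 :: "alise \<Rightarrow> real \<Rightarrow> rmat" where "G1 Z t = mG Z t * V1 Z t"
definition G2 :: "alise \<Rightarrow> real \<Rightarrow> rmat" where "G2 Z t = mG Z t * V2 Z t"
definition C1 :: "alise \<Rightarrow> real \<Rightarrow> rmat" where "C1 Z t = T1 Z t * mC Z t"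
definition C2 :: "alise \<Rightarrow> real \<Rightarrow> rmat" where "C2 Z t = T2 Z t * mC Z t"
definition D1 :: "alise \<Rightarrow> real \<Rightarrow> rmat" where "D1 Z t = T1 Z t * mD Z t"
definition D2 :: "alise \<Rightarrow> real \<Rightarrow> rmat" where "D2 Z t = T2 Z t * mD Z t"

text \<open>\<open>selL T = [T 0]\<close> and \<open>selR T = [0 T]\<close> act on the stacked noise \<open>[v; v']\<close>.\<close>

definition selL :: "rmat \<Rightarrow> rmat" where "selL T = hcat T (0\<^sub>m (dim_row T) (dim_col T))"
definition selR :: "rmat \<Rightarrow> rmat" where "selR T = hcat (0\<^sub>m (dim_row T) (dim_col T)) T"

definition R1 :: "alise \<Rightarrow> real \<Rightarrow> rmat" where
  "R1 Z t = selL (T1 Z t) * Pv Z t * (selL (T1 Z t))\<^sup>T"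

definition R2 :: "alise \<Rightarrow> real \<Rightarrow> rmat" where
  "R2 Z t = selL (T2 Z t) * Pv Z t * (selL (T2 Z t))\<^sup>T"

definition R2_bar :: "alise \<Rightarrow> real \<Rightarrow> rmat" where
  "R2_bar Z t = selR (T2 Z t) * Pv Z t * (selR (T2 Z t))\<^sup>T"

definition R2_grave :: "alise \<Rightarrow> real \<Rightarrow> rmat" where
  "R2_grave Z t = selL (T2 Z t) * Pv Z t * (selR (T2 Z t))\<^sup>T"

definition R12_grave :: "alise \<Rightarrow> real \<Rightarrow> rmat" where
  "R12_grave Z t = selL (T1 Z t) * Pv Z t * (selR (T2 Z t))\<^sup>T"

definition M1 :: "alise \<Rightarrow> real \<Rightarrow> rmat" where "M1 Z t = minv (Sig Z t)"

definition A_hat :: "alise \<Rightarrow> real \<Rightarrow> rmat" where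
  "A_hat Z t = mA Z t - G1 Z t * M1 Z t * C1 Z t"

definition Q_hat :: "alise \<Rightarrow> real \<Rightarrow> rmat" where
  "Q_hat Z t = mW Z t * Pw Z t * (mW Z t)\<^sup>T
     + G1 Z t * M1 Z t * R1 Z t * (M1 Z t)\<^sup>T * (G1 Z t)\<^sup>T"

definition R2_tilde :: "alise \<Rightarrow> real \<Rightarrow> rmat" where
  "R2_tilde Z t =
     (let K = C2 Z t * A_hat Z t + T2 Z t * mderiv (ti Z) (mC Z) t in
      K * Px Z t * K\<^sup>T + C2 Z t * Q_hat Z t * (C2 Z t)\<^sup>T + R2_bar Z t
        - (R12_grave Z t)\<^sup>T * (M1 Z t)\<^sup>T * (G1 Z t)\<^sup>T * (C2 Z t)\<^sup>T
        - C2 Z t * G1 Z t * M1 Z t * R12_grave Z t)"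


text \<open>The matrix inverted in the weighted least-squares gain \<open>M2\<close>.\<close>

definition normal_mat :: "alise \<Rightarrow> real \<Rightarrow> rmat" where
  "normal_mat Z t = (G2 Z t)\<^sup>T * (C2 Z t)\<^sup>T * minv (R2_tilde Z t) * C2 Z t * G2 Z t"

definition M2 :: "alise \<Rightarrow> real \<Rightarrow> rmat" where
  "M2 Z t = minv (normal_mat Z t) * (G2 Z t)\<^sup>T * (C2 Z t)\<^sup>T * minv (R2_tilde Z t)"

definition Proj :: "alise \<Rightarrow> real \<Rightarrow> rmat" where
  "Proj Z t = 1\<^sub>m (nx Z) - G2 Z t * M2 Z t * C2 Z t"

definition A_bar :: "alise \<Rightarrow> real \<Rightarrow> rmat" where
  "A_bar Z t = Proj Z t * A_hat Z t - G2 Z t * M2 Z t * T2 Z t * mderiv (ti Z) (mC Z) t"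

definition B_bar :: "alise \<Rightarrow> real \<Rightarrow> rmat" where
  "B_bar Z t = Proj Z t * (mB Z t - G1 Z t * M1 Z t * D1 Z t)
     - G2 Z t * M2 Z t * T2 Z t * mderiv (ti Z) (mD Z) t"

definition G_bar :: "alise \<Rightarrow> real \<Rightarrow> rmat" where
  "G_bar Z t = Proj Z t * G1 Z t"

definition Q_bar :: "alise \<Rightarrow> real \<Rightarrow> rmat" where
  "Q_bar Z t = Proj Z t * Q_hat Z t * (Proj Z t)\<^sup>T"

definition L_gain :: "alise \<Rightarrow> real \<Rightarrow> rmat" where
  "L_gain Z t = (Px Z t * (C2 Z t)\<^sup>T - G2 Z t * M2 Z t * (R2_grave Z t)\<^sup>T) * minv (R2 Z t)"

definition A_breve :: "alise \<Rightarrow> real \<Rightarrow> rmat" where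
  "A_breve Z t = A_bar Z t - L_gain Z t * C2 Z t"

definition Phi1 :: "alise \<Rightarrow> real \<Rightarrow> rmat" where
  "Phi1 Z t = G2 Z t * M2 Z t * T2 Z t"

definition Phi2 :: "alise \<Rightarrow> real \<Rightarrow> rmat" where
  "Phi2 Z t = - (G2 Z t * M2 Z t * D2 Z t)"

text \<open>
  Well-posedness of the gains: the rank condition, existence of the inverses and of the time
  derivatives that occur in the filter equations, and the Riccati equation for \<open>Px\<close>.
  Note that \<open>(U2 Z t)\<^sup>T * Rn Z t * U2 Z t\<close> and \<open>R2 Z t\<close> are the same matrix.
\<close>

definition filter_gains :: "alise \<Rightarrow> bool" where
  "filter_gains Z \<longleftrightarrow>
     matrix_fun (ti Z) (nx Z) (nx Z) (Px Z) \<and> Px Z (ti Z) = P0x Z \<and>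
     mdifferentiable (ti Z) (Phi1 Z) \<and> mdifferentiable (ti Z) (Phi2 Z) \<and>
     (\<forall>t\<ge>ti Z.
        mrank (ny Z - pH Z) (C2 Z t * G2 Z t) = nd Z - pH Z \<and>
        invertible_mat (R2 Z t) \<and> invertible_mat (R2_tilde Z t) \<and>
        invertible_mat (normal_mat Z t) \<and>
        has_mderiv (ti Z) (Px Z)
          (A_bar Z t * Px Z t + Px Z t * (A_bar Z t)\<^sup>T + Q_bar Z t
             - L_gain Z t * R2 Z t * (L_gain Z t)\<^sup>T) t)"


subsection \<open>Stochastic processes\<close>

definition random_vector :: "'w measure \<Rightarrow> nat \<Rightarrow> ('w \<Rightarrow> rvec) \<Rightarrow> bool" where
  "random_vector M k X \<longleftrightarrow> (\<forall>\<omega>\<in>space M. X \<omega> \<in> carrier_vec k) \<and>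
     (\<forall>i<k. (\<lambda>\<omega>. X \<omega> $ i) \<in> borel_measurable M)"

definition square_integrable :: "'w measure \<Rightarrow> nat \<Rightarrow> ('w \<Rightarrow> rvec) \<Rightarrow> bool" where
  "square_integrable M k X \<longleftrightarrow> random_vector M k X \<and> (\<forall>i<k. integrable M (\<lambda>\<omega>. (X \<omega> $ i)\<^sup>2))"

definition vector_process :: "'w measure \<Rightarrow> real \<Rightarrow> nat \<Rightarrow> (real \<Rightarrow> 'w \<Rightarrow> rvec) \<Rightarrow> bool" where
  "vector_process M a k X \<longleftrightarrow> (\<forall>t\<ge>a. random_vector M k (X t))"

definition mean_vec :: "'w measure \<Rightarrow> nat \<Rightarrow> ('w \<Rightarrow> rvec) \<Rightarrow> rvec" where
  "mean_vec M k X = Matrix.vec k (\<lambda>i. integral\<^sup>L M (\<lambda>\<omega>. X \<omega> $ i))"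

definition cov_mat :: "'w measure \<Rightarrow> nat \<Rightarrow> ('w \<Rightarrow> rvec) \<Rightarrow> rmat" where
  "cov_mat M k X = Matrix.mat k k (\<lambda>(i,j). integral\<^sup>L M
     (\<lambda>\<omega>. (X \<omega> $ i - mean_vec M k X $ i) * (X \<omega> $ j - mean_vec M k X $ j)))"

text \<open>
  White noise is represented by its integral \<open>\<beta>(t) = \<integral>\<^sub>a\<^sup>t \<dots> ds\<close>, a zero-mean process with orthogonal
  increments and continuous paths: the intensity \<open>Q\<close> is the covariance rate of the increments,
  the minimum minus maximum below being the length of the intersection of the two time intervals.
\<close>

definition integrated_white_noise ::
    "'w measure \<Rightarrow> real \<Rightarrow> nat \<Rightarrow> rmat \<Rightarrow> (real \<Rightarrow> 'w \<Rightarrow> rvec) \<Rightarrow> bool" where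
  "integrated_white_noise M a k Q \<beta> \<longleftrightarrow>
     (\<forall>t\<ge>a. square_integrable M k (\<beta> t) \<and> mean_vec M k (\<beta> t) = 0\<^sub>v k) \<and>
     (\<forall>\<omega>\<in>space M. \<beta> a \<omega> = 0\<^sub>v k \<and> (\<forall>i<k. continuous_on {a..} (\<lambda>t. \<beta> t \<omega> $ i))) \<and>
     (\<forall>i<k. \<forall>j<k. \<forall>s t s' t'. a \<le> s \<and> s \<le> t \<and> a \<le> s' \<and> s' \<le> t' \<longrightarrow>
        integral\<^sup>L M (\<lambda>\<omega>. (\<beta> t \<omega> $ i - \<beta> s \<omega> $ i) * (\<beta> t' \<omega> $ j - \<beta> s' \<omega> $ j))
          = Q $$ (i,j) * max 0 (min t t' - max s s'))"

definition uncorrelated_increments ::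
    "'w measure \<Rightarrow> real \<Rightarrow> nat \<Rightarrow> nat \<Rightarrow> (real \<Rightarrow> 'w \<Rightarrow> rvec) \<Rightarrow> (real \<Rightarrow> 'w \<Rightarrow> rvec) \<Rightarrow> bool" where
  "uncorrelated_increments M a k k' \<beta> \<beta>' \<longleftrightarrow>
     (\<forall>i<k. \<forall>j<k'. \<forall>s t s' t'. a \<le> s \<and> s \<le> t \<and> a \<le> s' \<and> s' \<le> t' \<longrightarrow>
        integral\<^sup>L M (\<lambda>\<omega>. (\<beta> t \<omega> $ i - \<beta> s \<omega> $ i) * (\<beta>' t' \<omega> $ j - \<beta>' s' \<omega> $ j)) = 0)"

text \<open>
  The equation \<open>w' + A\<^sub>w w = B\<^sub>w w\<^sub>G\<close> with \<open>w\<^sub>G = \<beta>w'\<close> reads, pathwise, \<open>(w - B\<^sub>w \<beta>w)' = - A\<^sub>w w\<close>, equivalently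
  \<open>dw = - A\<^sub>w w dt + B\<^sub>w d\<beta>w\<close>; similarly for \<open>v\<close>, where \<open>vd\<close> is the derivative of \<open>v\<close>.
  The initial noise states have mean zero, so that \<open>w\<close>, \<open>v\<close> and \<open>vd\<close> are zero-mean at all times.
\<close>

definition noise_processes ::
    "'w measure \<Rightarrow> alise \<Rightarrow> (real \<Rightarrow> 'w \<Rightarrow> rvec) \<Rightarrow> (real \<Rightarrow> 'w \<Rightarrow> rvec) \<Rightarrow> (real \<Rightarrow> 'w \<Rightarrow> rvec)
      \<Rightarrow> (real \<Rightarrow> 'w \<Rightarrow> rvec) \<Rightarrow> (real \<Rightarrow> 'w \<Rightarrow> rvec) \<Rightarrow> bool" where
  "noise_processes M Z w v vd \<beta>w \<beta>v \<longleftrightarrow>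
     integrated_white_noise M (ti Z) (nwG Z) (QG Z) \<beta>w \<and>
     integrated_white_noise M (ti Z) (nvG Z) (RG Z) \<beta>v \<and>
     uncorrelated_increments M (ti Z) (nwG Z) (nvG Z) \<beta>w \<beta>v \<and>
     vector_process M (ti Z) (nw Z) w \<and>
     vector_process M (ti Z) (ny Z) v \<and>
     vector_process M (ti Z) (ny Z) vd \<and>
     (\<forall>\<omega>\<in>space M. \<forall>t\<ge>ti Z.
        has_vderiv (ti Z) (\<lambda>s. w s \<omega> - Bw Z *\<^sub>v \<beta>w s \<omega>) (- (Aw Z *\<^sub>v w t \<omega>)) t \<and>
        has_vderiv (ti Z) (\<lambda>s. v s \<omega>) (vd t \<omega>) t \<and>
        has_vderiv (ti Z) (\<lambda>s. vd s \<omega> - Bv Z *\<^sub>v \<beta>v s \<omega>)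
          (- (Avd Z *\<^sub>v vd t \<omega>) - Av Z *\<^sub>v v t \<omega>) t) \<and>
     square_integrable M (nw Z) (w (ti Z)) \<and>
     mean_vec M (nw Z) (w (ti Z)) = 0\<^sub>v (nw Z) \<and>
     cov_mat M (nw Z) (w (ti Z)) = P0w Z \<and>
     square_integrable M (2 * ny Z) (\<lambda>\<omega>. v (ti Z) \<omega> @\<^sub>v vd (ti Z) \<omega>) \<and>
     mean_vec M (2 * ny Z) (\<lambda>\<omega>. v (ti Z) \<omega> @\<^sub>v vd (ti Z) \<omega>) = 0\<^sub>v (2 * ny Z) \<and>
     cov_mat M (2 * ny Z) (\<lambda>\<omega>. v (ti Z) \<omega> @\<^sub>v vd (ti Z) \<omega>) = P0v Z"

definition measurement ::
    "alise \<Rightarrow> (real \<Rightarrow> 'w \<Rightarrow> rvec) \<Rightarrow> (real \<Rightarrow> 'w \<Rightarrow> rvec) \<Rightarrow> real \<Rightarrow> 'w \<Rightarrow> rvec" where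
  "measurement Z x v t \<omega> =
     mC Z t *\<^sub>v x t \<omega> + mD Z t *\<^sub>v inp Z t + mH Z t *\<^sub>v unk Z t + v t \<omega>"

definition coordinate_events :: "'w measure \<Rightarrow> nat \<Rightarrow> ('w \<Rightarrow> rvec) \<Rightarrow> 'w set set" where
  "coordinate_events M k X = {(\<lambda>\<omega>. X \<omega> $ i) -` B \<inter> space M | i B. i < k \<and> B \<in> sets borel}"

text \<open>
  Boundedness of the random state is required in mean square, which uniformly bounded
  paths would imply.
\<close>

definition state_process ::
    "'w measure \<Rightarrow> alise \<Rightarrow> (real \<Rightarrow> 'w \<Rightarrow> rvec) \<Rightarrow> (real \<Rightarrow> 'w \<Rightarrow> rvec) \<Rightarrow> (real \<Rightarrow> 'w \<Rightarrow> rvec) \<Rightarrow> bool"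
  where
  "state_process M Z x w v \<longleftrightarrow>
     (\<forall>t\<ge>ti Z. square_integrable M (nx Z) (x t)) \<and>
     (\<exists>K. \<forall>t\<ge>ti Z. integral\<^sup>L M (\<lambda>\<omega>. (vnorm (x t \<omega>))\<^sup>2) \<le> K) \<and>
     (\<forall>\<omega>\<in>space M. \<forall>t\<ge>ti Z. has_vderiv (ti Z) (\<lambda>s. x s \<omega>)
        (mA Z t *\<^sub>v x t \<omega> + mB Z t *\<^sub>v inp Z t + mG Z t *\<^sub>v unk Z t + mW Z t *\<^sub>v w t \<omega>) t) \<and>
     (\<forall>\<omega>\<in>space M. vdifferentiable (ti Z) (\<lambda>t. measurement Z x v t \<omega>)) \<and>
     prob_space.indep_set M
       (sigma_sets (space M) (coordinate_events M (nx Z) (x (ti Z))))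
       (sigma_sets (space M) (\<Union>t\<in>{ti Z..}.
          coordinate_events M (nw Z) (w t) \<union> coordinate_events M (ny Z) (v t)))"


subsection \<open>The state estimate\<close>

text \<open>\<open>y\<close> is one sample path of the output and \<open>\<theta>\<close> one of the filter's internal state.\<close>

definition state_estimate :: "alise \<Rightarrow> (real \<Rightarrow> rvec) \<Rightarrow> (real \<Rightarrow> rvec) \<Rightarrow> real \<Rightarrow> rvec" where
  "state_estimate Z y \<theta> t =
     G2 Z t *\<^sub>v (M2 Z t *\<^sub>v (T2 Z t *\<^sub>v y t)) - G2 Z t *\<^sub>v (M2 Z t *\<^sub>v (D2 Z t *\<^sub>v inp Z t)) + \<theta> t"

definition filter_path :: "alise \<Rightarrow> (real \<Rightarrow> rvec) \<Rightarrow> rvec \<Rightarrow> (real \<Rightarrow> rvec) \<Rightarrow> bool" where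
  "filter_path Z y xhat0 \<theta> \<longleftrightarrow>
     \<theta> (ti Z) = xhat0 - G2 Z (ti Z) *\<^sub>v (M2 Z (ti Z) *\<^sub>v (T2 Z (ti Z) *\<^sub>v y (ti Z)))
       + G2 Z (ti Z) *\<^sub>v (M2 Z (ti Z) *\<^sub>v (D2 Z (ti Z) *\<^sub>v inp Z (ti Z))) \<and>
     (\<forall>t\<ge>ti Z. has_vderiv (ti Z) \<theta>
        ((A_bar Z t - L_gain Z t * C2 Z t) *\<^sub>v state_estimate Z y \<theta> t
           + (B_bar Z t - L_gain Z t * D2 Z t) *\<^sub>v inp Z t
           + G_bar Z t *\<^sub>v (M1 Z t *\<^sub>v (T1 Z t *\<^sub>v y t))
           + L_gain Z t *\<^sub>v (T2 Z t *\<^sub>v y t)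
           - mderiv (ti Z) (Phi1 Z) t *\<^sub>v y t
           - mderiv (ti Z) (Phi2 Z) t *\<^sub>v inp Z t) t)"

definition filter_process ::
    "'w measure \<Rightarrow> alise \<Rightarrow> (real \<Rightarrow> 'w \<Rightarrow> rvec) \<Rightarrow> (real \<Rightarrow> 'w \<Rightarrow> rvec) \<Rightarrow> ('w \<Rightarrow> rvec)
      \<Rightarrow> (real \<Rightarrow> 'w \<Rightarrow> rvec) \<Rightarrow> bool" where
  "filter_process M Z x v xhat0 \<theta> \<longleftrightarrow>
     square_integrable M (nx Z) xhat0 \<and>
     cov_mat M (nx Z) (\<lambda>\<omega>. x (ti Z) \<omega> - xhat0 \<omega>) = P0x Z \<and>
     vector_process M (ti Z) (nx Z) \<theta> \<and>
     (\<forall>\<omega>\<in>space M. filter_path Z (\<lambda>t. measurement Z x v t \<omega>) (xhat0 \<omega>) (\<lambda>t. \<theta> t \<omega>))"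

definition estimation_error ::
    "alise \<Rightarrow> (real \<Rightarrow> 'w \<Rightarrow> rvec) \<Rightarrow> (real \<Rightarrow> 'w \<Rightarrow> rvec) \<Rightarrow> (real \<Rightarrow> 'w \<Rightarrow> rvec) \<Rightarrow> real \<Rightarrow> 'w \<Rightarrow> rvec"
  where
  "estimation_error Z x v \<theta> t \<omega> =
     x t \<omega> - state_estimate Z (\<lambda>s. measurement Z x v s \<omega>) (\<lambda>s. \<theta> s \<omega>) t"

definition bias ::
    "'w measure \<Rightarrow> alise \<Rightarrow> (real \<Rightarrow> 'w \<Rightarrow> rvec) \<Rightarrow> (real \<Rightarrow> 'w \<Rightarrow> rvec) \<Rightarrow> (real \<Rightarrow> 'w \<Rightarrow> rvec)
      \<Rightarrow> real \<Rightarrow> rvec" where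
  "bias M Z x v \<theta> t = mean_vec M (nx Z) (estimation_error Z x v \<theta> t)"

end

theory Submission
  imports Defs
begin

text \<open>
  Along every sample path the estimation error solves a linear differential equation whose matrix is
  \<open>A_breve\<close> and whose forcing term is linear in the noises \<open>w\<close>, \<open>v\<close>, \<open>v'\<close>, with deterministic
  coefficients that are continuous in time (\<open>error_ode\<close>, \<open>coefficients_continuous\<close>). The unknown input
  is absent from it: \<open>d\<^sub>1\<close> cancels because \<open>M\<^sub>1 T\<^sub>1 H = V\<^sub>1\<^sup>T\<close>, \<open>d\<^sub>2\<close> because \<open>M\<^sub>2 C\<^sub>2 G\<^sub>2 = 1\<close>, and the
  unmeasured \<open>y'\<close> enters only through \<open>T\<^sub>2 y'\<close>, in which \<open>H d\<close> has disappeared since \<open>T\<^sub>2\<close> is constant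
  and \<open>T\<^sub>2 H = 0\<close>.

  Since the noises have mean zero, the bias \<open>e\<close> should then solve \<open>e' = A_breve e\<close>. Differentiation under
  the expectation would need an integrable bound for the supremum of the noise over an interval, and
  second moments alone do not give one. Instead, the difference between the error and the
  solution of \<open>\<xi>' = A_breve \<xi>\<close> that starts at the initial bias is shown to have mean zero at all times:
  Gronwall's inequality along paths bounds its second moments, Fubini's theorem turns the pathwise
  equation into an integral equation for the mean, and that equation has only the zero solution
  (\<open>centered_solution\<close>). The same lemma, applied to the shaping filters, shows that the
  noises have mean zero and locally bounded second moments.

  What remains is deterministic. By linearity, uniform asymptotic stability gives an exponential bound
  on all solutions (\<open>exponentially_stable\<close>), so the Gramian \<open>S\<close> exists and
  \<open>V(t) = e(t)\<^sup>T S(t) e(t)\<close> is the integral of \<open>\<bar>e\<bar>\<^sup>2\<close> from \<open>t\<close> to infinity. The exponential bound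
  makes \<open>S\<close> bounded, and boundedness of \<open>A_breve\<close> keeps solutions from decaying too fast, which
  makes \<open>S\<close> uniformly positive definite. Finally \<open>V' = - \<bar>e\<bar>\<^sup>2 \<le> - V / \<lambda>\<close> with \<open>\<lambda>\<close> the supremum of the
  largest eigenvalues, so \<open>V\<close> decays at rate \<open>1 / \<lambda>\<close> and \<open>\<bar>e\<bar>\<close> at half that rate (\<open>solution_decay\<close>).
  That the extreme eigenvalues of \<open>S\<close> bound its quadratic form is proved in \<open>Rayleigh_bounds\<close>.
\<close>

section \<open>Functions on a half line\<close>

lemma nonincreasing_on_halfline:
  fixes g :: "real \<Rightarrow> real"
  assumes der: "\<And>s. a \<le> s \<Longrightarrow> s \<le> t \<Longrightarrow> (g has_real_derivative g' s) (at s within {a..})"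
    and le: "\<And>s. a \<le> s \<Longrightarrow> s \<le> t \<Longrightarrow> g' s \<le> 0" and "a \<le> t"
  shows "g t \<le> g a"
proof (rule DERIV_nonpos_imp_decreasing_open[OF \<open>a \<le> t\<close>])
  fix s assume s: "a < s" "s < t"
  have "(g has_real_derivative g' s) (at s)"
    using der[of s] s at_within_interior[of s "{a..}"] by (simp add: interior_real_atLeast)
  then show "\<exists>y. DERIV g s :> y \<and> y \<le> 0" using le[of s] s by auto
next
  show "continuous_on {a..t} g"
    unfolding continuous_on_eq_continuous_within
  proof
    fix s assume "s \<in> {a..t}"
    then have "continuous (at s within {a..}) g" using der[of s] by (auto intro: DERIV_continuous)
    then show "continuous (at s within {a..t}) g" by (rule continuous_within_subset) auto
  qed
qed

lemma continuous_on_halfline_of_deriv: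
  fixes g :: "real \<Rightarrow> real"
  assumes "\<And>s. a \<le> s \<Longrightarrow> (g has_real_derivative g' s) (at s within {a..})"
  shows "continuous_on {a..} g"
  unfolding continuous_on_eq_continuous_within using assms DERIV_continuous by fastforce

text \<open>
  Near \<open>t\<close> the half line coincides with a compact interval, to which the fundamental theorem applies.
\<close>

lemma integral_deriv_on_halfline:
  fixes g :: "real \<Rightarrow> real"
  assumes "continuous_on {a..} g" and "a \<le> t"
  shows "((\<lambda>u. integral {a..u} g) has_real_derivative g t) (at t within {a..})"
proof -
  have "((\<lambda>u. integral {a..u} g) has_real_derivative g t) (at t within {a..t+1})"
    using assms by (intro integral_has_real_derivative) (auto intro: continuous_on_subset)
  moreover have "at t within {a..t+1} = at t within {a..}"
    by (rule at_within_nhd[of _ "{t-1<..<t+1}"]) auto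
  ultimately show ?thesis by simp
qed

lemma deriv_cong_halfline:
  fixes f g :: "real \<Rightarrow> real"
  assumes "(g has_real_derivative D) (at t within {a..})" "a \<le> t" "\<And>s. a \<le> s \<Longrightarrow> f s = g s"
  shows "(f has_real_derivative D) (at t within {a..})"
  by (rule has_field_derivative_transform_within[OF assms(1), of 1]) (use assms(2,3) in auto)

lemma at_within_halfline_nontrivial:
  fixes a t :: real
  assumes "a \<le> t" shows "at t within {a..} \<noteq> bot"
proof
  assume "at t within {a..} = bot"
  moreover have "at_right t \<le> at t within {a..}" using assms by (intro at_le) auto
  ultimately have "at_right t = bot" by (metis bot.extremum_uniqueI)
  then show False using trivial_limit_at_right_real[of t] by simp
qed

text \<open>
  From \<open>2 \<bar>y\<^sub>i y\<^sub>j\<bar> \<le> y\<^sub>i\<^sup>2 + y\<^sub>j\<^sup>2\<close>; an entrywise bound on the matrix is enough, so no operator norm has to be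
  introduced.
\<close>

lemma quadratic_form_bound:
  fixes A :: "nat \<Rightarrow> nat \<Rightarrow> real"
  assumes "\<And>i j. i < n \<Longrightarrow> j < n \<Longrightarrow> \<bar>A i j\<bar> \<le> K"
  shows "\<bar>\<Sum>i<n. y i * (\<Sum>j<n. A i j * y j)\<bar> \<le> real n * K * (\<Sum>i<n. (y i)\<^sup>2)"
proof -
  have "\<bar>\<Sum>i<n. y i * (\<Sum>j<n. A i j * y j)\<bar> \<le> (\<Sum>i<n. \<Sum>j<n. \<bar>y i * (A i j * y j)\<bar>)"
    unfolding sum_distrib_left by (rule order_trans[OF sum_abs], intro sum_mono, rule sum_abs)
  also have "\<dots> \<le> (\<Sum>i<n. \<Sum>j<n. K * (((y i)\<^sup>2 + (y j)\<^sup>2) / 2))"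
  proof (intro sum_mono)
    fix i j assume "i \<in> {..<n}" "j \<in> {..<n}"
    then have A: "\<bar>A i j\<bar> \<le> K" using assms by auto
    have "\<bar>y i\<bar> * \<bar>y j\<bar> \<le> ((y i)\<^sup>2 + (y j)\<^sup>2) / 2"
      using sum_squares_bound[of "\<bar>y i\<bar>" "\<bar>y j\<bar>"] by simp
    then have "\<bar>A i j\<bar> * (\<bar>y i\<bar> * \<bar>y j\<bar>) \<le> K * (((y i)\<^sup>2 + (y j)\<^sup>2) / 2)"
      using A by (intro mult_mono) auto
    then show "\<bar>y i * (A i j * y j)\<bar> \<le> K * (((y i)\<^sup>2 + (y j)\<^sup>2) / 2)"
      by (simp add: abs_mult mult_ac)
  qed
  also have "\<dots> = K / 2 * ((\<Sum>i<n. \<Sum>j<n. (y i)\<^sup>2) + (\<Sum>i<n. \<Sum>j<n. (y j)\<^sup>2))"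
    unfolding sum.distrib[symmetric] sum_distrib_left by (simp add: field_simps)
  also have "\<dots> = real n * K * (\<Sum>i<n. (y i)\<^sup>2)"
    by (simp add: sum_distrib_left[symmetric])
  finally show ?thesis .
qed

section \<open>Linear time-varying systems in coordinates\<close>

text \<open>
  The bound \<open>K\<close> on the coefficients is what the energy estimates below use, and these estimates give
  uniqueness of solutions. In coordinates, a solution may as well be a sample path of a random one.
\<close>

locale linear_system =
  fixes a :: real and n :: nat and A :: "real \<Rightarrow> nat \<Rightarrow> nat \<Rightarrow> real" and K :: real
  assumes A_bound: "\<And>t i j. a \<le> t \<Longrightarrow> i < n \<Longrightarrow> j < n \<Longrightarrow> \<bar>A t i j\<bar> \<le> K"
begin

definition solves :: "real \<Rightarrow> (nat \<Rightarrow> real \<Rightarrow> real) \<Rightarrow> (nat \<Rightarrow> real \<Rightarrow> real) \<Rightarrow> bool" where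
  "solves s f y \<longleftrightarrow> (\<forall>t\<ge>s. \<forall>i<n.
     (y i has_real_derivative (\<Sum>j<n. A t i j * y j t) + f i t) (at t within {s..}))"

lemma energy_deriv:
  assumes "solves s f y" and "s \<le> t"
  shows "((\<lambda>t. \<Sum>i<n. (y i t)\<^sup>2) has_real_derivative
     2 * (\<Sum>i<n. y i t * (\<Sum>j<n. A t i j * y j t)) + 2 * (\<Sum>i<n. y i t * f i t)) (at t within {s..})"
proof -
  have "((\<lambda>t. \<Sum>i<n. (y i t)\<^sup>2) has_real_derivative
      (\<Sum>i<n. 2 * y i t * ((\<Sum>j<n. A t i j * y j t) + f i t))) (at t within {s..})"
  proof (rule DERIV_sum)
    fix i assume "i \<in> {..<n}"
    then have "(y i has_real_derivative (\<Sum>j<n. A t i j * y j t) + f i t) (at t within {s..})"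
      using assms unfolding solves_def by auto
    then show "((\<lambda>t. (y i t)\<^sup>2) has_real_derivative
        2 * y i t * ((\<Sum>j<n. A t i j * y j t) + f i t)) (at t within {s..})"
      by (rule derivative_eq_intros) simp
  qed
  also have "(\<Sum>i<n. 2 * y i t * ((\<Sum>j<n. A t i j * y j t) + f i t)) =
      2 * (\<Sum>i<n. y i t * (\<Sum>j<n. A t i j * y j t)) + 2 * (\<Sum>i<n. y i t * f i t)"
    by (simp add: distrib_left sum.distrib sum_distrib_left mult.assoc)
  finally show ?thesis .
qed

text \<open>
  Gronwall's inequality for the energy \<open>V = \<Sum> y\<^sub>i\<^sup>2\<close>, which satisfies
  \<open>V' \<le> (2 n \<bar>K\<bar> + 1) V + \<Sum> f\<^sub>i\<^sup>2\<close>. The squares of the forcing term are what second moments control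
  when the forcing is random.
\<close>

lemma energy_growth:
  assumes sol: "solves s f y" and "a \<le> s" and "s \<le> t"
    and cf: "\<And>i. i < n \<Longrightarrow> continuous_on {s..} (f i)"
  shows "(\<Sum>i<n. (y i t)\<^sup>2) \<le> exp ((2 * real n * \<bar>K\<bar> + 1) * (t - s)) *
     ((\<Sum>i<n. (y i s)\<^sup>2) + integral {s..t} (\<lambda>r. \<Sum>i<n. (f i r)\<^sup>2))"
proof -
  \<comment> \<open>The summand 1 absorbs the cross term \<open>2 y f \<le> y\<^sup>2 + f\<^sup>2\<close>.\<close>
  define c where "c = 2 * real n * \<bar>K\<bar> + 1"
  define V where "V = (\<lambda>t. \<Sum>i<n. (y i t)\<^sup>2)"
  define F where "F = (\<lambda>t. \<Sum>i<n. (f i t)\<^sup>2)"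
  define D where "D = (\<lambda>t. 2 * (\<Sum>i<n. y i t * (\<Sum>j<n. A t i j * y j t)) + 2 * (\<Sum>i<n. y i t * f i t))"
  have dV: "(V has_real_derivative D r) (at r within {s..})" if "s \<le> r" for r
    using energy_deriv[OF sol that] unfolding V_def D_def .
  have D_le: "D r \<le> c * V r + F r" if "s \<le> r" for r
  proof -
    have "\<bar>\<Sum>i<n. y i r * (\<Sum>j<n. A r i j * y j r)\<bar> \<le> real n * \<bar>K\<bar> * V r"
      unfolding V_def using A_bound[of r] that \<open>a \<le> s\<close>
      by (intro quadratic_form_bound) (meson abs_ge_self order_trans)
    moreover have "2 * (\<Sum>i<n. y i r * f i r) \<le> V r + F r"
      unfolding V_def F_def sum_distrib_left sum.distrib[symmetric]
      by (intro sum_mono) (metis mult.assoc sum_squares_bound)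
    ultimately show ?thesis unfolding D_def c_def by (simp add: algebra_simps)
  qed
  have cF: "continuous_on {s..} F" unfolding F_def using cf by (intro continuous_intros) auto
  define g where "g = (\<lambda>r. exp (- c * (r - s)) * V r - integral {s..r} F)"
  have "g t \<le> g s"
  proof (rule nonincreasing_on_halfline[where g = g and
        g' = "\<lambda>r. exp (- c * (r - s)) * (D r - c * V r) - F r"])
    fix r assume r: "s \<le> r" "r \<le> t"
    show "(g has_real_derivative exp (- c * (r - s)) * (D r - c * V r) - F r) (at r within {s..})"
      unfolding g_def
      by (rule derivative_eq_intros dV integral_deriv_on_halfline cF r refl)+ (simp add: algebra_simps)
    have Fn: "0 \<le> F r" unfolding F_def by (simp add: sum_nonneg)
    have cn: "0 \<le> c" unfolding c_def by simp
    have "exp (- c * (r - s)) * (D r - c * V r) \<le> exp (- c * (r - s)) * F r"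
      using D_le[OF r(1)] by (intro mult_left_mono) auto
    also have "\<dots> \<le> 1 * F r" using Fn cn r by (intro mult_right_mono) auto
    finally show "exp (- c * (r - s)) * (D r - c * V r) - F r \<le> 0" by simp
  qed (fact \<open>s \<le> t\<close>)
  then have "exp (- c * (t - s)) * V t \<le> V s + integral {s..t} F" by (simp add: g_def)
  then have "exp (c * (t - s)) * (exp (- c * (t - s)) * V t) \<le> exp (c * (t - s)) * (V s + integral {s..t} F)"
    by (intro mult_left_mono) auto
  also have "exp (c * (t - s)) * (exp (- c * (t - s)) * V t) = V t"
    by (simp add: mult_exp_exp mult.assoc[symmetric])
  finally show ?thesis unfolding V_def F_def c_def .
qed

text \<open>
  The same derivative estimate read backwards: a solution of a system with bounded coefficients cannot
  decay faster than exponentially. This makes the Gramian uniformly positive definite.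
\<close>

lemma energy_decay_bound:
  assumes sol: "solves s (\<lambda>_ _. 0) y" and "a \<le> s" and "s \<le> t"
  shows "exp (- (2 * real n * \<bar>K\<bar> + 1) * (t - s)) * (\<Sum>i<n. (y i s)\<^sup>2) \<le> (\<Sum>i<n. (y i t)\<^sup>2)"
proof -
  define c where "c = 2 * real n * \<bar>K\<bar> + 1"
  define V where "V = (\<lambda>t. \<Sum>i<n. (y i t)\<^sup>2)"
  define D where "D = (\<lambda>t. 2 * (\<Sum>i<n. y i t * (\<Sum>j<n. A t i j * y j t)))"
  have dV: "(V has_real_derivative D r) (at r within {s..})" if "s \<le> r" for r
    using energy_deriv[OF sol that] unfolding V_def D_def by simp
  define g where "g = (\<lambda>r. - (exp (c * (r - s)) * V r))"
  have "g t \<le> g s"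
  proof (rule nonincreasing_on_halfline[where g = g and
        g' = "\<lambda>r. - (exp (c * (r - s)) * (D r + c * V r))"])
    fix r assume r: "s \<le> r" "r \<le> t"
    show "(g has_real_derivative - (exp (c * (r - s)) * (D r + c * V r))) (at r within {s..})"
      unfolding g_def
      by (rule derivative_eq_intros dV r refl)+ (simp add: algebra_simps)
    have "\<bar>\<Sum>i<n. y i r * (\<Sum>j<n. A r i j * y j r)\<bar> \<le> real n * \<bar>K\<bar> * V r"
      unfolding V_def using A_bound[of r] r \<open>a \<le> s\<close>
      by (intro quadratic_form_bound) (meson abs_ge_self order_trans)
    moreover have "0 \<le> V r" unfolding V_def by (simp add: sum_nonneg)
    ultimately have "0 \<le> D r + c * V r" unfolding D_def c_def by (simp add: algebra_simps)
    then show "- (exp (c * (r - s)) * (D r + c * V r)) \<le> 0" by simp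
  qed (fact \<open>s \<le> t\<close>)
  then have "V s \<le> exp (c * (t - s)) * V t" by (simp add: g_def)
  then have "exp (- c * (t - s)) * V s \<le> exp (- c * (t - s)) * (exp (c * (t - s)) * V t)"
    by (intro mult_left_mono) auto
  also have "\<dots> = V t" by (simp add: mult_exp_exp mult.assoc[symmetric])
  finally show ?thesis unfolding V_def c_def .
qed

lemma solves_diff:
  assumes "solves s f y" "solves s g z"
  shows "solves s (\<lambda>i t. f i t - g i t) (\<lambda>i t. y i t - z i t)"
  using assms unfolding solves_def
  by (auto intro!: derivative_eq_intros simp: sum_subtractf algebra_simps)

lemma solution_unique:
  assumes "solves s f y" "solves s f z" and "a \<le> s" "s \<le> t"
    and init: "\<And>i. i < n \<Longrightarrow> y i s = z i s" and "i < n"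
  shows "y i t = z i t"
proof -
  have "solves s (\<lambda>_ _. 0) (\<lambda>i t. y i t - z i t)" using solves_diff[OF assms(1,2)] by simp
  from energy_growth[OF this \<open>a \<le> s\<close> \<open>s \<le> t\<close>]
  have "(\<Sum>i<n. (y i t - z i t)\<^sup>2) \<le> 0" using init by simp
  moreover have "(y i t - z i t)\<^sup>2 \<le> (\<Sum>i<n. (y i t - z i t)\<^sup>2)"
    using \<open>i < n\<close> by (intro member_le_sum) auto
  ultimately have "(y i t - z i t)\<^sup>2 \<le> 0" by linarith
  then show ?thesis by simp
qed

end

section \<open>Expectations of pathwise integrals\<close>

text \<open>
  The time argument is rounded to the grid of step \<open>1 / (k + 1)\<close>; the rounded process is a countable
  patchwork of random variables, and it converges to \<open>h\<close> by continuity of the paths. The maximum with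
  \<open>a\<close> extends the process to the whole line.
\<close>

lemma jointly_measurable_continuous_paths:
  fixes h :: "real \<Rightarrow> 'w \<Rightarrow> real"
  assumes meas: "\<And>t. a \<le> t \<Longrightarrow> h t \<in> borel_measurable M"
    and cont: "\<And>\<omega>. \<omega> \<in> space M \<Longrightarrow> continuous_on {a..} (\<lambda>t. h t \<omega>)"
  shows "(\<lambda>(s, \<omega>). h (max a s) \<omega>) \<in> borel_measurable (borel \<Otimes>\<^sub>M M)"
proof -
  define r where "r = (\<lambda>(k::nat) (s::real). of_int \<lfloor>real (Suc k) * s\<rfloor> / real (Suc k))"
  show ?thesis
  proof (rule borel_measurable_LIMSEQ_real[where u = "\<lambda>k (s, \<omega>). h (max a (r k s)) \<omega>"])
  show "(\<lambda>(s, \<omega>). h (max a (r k s)) \<omega>) \<in> borel_measurable (borel \<Otimes>\<^sub>M M)" for k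
  proof -
    have "(\<lambda>x. (\<lambda>i x. h (max a (of_int i / real (Suc k))) (snd x)) \<lfloor>real (Suc k) * fst x\<rfloor> x)
        \<in> borel_measurable (borel \<Otimes>\<^sub>M M)"
    proof (rule measurable_compose_countable[where
          f = "\<lambda>i x. h (max a (of_int i / real (Suc k))) (snd x)" and
          g = "\<lambda>x. \<lfloor>real (Suc k) * fst x\<rfloor>"])
      show "(\<lambda>x. h (max a (of_int i / real (Suc k))) (snd x)) \<in> borel_measurable (borel \<Otimes>\<^sub>M M)" for i
        by (rule measurable_compose[OF measurable_snd meas]) simp
      show "(\<lambda>x. \<lfloor>real (Suc k) * fst x\<rfloor>) \<in> measurable (borel \<Otimes>\<^sub>M M) (count_space UNIV)"
        by measurable
    qed
    then show ?thesis by (simp add: r_def case_prod_beta)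
  qed
  fix x :: "real \<times> 'w" assume "x \<in> space (borel \<Otimes>\<^sub>M M)"
  then obtain s \<omega> where x: "x = (s, \<omega>)" "\<omega> \<in> space M" by (auto simp: space_pair_measure)
  have "(\<lambda>k. r k s) \<longlonglongrightarrow> s"
  proof (rule real_tendsto_sandwich)
    show "\<forall>\<^sub>F k in sequentially. s - inverse (real (Suc k)) \<le> r k s"
    proof (intro always_eventually allI)
      fix k
      have "real (Suc k) * s \<le> of_int \<lfloor>real (Suc k) * s\<rfloor> + 1" by linarith
      then have "real (Suc k) * s / real (Suc k) \<le> (of_int \<lfloor>real (Suc k) * s\<rfloor> + 1) / real (Suc k)"
        by (intro divide_right_mono) auto
      moreover have "real (Suc k) * s / real (Suc k) = s" by simp
      ultimately show "s - inverse (real (Suc k)) \<le> r k s"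
        unfolding r_def by (simp only: add_divide_distrib inverse_eq_divide)
    qed
    show "\<forall>\<^sub>F k in sequentially. r k s \<le> s"
    proof (intro always_eventually allI)
      fix k
      have "of_int \<lfloor>real (Suc k) * s\<rfloor> / real (Suc k) \<le> real (Suc k) * s / real (Suc k)"
        by (intro divide_right_mono) auto
      then show "r k s \<le> s" unfolding r_def by simp
    qed
    show "(\<lambda>k. s - inverse (real (Suc k))) \<longlonglongrightarrow> s"
      using tendsto_diff[OF tendsto_const LIMSEQ_inverse_real_of_nat] by fastforce
  qed simp
  then have "(\<lambda>k. max a (r k s)) \<longlonglongrightarrow> max a s" by (intro tendsto_intros)
  then have "(\<lambda>k. h (max a (r k s)) \<omega>) \<longlonglongrightarrow> h (max a s) \<omega>"
    by (intro continuous_on_tendsto_compose[OF cont[OF x(2)]]) auto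
  then show "(\<lambda>k. case x of (s, \<omega>) \<Rightarrow> h (max a (r k s)) \<omega>) \<longlonglongrightarrow> (case x of (s, \<omega>) \<Rightarrow> h (max a s) \<omega>)"
    by (simp add: x)
  qed
qed

context prob_space
begin

text \<open>
  A uniform bound on the first absolute moments makes the process integrable over the product of the
  interval with the probability space.
\<close>

lemma fubini_interval:
  fixes g :: "real \<Rightarrow> 'a \<Rightarrow> real"
  assumes jm: "(\<lambda>(s, \<omega>). indicator {a..t} s * g s \<omega>) \<in> borel_measurable (lborel \<Otimes>\<^sub>M M)"
    and int: "\<And>s. s \<in> {a..t} \<Longrightarrow> integrable M (g s)"
    and bound: "\<And>s. s \<in> {a..t} \<Longrightarrow> expectation (\<lambda>\<omega>. \<bar>g s \<omega>\<bar>) \<le> B"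
  shows "AE \<omega> in M. set_integrable lborel {a..t} (\<lambda>s. g s \<omega>)"
    and "integrable M (\<lambda>\<omega>. LINT s:{a..t}|lborel. g s \<omega>)"
    and "set_integrable lborel {a..t} (\<lambda>s. expectation (g s))"
    and "expectation (\<lambda>\<omega>. LINT s:{a..t}|lborel. g s \<omega>) = (LINT s:{a..t}|lborel. expectation (g s))"
proof -
  interpret P: pair_sigma_finite lborel M ..
  define G where "G = (\<lambda>(s, \<omega>). indicator {a..t} s * g s \<omega>)"
  have [measurable]: "G \<in> borel_measurable (lborel \<Otimes>\<^sub>M M)" using jm by (simp add: G_def)
  have G: "integrable (lborel \<Otimes>\<^sub>M M) G"
  proof (rule P.Fubini_integrable)
    show "integrable lborel (\<lambda>s. LINT \<omega>|M. norm (G (s, \<omega>)))"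
    proof (rule Bochner_Integration.integrable_bound)
      show "integrable lborel (\<lambda>s. indicator {a..t} s * B)"
        using borel_integrable_atLeastAtMost'[OF continuous_on_const, of a t B]
        by (simp add: set_integrable_def)
      show "AE s in lborel. norm (LINT \<omega>|M. norm (G (s, \<omega>))) \<le> norm (indicator {a..t} s * B)"
      proof (rule AE_I2)
        fix s
        show "norm (LINT \<omega>|M. norm (G (s, \<omega>))) \<le> norm (indicator {a..t} s * B)"
        proof (cases "s \<in> {a..t}")
          case True
          then have "\<bar>LINT \<omega>|M. \<bar>g s \<omega>\<bar>\<bar> \<le> \<bar>B\<bar>" using bound[OF True] by simp
          then show ?thesis using True by (simp add: G_def)
        qed (simp add: G_def)
      qed
    qed measurable
    show "AE s in lborel. integrable M (\<lambda>\<omega>. G (s, \<omega>))"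
    proof (rule AE_I2)
      fix s show "integrable M (\<lambda>\<omega>. G (s, \<omega>))"
        using int[of s] by (cases "s \<in> {a..t}") (auto simp: G_def)
    qed
  qed measurable
  have G': "integrable (lborel \<Otimes>\<^sub>M M) (\<lambda>(s, \<omega>). G (s, \<omega>))" using G by simp
  show "AE \<omega> in M. set_integrable lborel {a..t} (\<lambda>s. g s \<omega>)"
    using P.AE_integrable_snd[OF G'] by (simp add: set_integrable_def G_def)
  show "integrable M (\<lambda>\<omega>. LINT s:{a..t}|lborel. g s \<omega>)"
    using P.integrable_snd[OF G'] by (simp add: set_lebesgue_integral_def G_def)
  have "integrable lborel (\<lambda>s. LINT \<omega>|M. indicator {a..t} s * g s \<omega>)"
    using P.integrable_fst[OF G'] by (simp add: G_def)
  then show "set_integrable lborel {a..t} (\<lambda>s. expectation (g s))"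
    by (simp add: set_integrable_def)
  have "(LINT \<omega>|M. LINT s|lborel. G (s, \<omega>)) = (LINT s|lborel. LINT \<omega>|M. G (s, \<omega>))"
    by (rule P.Fubini_integral[OF G'])
  then show "expectation (\<lambda>\<omega>. LINT s:{a..t}|lborel. g s \<omega>) = (LINT s:{a..t}|lborel. expectation (g s))"
    by (simp add: set_lebesgue_integral_def G_def)
qed

lemma mean_integral_of_process:
  fixes h :: "real \<Rightarrow> 'a \<Rightarrow> real"
  assumes meas: "\<And>s. a \<le> s \<Longrightarrow> h s \<in> borel_measurable M"
    and cont: "\<And>\<omega>. \<omega> \<in> space M \<Longrightarrow> continuous_on {a..} (\<lambda>s. h s \<omega>)"
    and int: "\<And>s. s \<in> {a..t} \<Longrightarrow> integrable M (h s)"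
    and bound: "\<And>s. s \<in> {a..t} \<Longrightarrow> expectation (\<lambda>\<omega>. \<bar>h s \<omega>\<bar>) \<le> B"
    and "a \<le> t"
  shows "integrable M (\<lambda>\<omega>. integral {a..t} (\<lambda>s. h s \<omega>))"
    and "expectation (\<lambda>\<omega>. integral {a..t} (\<lambda>s. h s \<omega>)) \<le> B * (t - a)"
proof -
  have "(\<lambda>(s, \<omega>). h (max a s) \<omega>) \<in> borel_measurable (borel \<Otimes>\<^sub>M M)"
    by (rule jointly_measurable_continuous_paths[OF meas cont])
  then have "(\<lambda>x. indicator {a..t} (fst x) * (case x of (s, \<omega>) \<Rightarrow> h (max a s) \<omega>)) \<in> borel_measurable (borel \<Otimes>\<^sub>M M)"
    by measurable
  also have "(\<lambda>x. indicator {a..t} (fst x) * (case x of (s, \<omega>) \<Rightarrow> h (max a s) \<omega>)) = (\<lambda>(s, \<omega>). indicator {a..t} s * h s \<omega>)"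
    by (auto simp: fun_eq_iff indicator_def max_def)
  also have "borel_measurable (borel \<Otimes>\<^sub>M M) = borel_measurable (lborel \<Otimes>\<^sub>M M)"
    by (intro measurable_cong_sets sets_pair_measure_cong) auto
  finally have jm: "(\<lambda>(s, \<omega>). indicator {a..t} s * h s \<omega>) \<in> borel_measurable (lborel \<Otimes>\<^sub>M M)" .
  note F = fubini_interval[OF jm int bound]
  have eq: "integral {a..t} (\<lambda>s. h s \<omega>) = (LINT s:{a..t}|lborel. h s \<omega>)" if "\<omega> \<in> space M" for \<omega>
  proof (rule set_borel_integral_eq_integral(2)[symmetric])
    show "set_integrable lborel {a..t} (\<lambda>s. h s \<omega>)"
      by (intro borel_integrable_compact continuous_on_subset[OF cont[OF that]]
          borel_integrable_atLeastAtMost') auto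
  qed
  show "integrable M (\<lambda>\<omega>. integral {a..t} (\<lambda>s. h s \<omega>))"
    using F(2) eq by (subst Bochner_Integration.integrable_cong[OF refl eq]) auto
  have "expectation (\<lambda>\<omega>. integral {a..t} (\<lambda>s. h s \<omega>)) = (LINT s:{a..t}|lborel. expectation (h s))"
    using F(4) eq by (simp cong: Bochner_Integration.integral_cong)
  also have "\<dots> \<le> (LINT s:{a..t}|lborel. B)"
  proof (rule set_integral_mono[OF F(3)])
    show "set_integrable lborel {a..t} (\<lambda>s. B)"
      by (intro borel_integrable_atLeastAtMost' continuous_on_const)
    fix s assume s: "s \<in> {a..t}"
    have "expectation (h s) \<le> expectation (\<lambda>\<omega>. \<bar>h s \<omega>\<bar>)"
      by (intro integral_mono int[OF s] integrable_abs) auto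
    then show "expectation (h s) \<le> B" using bound[OF s] by simp
  qed
  also have "\<dots> = B * (t - a)" using \<open>a \<le> t\<close> by (simp add: set_lebesgue_integral_def)
  finally show "expectation (\<lambda>\<omega>. integral {a..t} (\<lambda>s. h s \<omega>)) \<le> B * (t - a)" .
qed

text \<open>
  The expectation of the pathwise fundamental theorem of calculus. Joint measurability of \<open>g\<close> in time
  and chance comes from writing \<open>g\<close> as a limit of difference quotients of the path-continuous process
  \<open>Y\<close>; a matrix \<open>A(t)\<close> whose dependence on \<open>t\<close> is merely bounded may therefore occur in \<open>g\<close>.
\<close>

lemma mean_of_derivative:
  fixes Y g :: "real \<Rightarrow> 'a \<Rightarrow> real"
  assumes meas: "\<And>s. a \<le> s \<Longrightarrow> Y s \<in> borel_measurable M"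
    and der: "\<And>s \<omega>. a \<le> s \<Longrightarrow> \<omega> \<in> space M \<Longrightarrow> ((\<lambda>s. Y s \<omega>) has_real_derivative g s \<omega>) (at s within {a..})"
    and int: "\<And>s. s \<in> {a..t} \<Longrightarrow> integrable M (g s)"
    and bound: "\<And>s. s \<in> {a..t} \<Longrightarrow> expectation (\<lambda>\<omega>. \<bar>g s \<omega>\<bar>) \<le> B"
    and inta: "integrable M (Y a)" and "a \<le> t"
  shows "set_integrable lborel {a..t} (\<lambda>s. expectation (g s))"
    and "expectation (Y t) = expectation (Y a) + (LINT s:{a..t}|lborel. expectation (g s))"
proof -
  have cont: "continuous_on {a..} (\<lambda>s. Y s \<omega>)" if "\<omega> \<in> space M" for \<omega>
    using der that by (intro continuous_on_halfline_of_deriv) auto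
  have "(\<lambda>(s, \<omega>). Y (max a s) \<omega>) \<in> borel_measurable (borel \<Otimes>\<^sub>M M)"
    by (rule jointly_measurable_continuous_paths[OF meas cont])
  then have Ym: "(\<lambda>x. Y (max a (fst x)) (snd x)) \<in> borel_measurable (borel \<Otimes>\<^sub>M M)"
    by (simp add: case_prod_beta)
  have "(\<lambda>x. indicator {a..t} (fst x) * g (fst x) (snd x)) \<in> borel_measurable (borel \<Otimes>\<^sub>M M)"
  proof (rule borel_measurable_LIMSEQ_real)
    define Q where "Q = (\<lambda>k x. indicator {a..t} (fst x) *
      ((Y (max a (fst x + inverse (real (Suc k)))) (snd x) - Y (max a (fst x)) (snd x))
        / inverse (real (Suc k))))"
    fix k
    have "(\<lambda>x. Y (max a (fst (fst x + inverse (real (Suc k)), snd x))) (snd (fst x + inverse (real (Suc k)), snd x)))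
        \<in> borel_measurable (borel \<Otimes>\<^sub>M M)"
      by (rule measurable_compose[OF _ Ym]) measurable
    then have sm: "(\<lambda>x. Y (max a (fst x + inverse (real (Suc k)))) (snd x)) \<in> borel_measurable (borel \<Otimes>\<^sub>M M)"
      by simp
    have im: "(\<lambda>x. indicator {a..t} (fst x) :: real) \<in> borel_measurable (borel \<Otimes>\<^sub>M M)" by measurable
    show "Q k \<in> borel_measurable (borel \<Otimes>\<^sub>M M)"
      unfolding Q_def by (intro borel_measurable_times borel_measurable_divide borel_measurable_diff
          borel_measurable_const sm im Ym)
  next
    fix x :: "real \<times> 'a" assume "x \<in> space (borel \<Otimes>\<^sub>M M)"
    then obtain s \<omega> where x: "x = (s, \<omega>)" "\<omega> \<in> space M" by (auto simp: space_pair_measure)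
    show "(\<lambda>k. indicator {a..t} (fst x) *
      ((Y (max a (fst x + inverse (real (Suc k)))) (snd x) - Y (max a (fst x)) (snd x))
        / inverse (real (Suc k)))) \<longlonglongrightarrow> indicator {a..t} (fst x) * g (fst x) (snd x)"
    proof (cases "s \<in> {a..t}")
      case True
      have "((\<lambda>r. (Y r \<omega> - Y s \<omega>) / (r - s)) \<longlongrightarrow> g s \<omega>) (at s within {a..})"
        using der[of s \<omega>] True x by (simp add: has_field_derivative_iff)
      moreover have "filterlim (\<lambda>k. s + inverse (real (Suc k))) (at s within {a..}) sequentially"
        unfolding filterlim_at
      proof
        show "\<forall>\<^sub>F k in sequentially. s + inverse (real (Suc k)) \<in> {a..} \<and> s + inverse (real (Suc k)) \<noteq> s"
          using True by (intro always_eventually) (auto intro: add_increasing2)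
        show "(\<lambda>k. s + inverse (real (Suc k))) \<longlonglongrightarrow> s"
          using tendsto_add[OF tendsto_const LIMSEQ_inverse_real_of_nat] by fastforce
      qed
      ultimately have "(\<lambda>k. (Y (s + inverse (real (Suc k))) \<omega> - Y s \<omega>) / (s + inverse (real (Suc k)) - s)) \<longlonglongrightarrow> g s \<omega>"
        by (rule filterlim_compose)
      moreover have "max a (s + inverse (real (Suc k))) = s + inverse (real (Suc k))" "max a s = s" for k
        using True by (auto simp: max_def) (smt (verit) of_nat_0_le_iff positive_imp_inverse_positive of_nat_0_less_iff zero_less_Suc)
      ultimately show ?thesis using True by (simp add: x)
    qed (simp add: x)
  qed
  also have "borel_measurable (borel \<Otimes>\<^sub>M M) = borel_measurable (lborel \<Otimes>\<^sub>M M)"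
    by (intro measurable_cong_sets sets_pair_measure_cong) auto
  finally have jm: "(\<lambda>(s, \<omega>). indicator {a..t} s * g s \<omega>) \<in> borel_measurable (lborel \<Otimes>\<^sub>M M)"
    by (simp add: case_prod_beta)
  note F = fubini_interval[OF jm int bound]
  show "set_integrable lborel {a..t} (\<lambda>s. expectation (g s))" by (rule F(3))
  have ae: "AE \<omega> in M. Y t \<omega> = Y a \<omega> + (LINT s:{a..t}|lborel. g s \<omega>)"
  proof (rule AE_mp[of "\<lambda>\<omega>. set_integrable lborel {a..t} (\<lambda>s. g s \<omega>)"], rule F(1), assumption, assumption, intro AE_I2 impI)
    fix \<omega> assume w: "\<omega> \<in> space M" and si: "set_integrable lborel {a..t} (\<lambda>s. g s \<omega>)"
    have "((\<lambda>s. g s \<omega>) has_integral (Y t \<omega> - Y a \<omega>)) {a..t}"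
    proof (rule fundamental_theorem_of_calculus[OF \<open>a \<le> t\<close>])
      fix s assume "s \<in> {a..t}"
      then have "((\<lambda>s. Y s \<omega>) has_real_derivative g s \<omega>) (at s within {a..t})"
        using der[of s \<omega>] w by (auto intro: DERIV_subset)
      then show "((\<lambda>s. Y s \<omega>) has_vector_derivative g s \<omega>) (at s within {a..t})"
        by (simp add: has_real_derivative_iff_has_vector_derivative)
    qed
    then have "integral {a..t} (\<lambda>s. g s \<omega>) = Y t \<omega> - Y a \<omega>" by (rule integral_unique)
    then show "Y t \<omega> = Y a \<omega> + (LINT s:{a..t}|lborel. g s \<omega>)"
      using set_borel_integral_eq_integral(2)[OF si] by simp
  qed
  have "expectation (Y t) = expectation (\<lambda>\<omega>. Y a \<omega> + (LINT s:{a..t}|lborel. g s \<omega>))"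
    using meas[of t] \<open>a \<le> t\<close> ae F(2) inta by (intro integral_cong_AE) auto
  also have "\<dots> = expectation (Y a) + (LINT s:{a..t}|lborel. expectation (g s))"
    using inta F(2,4) by simp
  finally show "expectation (Y t) = expectation (Y a) + (LINT s:{a..t}|lborel. expectation (g s))" .
qed

end

section \<open>Centred processes driving a linear system\<close>

context prob_space
begin

text \<open>
  The class of noises used throughout. It is closed under the operations that occur in the error
  dynamics, and, by the lemma \<open>centered_solution\<close>, under passing to the solution of a linear system.
\<close>

definition centered_process :: "real \<Rightarrow> (real \<Rightarrow> 'a \<Rightarrow> real) \<Rightarrow> bool" where
  "centered_process a g \<longleftrightarrow>
     (\<forall>t\<ge>a. g t \<in> borel_measurable M \<and> integrable M (\<lambda>\<omega>. (g t \<omega>)\<^sup>2) \<and> expectation (g t) = 0) \<and>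
     (\<forall>\<omega>\<in>space M. continuous_on {a..} (\<lambda>t. g t \<omega>)) \<and>
     (\<forall>T. \<exists>B. \<forall>t\<in>{a..T}. expectation (\<lambda>\<omega>. (g t \<omega>)\<^sup>2) \<le> B)"

lemma mean_abs_le_mean_square:
  fixes f :: "'a \<Rightarrow> real"
  assumes "f \<in> borel_measurable M" "integrable M (\<lambda>\<omega>. (f \<omega>)\<^sup>2)"
  shows "expectation (\<lambda>\<omega>. \<bar>f \<omega>\<bar>) \<le> 1 + expectation (\<lambda>\<omega>. (f \<omega>)\<^sup>2)"
proof -
  have "expectation (\<lambda>\<omega>. \<bar>f \<omega>\<bar>) \<le> expectation (\<lambda>\<omega>. 1 + (f \<omega>)\<^sup>2)"
  proof (rule integral_mono)
    fix \<omega>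
    have "2 * \<bar>f \<omega>\<bar> \<le> 1 + (f \<omega>)\<^sup>2" using sum_squares_bound[of 1 "\<bar>f \<omega>\<bar>"] by simp
    then show "\<bar>f \<omega>\<bar> \<le> 1 + (f \<omega>)\<^sup>2" by simp
  qed (use assms square_integrable_imp_integrable[OF assms] in auto)
  also have "\<dots> = 1 + expectation (\<lambda>\<omega>. (f \<omega>)\<^sup>2)" using assms by (simp add: prob_space)
  finally show ?thesis .
qed

lemma centered_processD:
  assumes "centered_process a g" and "a \<le> t"
  shows "g t \<in> borel_measurable M" "integrable M (\<lambda>\<omega>. (g t \<omega>)\<^sup>2)" "integrable M (g t)" "expectation (g t) = 0"
proof -
  show 1: "g t \<in> borel_measurable M" "integrable M (\<lambda>\<omega>. (g t \<omega>)\<^sup>2)" "expectation (g t) = 0"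
    using assms unfolding centered_process_def by auto
  show "integrable M (g t)" using square_integrable_imp_integrable[OF 1(1,2)] .
qed

lemma centered_process_cont:
  "centered_process a g \<Longrightarrow> \<omega> \<in> space M \<Longrightarrow> continuous_on {a..} (\<lambda>t. g t \<omega>)"
  unfolding centered_process_def by auto

lemma centered_process_bound:
  assumes "centered_process a g"
  obtains B where "\<And>t. a \<le> t \<Longrightarrow> t \<le> T \<Longrightarrow> expectation (\<lambda>\<omega>. (g t \<omega>)\<^sup>2) \<le> B"
  using assms unfolding centered_process_def by (meson atLeastAtMost_iff)

lemma centered_process_zero: "centered_process a (\<lambda>_ _. 0)"
  unfolding centered_process_def by auto

lemma centered_process_add:
  assumes g: "centered_process a g" and h: "centered_process a h"
  shows "centered_process a (\<lambda>t \<omega>. g t \<omega> + h t \<omega>)"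
proof -
  have le: "(x + y)\<^sup>2 \<le> 2 * x\<^sup>2 + 2 * y\<^sup>2" for x y :: real
    using sum_squares_bound[of x y] by (simp add: power2_sum)
  have int: "integrable M (\<lambda>\<omega>. (g t \<omega> + h t \<omega>)\<^sup>2)" if t: "a \<le> t" for t
  proof (rule Bochner_Integration.integrable_bound)
    show "integrable M (\<lambda>\<omega>. 2 * (g t \<omega>)\<^sup>2 + 2 * (h t \<omega>)\<^sup>2)"
      using centered_processD(2)[OF g t] centered_processD(2)[OF h t] by simp
    show "(\<lambda>\<omega>. (g t \<omega> + h t \<omega>)\<^sup>2) \<in> borel_measurable M"
      using centered_processD(1)[OF g t] centered_processD(1)[OF h t] by simp
    show "AE \<omega> in M. norm ((g t \<omega> + h t \<omega>)\<^sup>2) \<le> norm (2 * (g t \<omega>)\<^sup>2 + 2 * (h t \<omega>)\<^sup>2)"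
      using le by (intro AE_I2) (simp add: abs_of_nonneg)
  qed
  have "\<exists>B. \<forall>t\<in>{a..T}. expectation (\<lambda>\<omega>. (g t \<omega> + h t \<omega>)\<^sup>2) \<le> B" for T
  proof -
    obtain B where B: "\<And>t. a \<le> t \<Longrightarrow> t \<le> T \<Longrightarrow> expectation (\<lambda>\<omega>. (g t \<omega>)\<^sup>2) \<le> B"
      using centered_process_bound[OF g] by blast
    obtain C where C: "\<And>t. a \<le> t \<Longrightarrow> t \<le> T \<Longrightarrow> expectation (\<lambda>\<omega>. (h t \<omega>)\<^sup>2) \<le> C"
      using centered_process_bound[OF h] by blast
    have "expectation (\<lambda>\<omega>. (g t \<omega> + h t \<omega>)\<^sup>2) \<le> 2 * B + 2 * C" if t: "a \<le> t" "t \<le> T" for t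
    proof -
      have "expectation (\<lambda>\<omega>. (g t \<omega> + h t \<omega>)\<^sup>2) \<le> expectation (\<lambda>\<omega>. 2 * (g t \<omega>)\<^sup>2 + 2 * (h t \<omega>)\<^sup>2)"
        using centered_processD(2)[OF g t(1)] centered_processD(2)[OF h t(1)] int[OF t(1)] le
        by (intro integral_mono) auto
      also have "\<dots> = 2 * expectation (\<lambda>\<omega>. (g t \<omega>)\<^sup>2) + 2 * expectation (\<lambda>\<omega>. (h t \<omega>)\<^sup>2)"
        using centered_processD(2)[OF g t(1)] centered_processD(2)[OF h t(1)] by simp
      finally show ?thesis using B[OF t] C[OF t] by simp
    qed
    then show ?thesis by (intro exI[of _ "2 * B + 2 * C"]) auto
  qed
  moreover have "(\<lambda>\<omega>. g t \<omega> + h t \<omega>) \<in> borel_measurable M \<and>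
      integrable M (\<lambda>\<omega>. (g t \<omega> + h t \<omega>)\<^sup>2) \<and> expectation (\<lambda>\<omega>. g t \<omega> + h t \<omega>) = 0"
    if t: "a \<le> t" for t
    using int[OF t] centered_processD[OF g t] centered_processD[OF h t] by auto
  moreover have "continuous_on {a..} (\<lambda>t. g t \<omega> + h t \<omega>)" if "\<omega> \<in> space M" for \<omega>
    using centered_process_cont[OF g that] centered_process_cont[OF h that] by (rule continuous_on_add)
  ultimately show ?thesis unfolding centered_process_def by blast
qed

lemma centered_process_mult:
  assumes g: "centered_process a g" and c: "continuous_on {a..} c"
  shows "centered_process a (\<lambda>t \<omega>. c t * g t \<omega>)"
proof -
  have "\<exists>B. \<forall>t\<in>{a..T}. expectation (\<lambda>\<omega>. (c t * g t \<omega>)\<^sup>2) \<le> B" for T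
  proof -
    obtain B where B: "\<And>t. a \<le> t \<Longrightarrow> t \<le> T \<Longrightarrow> expectation (\<lambda>\<omega>. (g t \<omega>)\<^sup>2) \<le> B"
      using centered_process_bound[OF g] by blast
    have "compact ((\<lambda>t. (c t)\<^sup>2) ` {a..T})"
    proof (rule compact_continuous_image[OF _ compact_Icc])
      show "continuous_on {a..T} (\<lambda>t. (c t)\<^sup>2)"
        by (rule continuous_on_power, rule continuous_on_subset[OF c]) simp
    qed
    then have "bounded ((\<lambda>t. (c t)\<^sup>2) ` {a..T})" by (rule compact_imp_bounded)
    then obtain C where C: "\<And>t. t \<in> {a..T} \<Longrightarrow> (c t)\<^sup>2 \<le> C"
      unfolding bounded_iff by (metis abs_ge_self image_eqI order_trans real_norm_def)
    have "(c t)\<^sup>2 * expectation (\<lambda>\<omega>. (g t \<omega>)\<^sup>2) \<le> C * B" if "t \<in> {a..T}" for t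
    proof (rule mult_mono)
      show "(c t)\<^sup>2 \<le> C" using C[OF that] .
      then show "0 \<le> C" by (rule order_trans[OF zero_le_power2])
    qed (use B that in auto)
    then show ?thesis by (intro exI[of _ "C * B"]) (auto simp: power_mult_distrib)
  qed
  moreover have "(\<lambda>\<omega>. c t * g t \<omega>) \<in> borel_measurable M \<and>
      integrable M (\<lambda>\<omega>. (c t * g t \<omega>)\<^sup>2) \<and> expectation (\<lambda>\<omega>. c t * g t \<omega>) = 0" if t: "a \<le> t" for t
    using centered_processD[OF g t] by (auto simp: power_mult_distrib)
  moreover have "continuous_on {a..} (\<lambda>t. c t * g t \<omega>)" if "\<omega> \<in> space M" for \<omega>
    using c centered_process_cont[OF g that] by (rule continuous_on_mult)
  ultimately show ?thesis unfolding centered_process_def by blast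
qed

lemma centered_process_uminus:
  "centered_process a g \<Longrightarrow> centered_process a (\<lambda>t \<omega>. - g t \<omega>)"
  using centered_process_mult[of a g "\<lambda>_. -1"] by simp

lemma centered_process_diff:
  "centered_process a g \<Longrightarrow> centered_process a h \<Longrightarrow> centered_process a (\<lambda>t \<omega>. g t \<omega> - h t \<omega>)"
  using centered_process_add[of a g "\<lambda>t \<omega>. - h t \<omega>"] centered_process_uminus by auto

lemma centered_process_sum:
  assumes "\<And>i. i \<in> I \<Longrightarrow> centered_process a (g i)"
  shows "centered_process a (\<lambda>t \<omega>. \<Sum>i\<in>I. g i t \<omega>)"
  using assms
proof (induction I rule: infinite_finite_induct)
  case (insert x F)
  then show ?case using centered_process_add[of a "g x" "\<lambda>t \<omega>. \<Sum>i\<in>F. g i t \<omega>"] by simp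
qed (auto intro: centered_process_zero)

lemma centered_process_cong:
  assumes "centered_process a g" and eq: "\<And>t \<omega>. a \<le> t \<Longrightarrow> \<omega> \<in> space M \<Longrightarrow> g t \<omega> = h t \<omega>"
  shows "centered_process a h"
proof -
  have m: "h t \<in> borel_measurable M \<longleftrightarrow> g t \<in> borel_measurable M" if "a \<le> t" for t
    using eq[OF that] by (intro measurable_cong) auto
  have i: "integrable M (\<lambda>\<omega>. (h t \<omega>)\<^sup>2) \<longleftrightarrow> integrable M (\<lambda>\<omega>. (g t \<omega>)\<^sup>2)" if "a \<le> t" for t
    using eq[OF that] by (intro Bochner_Integration.integrable_cong) auto
  have e: "expectation (h t) = expectation (g t)"
    "expectation (\<lambda>\<omega>. (h t \<omega>)\<^sup>2) = expectation (\<lambda>\<omega>. (g t \<omega>)\<^sup>2)" if "a \<le> t" for t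
    using eq[OF that] by (auto intro!: Bochner_Integration.integral_cong)
  have c: "continuous_on {a..} (\<lambda>t. h t \<omega>) \<longleftrightarrow> continuous_on {a..} (\<lambda>t. g t \<omega>)" if "\<omega> \<in> space M" for \<omega>
    using eq that by (intro continuous_on_cong) auto
  show ?thesis using assms(1) unfolding centered_process_def by (simp add: m i e c)
qed

end

text \<open>
  Uniqueness for an integral inequality \<open>\<bar>m(t)\<bar> \<le> K \<integral> \<Sum> \<bar>m\<^sub>j\<bar>\<close>, by inserting the bound into itself: after \<open>k\<close>
  rounds it has become \<open>B (n K (t - a))\<^sup>k / k!\<close>. The second assumption states the inequality through an
  arbitrary integrable majorant \<open>h\<close>, which makes sense for \<open>m\<close> of unknown measurability.
\<close>

lemma iterated_gronwall:
  fixes m :: "nat \<Rightarrow> real \<Rightarrow> real"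
  assumes bound: "\<And>i t. i < n \<Longrightarrow> a \<le> t \<Longrightarrow> t \<le> T \<Longrightarrow> \<bar>m i t\<bar> \<le> B"
    and step: "\<And>i t h. i < n \<Longrightarrow> a \<le> t \<Longrightarrow> t \<le> T \<Longrightarrow> set_integrable lborel {a..t} h \<Longrightarrow>
       (\<And>s. s \<in> {a..t} \<Longrightarrow> K * (\<Sum>j<n. \<bar>m j s\<bar>) \<le> h s) \<Longrightarrow> \<bar>m i t\<bar> \<le> (LINT s:{a..t}|lborel. h s)"
    and "0 \<le> K" and t: "i < n" "a \<le> t" "t \<le> T"
  shows "m i t = 0"
proof -
  define c where "c = real n * K"
  have "\<bar>m i t\<bar> \<le> B * ((c * (t - a)) ^ k / fact k)" if "i < n" "a \<le> t" "t \<le> T" for k i t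
    using that
  proof (induction k arbitrary: i t)
    case 0
    then show ?case using bound by simp
  next
    case (Suc k)
    define h where "h = (\<lambda>s. c * (B * ((c * (s - a)) ^ k / fact k)))"
    have "\<bar>m i t\<bar> \<le> (LINT s:{a..t}|lborel. h s)"
    proof (rule step[OF Suc.prems])
      show hi: "set_integrable lborel {a..t} h"
        unfolding h_def by (intro borel_integrable_atLeastAtMost' continuous_intros) auto
      fix s assume s: "s \<in> {a..t}"
      have "(\<Sum>j<n. \<bar>m j s\<bar>) \<le> (\<Sum>j<n. B * ((c * (s - a)) ^ k / fact k))"
        using Suc s by (intro sum_mono Suc.IH) auto
      then have "K * (\<Sum>j<n. \<bar>m j s\<bar>) \<le> K * (\<Sum>j<n. B * ((c * (s - a)) ^ k / fact k))"
        using \<open>0 \<le> K\<close> by (rule mult_left_mono)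
      then show "K * (\<Sum>j<n. \<bar>m j s\<bar>) \<le> h s" by (simp add: h_def c_def mult_ac)
    qed
    also have "\<dots> = integral {a..t} h"
      unfolding h_def by (intro set_borel_integral_eq_integral borel_integrable_atLeastAtMost' continuous_intros) auto
    also have "\<dots> = B * ((c * (t - a)) ^ Suc k / fact (Suc k)) - B * ((c * (a - a)) ^ Suc k / fact (Suc k))"
    proof (rule integral_unique, rule fundamental_theorem_of_calculus[OF \<open>a \<le> t\<close>])
      fix s assume "s \<in> {a..t}"
      have "((\<lambda>s. B * ((c * (s - a)) ^ Suc k / fact (Suc k))) has_real_derivative h s) (at s within {a..t})"
      proof -
        have "((\<lambda>s. (c * (s - a)) ^ Suc k) has_real_derivative real (Suc k) * (c * (s - a)) ^ k * c) (at s within {a..t})"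
          by (rule derivative_eq_intros refl)+ simp
        from DERIV_cmult[OF this, of "B / fact (Suc k)"]
        have "((\<lambda>s. B / fact (Suc k) * (c * (s - a)) ^ Suc k) has_real_derivative
            B / fact (Suc k) * (real (Suc k) * (c * (s - a)) ^ k * c)) (at s within {a..t})" .
        moreover have "B / fact (Suc k) * (real (Suc k) * (c * (s - a)) ^ k * c) = h s"
        proof -
          have "fact (Suc k) = real (Suc k) * fact k" by simp
          then show ?thesis unfolding h_def by (simp only: divide_simps) simp
        qed
        ultimately show ?thesis by simp
      qed
      then show "((\<lambda>s. B * ((c * (s - a)) ^ Suc k / fact (Suc k))) has_vector_derivative h s) (at s within {a..t})"
        by (simp add: has_real_derivative_iff_has_vector_derivative)
    qed
    finally show ?case by simp
  qed
  then have le: "\<bar>m i t\<bar> \<le> B * ((c * (t - a)) ^ k / fact k)" for k using t by auto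
  have "(\<lambda>k. B * ((c * (t - a)) ^ k / fact k)) \<longlonglongrightarrow> B * 0"
  proof (rule tendsto_mult_left)
    show "(\<lambda>k. (c * (t - a)) ^ k / fact k) \<longlonglongrightarrow> 0"
      using summable_LIMSEQ_zero[OF summable_exp[of "c * (t - a)"]] by (simp add: field_simps)
  qed
  then have "\<bar>m i t\<bar> \<le> B * 0"
    using le by (intro LIMSEQ_le_const) auto
  then show ?thesis by simp
qed

locale random_linear_system = prob_space M + linear_system a n A K
  for M :: "'w measure" and a n A K
begin

text \<open>
  The energy estimate along paths bounds the second moments of the solution in terms of those of the
  initial value and of the forcing. This licenses \<open>mean_of_derivative\<close>, which yields
  \<open>m(t) = \<integral> A m\<close> for the mean \<open>m\<close>, the forcing having mean zero; so \<open>m\<close> vanishes.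
\<close>

lemma centered_solution:
  fixes X f :: "nat \<Rightarrow> real \<Rightarrow> 'w \<Rightarrow> real"
  assumes sol: "\<And>\<omega>. \<omega> \<in> space M \<Longrightarrow> solves a (\<lambda>i t. f i t \<omega>) (\<lambda>i t. X i t \<omega>)"
    and f: "\<And>i. i < n \<Longrightarrow> centered_process a (f i)"
    and meas: "\<And>i t. i < n \<Longrightarrow> a \<le> t \<Longrightarrow> X i t \<in> borel_measurable M"
    and sq0: "\<And>i. i < n \<Longrightarrow> integrable M (\<lambda>\<omega>. (X i a \<omega>)\<^sup>2)"
    and mean0: "\<And>i. i < n \<Longrightarrow> expectation (X i a) = 0"
    and "i < n"
  shows "centered_process a (X i)"
proof -
  define c where "c = 2 * real n * \<bar>K\<bar> + 1"
  define F where "F = (\<lambda>t \<omega>. \<Sum>i<n. (f i t \<omega>)\<^sup>2)"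
  have Fm: "F t \<in> borel_measurable M" "integrable M (F t)" if "a \<le> t" for t
    using centered_processD(1,2)[OF f that] unfolding F_def by auto
  have Fc: "continuous_on {a..} (\<lambda>t. F t \<omega>)" if "\<omega> \<in> space M" for \<omega>
    unfolding F_def using centered_process_cont[OF f that]
    by (intro continuous_on_sum continuous_on_power) auto
  have Fn: "0 \<le> F t \<omega>" for t \<omega> unfolding F_def by (simp add: sum_nonneg)
  have E: "(\<Sum>i<n. (X i t \<omega>)\<^sup>2) \<le> exp (c * (t - a)) * ((\<Sum>i<n. (X i a \<omega>)\<^sup>2) + integral {a..t} (\<lambda>r. F r \<omega>))"
    if "\<omega> \<in> space M" "a \<le> t" for \<omega> t
    unfolding c_def F_def
    using energy_growth[OF sol[OF that(1)] order_refl that(2)] centered_process_cont[OF f that(1)] by simp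
  have E1: "(X i t \<omega>)\<^sup>2 \<le> exp (c * (t - a)) * ((\<Sum>i<n. (X i a \<omega>)\<^sup>2) + integral {a..t} (\<lambda>r. F r \<omega>))"
    if "\<omega> \<in> space M" "a \<le> t" "i < n" for \<omega> t i
  proof -
    have "(X i t \<omega>)\<^sup>2 \<le> (\<Sum>i<n. (X i t \<omega>)\<^sup>2)"
      using that by (intro member_le_sum) auto
    then show ?thesis using E[OF that(1,2)] by linarith
  qed
  have FB: "\<exists>B. \<forall>t\<in>{a..T}. expectation (F t) \<le> B" for T
  proof -
    have "\<forall>i. \<exists>b. i < n \<longrightarrow> (\<forall>t\<in>{a..T}. expectation (\<lambda>\<omega>. (f i t \<omega>)\<^sup>2) \<le> b)"
      using f unfolding centered_process_def by auto
    then obtain b where b: "\<And>i t. i < n \<Longrightarrow> t \<in> {a..T} \<Longrightarrow> expectation (\<lambda>\<omega>. (f i t \<omega>)\<^sup>2) \<le> b i" by metis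
    have "expectation (F t) \<le> (\<Sum>i<n. b i)" if "t \<in> {a..T}" for t
    proof -
      have "expectation (F t) = (\<Sum>i<n. expectation (\<lambda>\<omega>. (f i t \<omega>)\<^sup>2))"
        unfolding F_def using centered_processD(2)[OF f] that by (intro Bochner_Integration.integral_sum) auto
      then show ?thesis using b that by (auto intro!: sum_mono)
    qed
    then show ?thesis by blast
  qed
  have L2: "integrable M (\<lambda>\<omega>. (X i t \<omega>)\<^sup>2) \<and> expectation (\<lambda>\<omega>. (X i t \<omega>)\<^sup>2) \<le>
      exp (c * (t - a)) * (expectation (\<lambda>\<omega>. \<Sum>i<n. (X i a \<omega>)\<^sup>2) + B * (t - a))"
    if t: "a \<le> t" "t \<le> T" "i < n" and B: "\<forall>t\<in>{a..T}. expectation (F t) \<le> B" for t T i B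
  proof -
    have Fa: "expectation (\<lambda>\<omega>. \<bar>F s \<omega>\<bar>) \<le> B" if "s \<in> {a..t}" for s
      using B that t Fn by simp
    have I: "integrable M (\<lambda>\<omega>. integral {a..t} (\<lambda>r. F r \<omega>))"
      "expectation (\<lambda>\<omega>. integral {a..t} (\<lambda>r. F r \<omega>)) \<le> B * (t - a)"
      using mean_integral_of_process[of a F t B] Fm Fc Fa t by auto
    have R: "integrable M (\<lambda>\<omega>. exp (c * (t - a)) * ((\<Sum>i<n. (X i a \<omega>)\<^sup>2) + integral {a..t} (\<lambda>r. F r \<omega>)))"
      using I(1) sq0 by (intro integrable_mult_right Bochner_Integration.integrable_add
          Bochner_Integration.integrable_sum) auto
    have X: "integrable M (\<lambda>\<omega>. (X i t \<omega>)\<^sup>2)"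
    proof (rule Bochner_Integration.integrable_bound[OF R])
      show "(\<lambda>\<omega>. (X i t \<omega>)\<^sup>2) \<in> borel_measurable M" using meas t by simp
      show "AE \<omega> in M. norm ((X i t \<omega>)\<^sup>2) \<le> norm (exp (c * (t - a)) * ((\<Sum>i<n. (X i a \<omega>)\<^sup>2) + integral {a..t} (\<lambda>r. F r \<omega>)))"
        using E1[OF _ t(1,3)] by (intro AE_I2) (smt (verit) real_norm_def zero_le_power2)
    qed
    have "expectation (\<lambda>\<omega>. (X i t \<omega>)\<^sup>2) \<le> expectation (\<lambda>\<omega>. exp (c * (t - a)) * ((\<Sum>i<n. (X i a \<omega>)\<^sup>2) + integral {a..t} (\<lambda>r. F r \<omega>)))"
      by (intro integral_mono X R E1 t)
    also have "\<dots> = exp (c * (t - a)) * (expectation (\<lambda>\<omega>. \<Sum>i<n. (X i a \<omega>)\<^sup>2) + expectation (\<lambda>\<omega>. integral {a..t} (\<lambda>r. F r \<omega>)))"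
    proof -
      have "integrable M (\<lambda>\<omega>. \<Sum>i<n. (X i a \<omega>)\<^sup>2)"
        using sq0 by (intro Bochner_Integration.integrable_sum) auto
      then show ?thesis
        by (simp only: integral_mult_right_zero Bochner_Integration.integral_add[OF _ I(1)])
    qed
    also have "\<dots> \<le> exp (c * (t - a)) * (expectation (\<lambda>\<omega>. \<Sum>i<n. (X i a \<omega>)\<^sup>2) + B * (t - a))"
      using I(2) by (intro mult_left_mono) auto
    finally show ?thesis using X by simp
  qed
  have X2: "integrable M (\<lambda>\<omega>. (X i t \<omega>)\<^sup>2)" if "a \<le> t" "i < n" for t i
    using FB[of t] L2[OF that(1) order_refl that(2)] by blast
  have XB: "\<exists>B. \<forall>i<n. \<forall>t\<in>{a..T}. expectation (\<lambda>\<omega>. (X i t \<omega>)\<^sup>2) \<le> B" for T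
  proof -
    obtain B where B: "\<forall>t\<in>{a..T}. expectation (F t) \<le> B" using FB by blast
    define V0 where "V0 = expectation (\<lambda>\<omega>. \<Sum>i<n. (X i a \<omega>)\<^sup>2)"
    have V0: "0 \<le> V0" unfolding V0_def by (intro integral_nonneg_AE AE_I2) (simp add: sum_nonneg)
    have "expectation (\<lambda>\<omega>. (X i t \<omega>)\<^sup>2) \<le> exp (c * (T - a)) * (V0 + B * (T - a))"
      if "i < n" "t \<in> {a..T}" for i t
    proof -
      have "0 \<le> expectation (F t)" using Fn by simp
      then have B0: "0 \<le> B" using bspec[OF B that(2)] by (rule order_trans)
      have "expectation (\<lambda>\<omega>. (X i t \<omega>)\<^sup>2) \<le> exp (c * (t - a)) * (V0 + B * (t - a))"
        using L2[of t T i B] that B unfolding V0_def by auto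
      also have "\<dots> \<le> exp (c * (T - a)) * (V0 + B * (T - a))"
        using that B0 V0 by (intro mult_mono add_left_mono) (auto simp: c_def intro!: mult_left_mono)
      finally show ?thesis .
    qed
    then show ?thesis by blast
  qed
  have Xi: "integrable M (X i t)" if "a \<le> t" "i < n" for t i
    using square_integrable_imp_integrable meas X2 that by blast
  define m where "m = (\<lambda>i t. expectation (X i t))"
  define g where "g = (\<lambda>i t \<omega>. (\<Sum>j<n. A t i j * X j t \<omega>) + f i t \<omega>)"
  have gi: "integrable M (g i t)" if "a \<le> t" "i < n" for t i
    unfolding g_def using Xi that centered_processD(3)[OF f]
    by (intro Bochner_Integration.integrable_add Bochner_Integration.integrable_sum integrable_mult_right) auto
  have Eg: "expectation (g i t) = (\<Sum>j<n. A t i j * m j t)" if "a \<le> t" "i < n" for t i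
  proof -
    have S: "integrable M (\<lambda>\<omega>. \<Sum>j<n. A t i j * X j t \<omega>)"
      using Xi that by (intro Bochner_Integration.integrable_sum integrable_mult_right) auto
    have "expectation (g i t) = expectation (\<lambda>\<omega>. \<Sum>j<n. A t i j * X j t \<omega>) + expectation (f i t)"
      unfolding g_def using that f by (intro Bochner_Integration.integral_add S centered_processD(3)) auto
    also have "expectation (\<lambda>\<omega>. \<Sum>j<n. A t i j * X j t \<omega>) = (\<Sum>j<n. expectation (\<lambda>\<omega>. A t i j * X j t \<omega>))"
      using Xi that by (intro Bochner_Integration.integral_sum integrable_mult_right) auto
    finally show ?thesis using centered_processD(4)[OF f] that by (simp add: m_def)
  qed
  have der: "((\<lambda>s. X i s \<omega>) has_real_derivative g i s \<omega>) (at s within {a..})"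
    if "a \<le> s" "\<omega> \<in> space M" "i < n" for i s \<omega>
    using sol[OF that(2)] that unfolding solves_def g_def by auto
  have m0: "m i t = 0" if it: "i < n" "a \<le> t" for i t
  proof -
    obtain B where B: "\<forall>i<n. \<forall>s\<in>{a..t}. expectation (\<lambda>\<omega>. (X i s \<omega>)\<^sup>2) \<le> B" using XB by blast
    have absX: "expectation (\<lambda>\<omega>. \<bar>X i s \<omega>\<bar>) \<le> 1 + B" if "i < n" "s \<in> {a..t}" for i s
    proof -
      have "expectation (\<lambda>\<omega>. \<bar>X i s \<omega>\<bar>) \<le> 1 + expectation (\<lambda>\<omega>. (X i s \<omega>)\<^sup>2)"
        using that by (intro mean_abs_le_mean_square meas X2) auto
      moreover have "expectation (\<lambda>\<omega>. (X i s \<omega>)\<^sup>2) \<le> B" using B that by blast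
      ultimately show ?thesis by linarith
    qed
    have "\<exists>D. \<forall>s\<in>{a..t}. expectation (\<lambda>\<omega>. \<bar>g i s \<omega>\<bar>) \<le> D" if "i < n" for i
    proof -
      obtain C where C: "\<And>s. a \<le> s \<Longrightarrow> s \<le> t \<Longrightarrow> expectation (\<lambda>\<omega>. (f i s \<omega>)\<^sup>2) \<le> C"
        using centered_process_bound[OF f[OF \<open>i < n\<close>]] by blast
      have "expectation (\<lambda>\<omega>. \<bar>g i s \<omega>\<bar>) \<le> real n * (\<bar>K\<bar> * (1 + B)) + (1 + C)" if s: "s \<in> {a..t}" for s
      proof -
        have as: "a \<le> s" using s by simp
        have "expectation (\<lambda>\<omega>. \<bar>g i s \<omega>\<bar>) \<le> expectation (\<lambda>\<omega>. (\<Sum>j<n. \<bar>A s i j\<bar> * \<bar>X j s \<omega>\<bar>) + \<bar>f i s \<omega>\<bar>)"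
        proof (rule integral_mono)
          show "integrable M (\<lambda>\<omega>. \<bar>g i s \<omega>\<bar>)" using gi[OF as \<open>i < n\<close>] by simp
          show "integrable M (\<lambda>\<omega>. (\<Sum>j<n. \<bar>A s i j\<bar> * \<bar>X j s \<omega>\<bar>) + \<bar>f i s \<omega>\<bar>)"
            using Xi[OF as] centered_processD(3)[OF f[OF \<open>i < n\<close>] as]
            by (intro Bochner_Integration.integrable_add Bochner_Integration.integrable_sum
                integrable_mult_right integrable_abs) auto
          show "\<bar>g i s \<omega>\<bar> \<le> (\<Sum>j<n. \<bar>A s i j\<bar> * \<bar>X j s \<omega>\<bar>) + \<bar>f i s \<omega>\<bar>" for \<omega>
            unfolding g_def abs_mult[symmetric]
            by (rule order_trans[OF abs_triangle_ineq add_right_mono[OF sum_abs]])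
        qed
        also have "\<dots> = expectation (\<lambda>\<omega>. \<Sum>j<n. \<bar>A s i j\<bar> * \<bar>X j s \<omega>\<bar>) + expectation (\<lambda>\<omega>. \<bar>f i s \<omega>\<bar>)"
          using Xi[OF as] centered_processD(3)[OF f[OF \<open>i < n\<close>] as]
          by (intro Bochner_Integration.integral_add Bochner_Integration.integrable_sum
              integrable_mult_right integrable_abs) auto
        also have "expectation (\<lambda>\<omega>. \<Sum>j<n. \<bar>A s i j\<bar> * \<bar>X j s \<omega>\<bar>) =
            (\<Sum>j<n. expectation (\<lambda>\<omega>. \<bar>A s i j\<bar> * \<bar>X j s \<omega>\<bar>))"
          using Xi[OF as] by (intro Bochner_Integration.integral_sum integrable_mult_right integrable_abs) auto
        also have "\<dots> = (\<Sum>j<n. \<bar>A s i j\<bar> * expectation (\<lambda>\<omega>. \<bar>X j s \<omega>\<bar>))" by simp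
        also have "(\<Sum>j<n. \<bar>A s i j\<bar> * expectation (\<lambda>\<omega>. \<bar>X j s \<omega>\<bar>)) + expectation (\<lambda>\<omega>. \<bar>f i s \<omega>\<bar>)
            \<le> (\<Sum>j<n. \<bar>K\<bar> * (1 + B)) + (1 + C)"
        proof (intro add_mono sum_mono mult_mono)
          show "\<bar>A s i j\<bar> \<le> \<bar>K\<bar>" if "j \<in> {..<n}" for j
            using A_bound[OF as \<open>i < n\<close>, of j] that by auto
          show "expectation (\<lambda>\<omega>. \<bar>f i s \<omega>\<bar>) \<le> 1 + C"
          proof -
            have "expectation (\<lambda>\<omega>. \<bar>f i s \<omega>\<bar>) \<le> 1 + expectation (\<lambda>\<omega>. (f i s \<omega>)\<^sup>2)"
              by (rule mean_abs_le_mean_square[OF centered_processD(1,2)[OF f[OF \<open>i < n\<close>] as]])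
            moreover have "expectation (\<lambda>\<omega>. (f i s \<omega>)\<^sup>2) \<le> C" using C s by simp
            ultimately show ?thesis by linarith
          qed
          show "expectation (\<lambda>\<omega>. \<bar>X j s \<omega>\<bar>) \<le> 1 + B" if "j \<in> {..<n}" for j
            using absX s that by simp
        qed simp_all
        finally show ?thesis by simp
      qed
      then show ?thesis by blast
    qed
    then obtain D where D: "\<And>i s. i < n \<Longrightarrow> s \<in> {a..t} \<Longrightarrow> expectation (\<lambda>\<omega>. \<bar>g i s \<omega>\<bar>) \<le> D i"
      by metis
    show ?thesis
    proof (rule iterated_gronwall[where m = m and a = a and T = t and B = "1 + B" and K = "\<bar>K\<bar>", OF _ _ _ it order_refl])
      show "\<bar>m i s\<bar> \<le> 1 + B" if "i < n" "a \<le> s" "s \<le> t" for i s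
      proof -
        have "\<bar>m i s\<bar> \<le> expectation (\<lambda>\<omega>. \<bar>X i s \<omega>\<bar>)" unfolding m_def by (rule integral_abs_bound)
        then show ?thesis using absX[of i s] that by simp
      qed
      fix i s h assume its: "i < n" "a \<le> s" "s \<le> t" and hi: "set_integrable lborel {a..s} h"
        and hb: "\<And>r. r \<in> {a..s} \<Longrightarrow> \<bar>K\<bar> * (\<Sum>j<n. \<bar>m j r\<bar>) \<le> h r"
      have MD: "set_integrable lborel {a..s} (\<lambda>s. expectation (g i s))"
        "expectation (X i s) = expectation (X i a) + (LINT r:{a..s}|lborel. expectation (g i r))"
        using its by (auto intro!: mean_of_derivative[where Y = "X i" and g = "g i" and B = "D i"] meas der gi D Xi)
      have "\<bar>m i s\<bar> = \<bar>LINT r:{a..s}|lborel. expectation (g i r)\<bar>"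
        using MD(2) mean0[OF its(1)] by (simp add: m_def)
      also have "\<dots> \<le> (LINT r:{a..s}|lborel. \<bar>expectation (g i r)\<bar>)"
        using set_integral_norm_bound[OF MD(1)] by (simp only: real_norm_def)
      also have "\<dots> \<le> (LINT r:{a..s}|lborel. h r)"
      proof (rule set_integral_mono[OF _ hi])
        show "set_integrable lborel {a..s} (\<lambda>r. \<bar>expectation (g i r)\<bar>)"
          by (rule set_integrable_abs[OF MD(1)])
        fix r assume r: "r \<in> {a..s}"
        have "\<bar>expectation (g i r)\<bar> \<le> (\<Sum>j<n. \<bar>A r i j * m j r\<bar>)"
          using Eg[of r i] r its by (simp add: sum_abs)
        also have "\<dots> \<le> (\<Sum>j<n. \<bar>K\<bar> * \<bar>m j r\<bar>)"
          unfolding abs_mult using A_bound[of r i] r its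
          by (intro sum_mono mult_right_mono) (auto intro: order_trans[OF _ abs_ge_self])
        finally show "\<bar>expectation (g i r)\<bar> \<le> h r" using hb[OF r] by (simp add: sum_distrib_left)
      qed
      finally show "\<bar>m i s\<bar> \<le> (LINT r:{a..s}|lborel. h r)" .
    qed simp
  qed
  show ?thesis
    unfolding centered_process_def
  proof (intro conjI allI impI ballI)
    fix t assume "a \<le> t"
    then show "X i t \<in> borel_measurable M" "integrable M (\<lambda>\<omega>. (X i t \<omega>)\<^sup>2)" "expectation (X i t) = 0"
      using meas X2 m0 \<open>i < n\<close> unfolding m_def by auto
  next
    fix \<omega> assume "\<omega> \<in> space M"
    then show "continuous_on {a..} (\<lambda>t. X i t \<omega>)"
      using der[OF _ _ \<open>i < n\<close>] by (intro continuous_on_halfline_of_deriv) auto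
  next
    fix T show "\<exists>B. \<forall>t\<in>{a..T}. expectation (\<lambda>\<omega>. (X i t \<omega>)\<^sup>2) \<le> B"
      using XB[of T] \<open>i < n\<close> by blast
  qed
qed

end

section \<open>Rayleigh quotients of symmetric matrices\<close>

lemma scalar_prod_sum: "w \<in> carrier_vec n \<Longrightarrow> scalar_prod v w = (\<Sum>i<n. v $ i * w $ i)"
  by (simp add: scalar_prod_def atLeast0LessThan)

lemma mult_mat_vec_sum:
  "A \<in> carrier_mat r c \<Longrightarrow> v \<in> carrier_vec c \<Longrightarrow> i < r \<Longrightarrow> (A *\<^sub>v v) $ i = (\<Sum>j<c. A $$ (i,j) * v $ j)"
  by (simp add: scalar_prod_def atLeast0LessThan)

lemma scalar_prod_self_nonneg: "0 \<le> scalar_prod v (v :: rvec)"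
  by (simp add: scalar_prod_def sum_nonneg)

lemma scalar_prod_self_eq_0:
  assumes "v \<in> carrier_vec n" shows "scalar_prod v (v :: rvec) = 0 \<longleftrightarrow> v = 0\<^sub>v n"
proof
  assume "scalar_prod v v = 0"
  then have "(\<Sum>i<n. v $ i * v $ i) = 0" using assms by (simp add: scalar_prod_sum)
  then have "\<forall>i\<in>{..<n}. v $ i * v $ i = 0" by (subst (asm) sum_nonneg_eq_0_iff) auto
  then show "v = 0\<^sub>v n" using assms by (intro eq_vecI) auto
qed (use assms in simp)

lemma vnorm_sq: "(vnorm v)\<^sup>2 = scalar_prod v v"
  by (simp add: vnorm_def scalar_prod_self_nonneg)

lemma mult_mat_vec_norm_le:
  assumes A: "(A :: rmat) \<in> carrier_mat r c" and v: "v \<in> carrier_vec c"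
  shows "scalar_prod (A *\<^sub>v v) (A *\<^sub>v v) \<le> (\<Sum>i<r. \<Sum>j<c. (A $$ (i,j))\<^sup>2) * scalar_prod v v"
proof -
  have "scalar_prod (A *\<^sub>v v) (A *\<^sub>v v) = (\<Sum>i<r. (\<Sum>j<c. A $$ (i,j) * v $ j)\<^sup>2)"
    using A v by (subst scalar_prod_sum[of _ r]) (auto simp: mult_mat_vec_sum power2_eq_square simp del: index_mult_mat_vec intro!: sum.cong)
  also have "\<dots> \<le> (\<Sum>i<r. (\<Sum>j<c. (A $$ (i,j))\<^sup>2) * (\<Sum>j<c. (v $ j)\<^sup>2))"
    by (intro sum_mono Cauchy_Schwarz_ineq_sum)
  also have "\<dots> = (\<Sum>i<r. \<Sum>j<c. (A $$ (i,j))\<^sup>2) * scalar_prod v v"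
    using v by (simp add: scalar_prod_sum power2_eq_square sum_distrib_right)
  finally show ?thesis .
qed

lemma symmetric_scalar_prod:
  assumes "(A :: rmat) \<in> carrier_mat n n" "A\<^sup>T = A" "u \<in> carrier_vec n" "v \<in> carrier_vec n"
  shows "scalar_prod u (A *\<^sub>v v) = scalar_prod v (A *\<^sub>v u)"
  using transpose_vec_mult_scalar[of A n n v u] assms
  by (metis comm_scalar_prod mult_mat_vec_carrier)

text \<open>
  The form is nonnegative at \<open>s u + t v\<close>, a quadratic polynomial in \<open>s\<close> and \<open>t\<close>. When the value at \<open>v\<close> is zero the
  discriminant argument degenerates and the mixed term must vanish.
\<close>

lemma semidefinite_Cauchy_Schwarz:
  assumes B: "(B :: rmat) \<in> carrier_mat n n" "B\<^sup>T = B"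
    and psd: "\<And>v. v \<in> carrier_vec n \<Longrightarrow> 0 \<le> scalar_prod v (B *\<^sub>v v)"
    and u: "u \<in> carrier_vec n" and v: "v \<in> carrier_vec n"
  shows "(scalar_prod u (B *\<^sub>v v))\<^sup>2 \<le> scalar_prod u (B *\<^sub>v u) * scalar_prod v (B *\<^sub>v v)"
proof -
  define p where "p = scalar_prod u (B *\<^sub>v u)"
  define q where "q = scalar_prod v (B *\<^sub>v v)"
  define r where "r = scalar_prod u (B *\<^sub>v v)"
  have r': "scalar_prod v (B *\<^sub>v u) = r"
    unfolding r_def by (rule symmetric_scalar_prod[OF B v u])
  have Bu: "B *\<^sub>v u \<in> carrier_vec n" and Bv: "B *\<^sub>v v \<in> carrier_vec n" using B u v by auto
  have quad: "0 \<le> s\<^sup>2 * p + 2 * s * t * r + t\<^sup>2 * q" for s t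
  proof -
    have su: "s \<cdot>\<^sub>v u \<in> carrier_vec n" and tv: "t \<cdot>\<^sub>v v \<in> carrier_vec n" using u v by auto
    have "B *\<^sub>v (s \<cdot>\<^sub>v u + t \<cdot>\<^sub>v v) = s \<cdot>\<^sub>v (B *\<^sub>v u) + t \<cdot>\<^sub>v (B *\<^sub>v v)"
      using mult_add_distrib_mat_vec[OF B(1) su tv] mult_mat_vec[OF B(1) u] mult_mat_vec[OF B(1) v] by simp
    then have "scalar_prod (s \<cdot>\<^sub>v u + t \<cdot>\<^sub>v v) (B *\<^sub>v (s \<cdot>\<^sub>v u + t \<cdot>\<^sub>v v)) = s\<^sup>2 * p + 2 * s * t * r + t\<^sup>2 * q"
      using u v Bu Bv su tv r' unfolding p_def q_def r_def
      by (simp add: add_scalar_prod_distrib[of _ n] scalar_prod_add_distrib[of _ n] power2_eq_square algebra_simps)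
    then show ?thesis using psd[of "s \<cdot>\<^sub>v u + t \<cdot>\<^sub>v v"] su tv by simp
  qed
  have p0: "0 \<le> p" and q0: "0 \<le> q" unfolding p_def q_def using psd u v by auto
  have "r\<^sup>2 \<le> p * q"
  proof (cases "q = 0")
    case True
    have "r = 0"
    proof (rule ccontr)
      assume "r \<noteq> 0"
      have "0 \<le> p + 2 * (- (p + 1) / (2 * r)) * r" using quad[of 1 "- (p + 1) / (2 * r)"] True by simp
      also have "\<dots> = -1" using \<open>r \<noteq> 0\<close> by (simp add: field_simps)
      finally show False by simp
    qed
    then show ?thesis using True by simp
  next
    case False
    \<comment> \<open>The minimizing coefficients are proportional to \<open>q\<close> and \<open>- r\<close>.\<close>
    have "0 \<le> q * (q * p - r\<^sup>2)" using quad[of q "- r"] by (simp add: power2_eq_square algebra_simps)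
    then show ?thesis using False q0 by (simp add: zero_le_mult_iff mult.commute)
  qed
  then show ?thesis unfolding p_def q_def r_def .
qed

text \<open>
  Applied to \<open>B v\<close> and \<open>v\<close>, the Cauchy-Schwarz inequality gives \<open>\<bar>B v\<bar>\<^sup>2 \<le> K (v \<bullet> B v)\<close>, and nonsingularity
  gives \<open>\<bar>v\<bar>\<^sup>2 \<le> F \<bar>B v\<bar>\<^sup>2\<close>.
\<close>

lemma nonsingular_semidefinite_coercive:
  assumes B: "(B :: rmat) \<in> carrier_mat n n" "B\<^sup>T = B"
    and psd: "\<And>v. v \<in> carrier_vec n \<Longrightarrow> 0 \<le> scalar_prod v (B *\<^sub>v v)"
    and det: "det B \<noteq> 0"
  shows "\<exists>\<epsilon>>0. \<forall>v\<in>carrier_vec n. \<epsilon> * scalar_prod v v \<le> scalar_prod v (B *\<^sub>v v)"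
proof -
  obtain N where N: "N \<in> carrier_mat n n" "N * B = 1\<^sub>m n"
    using det_non_zero_imp_unit[OF B(1) det, of "()"] unfolding Units_def by (auto simp: ring_mat_def)
  define F where "F = (\<Sum>i<n. \<Sum>j<n. (N $$ (i,j))\<^sup>2)"
  define K where "K = 1 + (\<Sum>i<n. \<Sum>j<n. (B $$ (i,j))\<^sup>2)"
  have F0: "0 \<le> F" unfolding F_def by (intro sum_nonneg) auto
  have K1: "1 \<le> K" unfolding K_def by (auto intro!: sum_nonneg)
  define \<epsilon> where "\<epsilon> = 1 / ((F + 1) * K)"
  have "\<epsilon> * scalar_prod v v \<le> scalar_prod v (B *\<^sub>v v)" if v: "v \<in> carrier_vec n" for v
  proof -
    define q where "q = scalar_prod v (B *\<^sub>v v)"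
    define b where "b = scalar_prod (B *\<^sub>v v) (B *\<^sub>v v)"
    have Bv: "B *\<^sub>v v \<in> carrier_vec n" using B v by auto
    have b0: "0 \<le> b" unfolding b_def by (rule scalar_prod_self_nonneg)
    have q0: "0 \<le> q" unfolding q_def by (rule psd[OF v])
    have le1: "scalar_prod v v \<le> F * b"
    proof -
      have "N *\<^sub>v (B *\<^sub>v v) = v"
        using assoc_mult_mat_vec[OF N(1) B(1) v] N(2) v by simp
      then show ?thesis using mult_mat_vec_norm_le[OF N(1) Bv] unfolding F_def b_def by simp
    qed
    have le2: "b \<le> K * q"
    proof (cases "b = 0")
      case False
      have BB: "scalar_prod (B *\<^sub>v v) (B *\<^sub>v (B *\<^sub>v v)) \<le> K * b"
      proof -
        define w where "w = B *\<^sub>v v"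
        have w: "w \<in> carrier_vec n" using Bv by (simp add: w_def)
        have Bw: "B *\<^sub>v w \<in> carrier_vec n" using B w by auto
        have "2 * scalar_prod w (B *\<^sub>v w) \<le> scalar_prod w w + scalar_prod (B *\<^sub>v w) (B *\<^sub>v w)"
          unfolding scalar_prod_sum[OF w] scalar_prod_sum[OF Bw] sum_distrib_left sum.distrib[symmetric]
          by (intro sum_mono) (metis mult.assoc power2_eq_square sum_squares_bound)
        also have "\<dots> \<le> scalar_prod w w + (K - 1) * scalar_prod w w"
          using mult_mat_vec_norm_le[OF B(1) w] unfolding K_def by simp
        also have "\<dots> = K * scalar_prod w w" by (simp add: algebra_simps)
        finally have "2 * scalar_prod w (B *\<^sub>v w) \<le> K * scalar_prod w w" .
        moreover have "0 \<le> scalar_prod w (B *\<^sub>v w)" by (rule psd[OF w])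
        ultimately show ?thesis unfolding b_def w_def by linarith
      qed
      have "b\<^sup>2 \<le> scalar_prod (B *\<^sub>v v) (B *\<^sub>v (B *\<^sub>v v)) * q"
        unfolding b_def q_def by (rule semidefinite_Cauchy_Schwarz[OF B psd Bv v])
      also have "\<dots> \<le> K * b * q" using BB q0 by (rule mult_right_mono)
      finally have "b * b \<le> b * (K * q)" by (simp add: power2_eq_square mult_ac)
      then show ?thesis using False b0 by simp
    qed (use K1 q0 in simp)
    have "scalar_prod v v \<le> (F + 1) * (K * q)"
      using le1 mult_left_mono[OF le2 F0] K1 q0 by (simp add: algebra_simps) (smt (verit) mult_nonneg_nonneg)
    then have "scalar_prod v v \<le> q * ((F + 1) * K)" by (simp add: mult_ac)
    moreover have "0 < (F + 1) * K" using F0 K1 by simp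
    ultimately have "scalar_prod v v / ((F + 1) * K) \<le> q" by (simp only: pos_divide_le_eq)
    then show ?thesis unfolding q_def[symmetric] \<epsilon>_def by simp
  qed
  moreover have "0 < \<epsilon>" unfolding \<epsilon>_def using F0 K1 by simp
  ultimately show ?thesis by blast
qed

text \<open>
  If the supremum \<open>\<mu>\<close> of the Rayleigh quotients were no eigenvalue, the semidefinite matrix \<open>\<mu> - S\<close>
  would be nonsingular, hence coercive, and \<open>\<mu>\<close> would not be the least upper bound. Coercivity
  replaces the usual compactness of the unit sphere.
\<close>

lemma sup_Rayleigh_is_eigenvalue:
  assumes S: "(S :: rmat) \<in> carrier_mat n n" "S\<^sup>T = S" and "0 < n"
    and up: "\<And>v. v \<in> carrier_vec n \<Longrightarrow> scalar_prod v (S *\<^sub>v v) \<le> C * scalar_prod v v"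
  shows "\<exists>\<mu>. eigenvalue S \<mu> \<and> (\<forall>v\<in>carrier_vec n. scalar_prod v (S *\<^sub>v v) \<le> \<mu> * scalar_prod v v)"
proof -
  define R where "R = (\<lambda>v. scalar_prod v (S *\<^sub>v v) / scalar_prod v v)"
  define V :: "rvec set" where "V = {v \<in> carrier_vec n. v \<noteq> 0\<^sub>v n}"
  have pos: "0 < scalar_prod v v" if "v \<in> V" for v
    using that scalar_prod_self_eq_0[of v n] scalar_prod_self_nonneg[of v] unfolding V_def by auto
  have "unit_vec n 0 \<in> V" using \<open>0 < n\<close> unfolding V_def by auto
  then have ne: "V \<noteq> {}" by auto
  have bdd: "bdd_above (R ` V)"
  proof (rule bdd_aboveI2)
    fix v assume "v \<in> V"
    then show "R v \<le> C" using up[of v] pos[of v] unfolding R_def V_def by (simp add: divide_le_eq)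
  qed
  define \<mu> where "\<mu> = (SUP v\<in>V. R v)"
  have mu: "scalar_prod v (S *\<^sub>v v) \<le> \<mu> * scalar_prod v v" if v: "v \<in> carrier_vec n" for v
  proof (cases "v = 0\<^sub>v n")
    case True then show ?thesis using S by simp
  next
    case False
    then have "v \<in> V" using v by (simp add: V_def)
    then have "R v \<le> \<mu>" unfolding \<mu>_def using bdd by (rule cSUP_upper)
    then show ?thesis using pos[OF \<open>v \<in> V\<close>] unfolding R_def by (simp add: divide_le_eq)
  qed
  have "eigenvalue S \<mu>"
  proof (rule ccontr)
    assume "\<not> eigenvalue S \<mu>"
    then have d: "det (char_matrix S \<mu>) \<noteq> 0" using eigenvalue_det[OF S(1)] by simp
    define B where "B = - char_matrix S \<mu>"
    have B: "B \<in> carrier_mat n n" "B\<^sup>T = B"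
    proof -
      show "B \<in> carrier_mat n n" using S by (simp add: B_def)
      have sym: "S $$ (i,j) = S $$ (j,i)" if "i < n" "j < n" for i j
        using S that by (metis carrier_matD index_transpose_mat(1))
      show "B\<^sup>T = B"
        using S(1) by (intro eq_matI) (auto simp: B_def char_matrix_def sym)
    qed
    have Bv: "scalar_prod v (B *\<^sub>v v) = \<mu> * scalar_prod v v - scalar_prod v (S *\<^sub>v v)" if v: "v \<in> carrier_vec n" for v
    proof -
      have "B *\<^sub>v v = \<mu> \<cdot>\<^sub>v v - S *\<^sub>v v"
      proof (rule eq_vecI)
        fix i assume "i < dim_vec (\<mu> \<cdot>\<^sub>v v - S *\<^sub>v v)"
        then have i: "i < n" using S v by simp
        have "(B *\<^sub>v v) $ i = (\<Sum>j<n. B $$ (i,j) * v $ j)" using B v i by (simp only: mult_mat_vec_sum)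
        also have "\<dots> = (\<Sum>j<n. (if i = j then \<mu> * v $ j else 0) - S $$ (i,j) * v $ j)"
          using S i by (intro sum.cong) (auto simp: B_def char_matrix_def algebra_simps)
        also have "\<dots> = \<mu> * v $ i - (\<Sum>j<n. S $$ (i,j) * v $ j)"
          using i by (simp add: sum_subtractf)
        finally show "(B *\<^sub>v v) $ i = (\<mu> \<cdot>\<^sub>v v - S *\<^sub>v v) $ i"
          using S v i by (simp del: index_mult_mat_vec add: mult_mat_vec_sum)
      qed (use S v B in auto)
      then show ?thesis using S v by (simp add: scalar_prod_minus_distrib[of _ n])
    qed
    have "char_matrix S \<mu> \<in> carrier_mat n n" using S by simp
    then have "det B \<noteq> 0" using d unfolding B_def by (simp add: det_0_negate)
    have psd: "0 \<le> scalar_prod v (B *\<^sub>v v)" if "v \<in> carrier_vec n" for v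
      using Bv[OF that] mu[OF that] by simp
    obtain \<epsilon> where e: "0 < \<epsilon>" "\<forall>v\<in>carrier_vec n. \<epsilon> * scalar_prod v v \<le> scalar_prod v (B *\<^sub>v v)"
      using nonsingular_semidefinite_coercive[OF B psd \<open>det B \<noteq> 0\<close>] by blast
    have "\<mu> \<le> \<mu> - \<epsilon>" unfolding \<mu>_def
    proof (rule cSUP_least[OF ne], fold \<mu>_def)
      fix v assume v: "v \<in> V"
      then have "scalar_prod v (S *\<^sub>v v) \<le> (\<mu> - \<epsilon>) * scalar_prod v v"
        using bspec[OF e(2), of v] Bv[of v] unfolding V_def by (simp add: algebra_simps)
      then show "R v \<le> \<mu> - \<epsilon>" using pos[OF v] unfolding R_def by (simp add: divide_le_eq)
    qed
    then show False using e(1) by simp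
  qed
  then show ?thesis using mu by blast
qed

lemma eigenvalue_Rayleigh:
  assumes "(S :: rmat) \<in> carrier_mat n n" "eigenvalue S k"
  obtains v where "v \<in> carrier_vec n" "0 < scalar_prod v v" "scalar_prod v (S *\<^sub>v v) = k * scalar_prod v v"
proof -
  obtain v where v: "v \<in> carrier_vec n" "v \<noteq> 0\<^sub>v n" "S *\<^sub>v v = k \<cdot>\<^sub>v v"
    using assms unfolding eigenvalue_def eigenvector_def by auto
  show ?thesis
  proof (rule that[OF v(1)])
    show "0 < scalar_prod v v"
      using v scalar_prod_self_eq_0[of v n] scalar_prod_self_nonneg[of v] by linarith
    show "scalar_prod v (S *\<^sub>v v) = k * scalar_prod v v" using v by simp
  qed
qed

lemma finite_eigenvalues:
  assumes "(S :: rmat) \<in> carrier_mat n n" shows "finite {k. eigenvalue S k}"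
proof -
  have "char_poly S \<noteq> 0" using degree_monic_char_poly[OF assms] by auto
  then show ?thesis using poly_roots_finite[of "char_poly S"] eigenvalue_root_char_poly[OF assms] by simp
qed

lemma eigenvalue_uminus:
  assumes S: "(S :: rmat) \<in> carrier_mat n n" and "eigenvalue (- S) k" shows "eigenvalue S (- k)"
proof -
  obtain v where v: "v \<in> carrier_vec n" "v \<noteq> 0\<^sub>v n" "(- S) *\<^sub>v v = k \<cdot>\<^sub>v v"
    using assms unfolding eigenvalue_def eigenvector_def by auto
  have "S *\<^sub>v v = (- k) \<cdot>\<^sub>v v"
  proof (rule eq_vecI)
    fix i assume "i < dim_vec ((- k) \<cdot>\<^sub>v v)"
    then have i: "i < n" using v by simp
    have "((- S) *\<^sub>v v) $ i = - ((S *\<^sub>v v) $ i)"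
      using S v(1) i by (simp add: uminus_scalar_prod)
    then show "(S *\<^sub>v v) $ i = ((- k) \<cdot>\<^sub>v v) $ i" using v i by simp
  qed (use S v in auto)
  then show ?thesis using S v unfolding eigenvalue_def eigenvector_def by auto
qed

text \<open>
  The smallest eigenvalue is minus the largest one of \<open>- S\<close>.
\<close>

lemma Rayleigh_bounds:
  assumes S: "(S :: rmat) \<in> carrier_mat n n" "S\<^sup>T = S" and "0 < n"
    and up: "\<And>v. v \<in> carrier_vec n \<Longrightarrow> scalar_prod v (S *\<^sub>v v) \<le> C * scalar_prod v v"
    and low: "\<And>v. v \<in> carrier_vec n \<Longrightarrow> c * scalar_prod v v \<le> scalar_prod v (S *\<^sub>v v)"
  shows "lam_max S \<le> C" and "c \<le> lam_min S" and "lam_min S \<le> lam_max S"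
    and "\<And>v. v \<in> carrier_vec n \<Longrightarrow> scalar_prod v (S *\<^sub>v v) \<le> lam_max S * scalar_prod v v"
    and "\<And>v. v \<in> carrier_vec n \<Longrightarrow> lam_min S * scalar_prod v v \<le> scalar_prod v (S *\<^sub>v v)"
proof -
  obtain \<mu> where mu: "eigenvalue S \<mu>"
    "\<And>v. v \<in> carrier_vec n \<Longrightarrow> scalar_prod v (S *\<^sub>v v) \<le> \<mu> * scalar_prod v v"
    using sup_Rayleigh_is_eigenvalue[OF S \<open>0 < n\<close> up] by blast
  have neg: "scalar_prod v ((- S) *\<^sub>v v) = - scalar_prod v (S *\<^sub>v v)" if "v \<in> carrier_vec n" for v
    using S that by (simp add: scalar_prod_sum[of _ n] mult_mat_vec_sum[of _ n n] sum_negf del: index_mult_mat_vec)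
  have S': "- S \<in> carrier_mat n n" "(- S)\<^sup>T = - S" using S by (auto simp: transpose_uminus)
  have up': "scalar_prod v ((- S) *\<^sub>v v) \<le> - c * scalar_prod v v" if v: "v \<in> carrier_vec n" for v
    using neg[OF v] low[OF v] by simp
  obtain \<nu> where nu: "eigenvalue (- S) \<nu>"
    "\<And>v. v \<in> carrier_vec n \<Longrightarrow> scalar_prod v ((- S) *\<^sub>v v) \<le> \<nu> * scalar_prod v v"
    using sup_Rayleigh_is_eigenvalue[OF S' \<open>0 < n\<close> up'] by blast
  have fin: "finite {k. eigenvalue S k}" by (rule finite_eigenvalues[OF S(1)])
  have "eigenvalue S (- \<nu>)" by (rule eigenvalue_uminus[OF S(1) nu(1)])
  have le: "k \<le> b" if ev: "eigenvalue S k" and q: "\<And>v. v \<in> carrier_vec n \<Longrightarrow> scalar_prod v (S *\<^sub>v v) \<le> b * scalar_prod v v" for k b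
  proof -
    obtain v where v: "v \<in> carrier_vec n" "0 < scalar_prod v v" "scalar_prod v (S *\<^sub>v v) = k * scalar_prod v v"
      by (rule eigenvalue_Rayleigh[OF S(1) ev])
    have "k * scalar_prod v v \<le> b * scalar_prod v v" using q[OF v(1)] v(3) by linarith
    then show ?thesis using v(2) by (rule mult_right_le_imp_le)
  qed
  have ge: "b \<le> k" if ev: "eigenvalue S k" and q: "\<And>v. v \<in> carrier_vec n \<Longrightarrow> b * scalar_prod v v \<le> scalar_prod v (S *\<^sub>v v)" for k b
  proof -
    obtain v where v: "v \<in> carrier_vec n" "0 < scalar_prod v v" "scalar_prod v (S *\<^sub>v v) = k * scalar_prod v v"
      by (rule eigenvalue_Rayleigh[OF S(1) ev])
    have "b * scalar_prod v v \<le> k * scalar_prod v v" using q[OF v(1)] v(3) by linarith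
    then show ?thesis using v(2) by (rule mult_right_le_imp_le)
  qed
  have ge_nu: "- \<nu> * scalar_prod v v \<le> scalar_prod v (S *\<^sub>v v)" if "v \<in> carrier_vec n" for v
    using nu(2)[OF that] neg[OF that] by simp
  have mx: "lam_max S = \<mu>" unfolding lam_max_def
    using fin mu le by (intro Max_eqI) auto
  have mn: "lam_min S = - \<nu>" unfolding lam_min_def
    using fin \<open>eigenvalue S (- \<nu>)\<close> ge ge_nu by (intro Min_eqI) auto
  show "lam_max S \<le> C" using le[OF mu(1) up] mx by simp
  show "c \<le> lam_min S" using ge[OF \<open>eigenvalue S (- \<nu>)\<close> low] mn by simp
  show "lam_min S \<le> lam_max S" using le[OF \<open>eigenvalue S (- \<nu>)\<close> mu(2)] mx mn by simp
  show "\<And>v. v \<in> carrier_vec n \<Longrightarrow> scalar_prod v (S *\<^sub>v v) \<le> lam_max S * scalar_prod v v" using mu mx by simp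
  show "\<And>v. v \<in> carrier_vec n \<Longrightarrow> lam_min S * scalar_prod v v \<le> scalar_prod v (S *\<^sub>v v)" using ge_nu mn by simp
qed

section \<open>The Gramian of a uniformly asymptotically stable system\<close>

text \<open>
  Dominated by an integrable exponential, \<open>f\<close> is absolutely integrable; the limit is then a case of
  dominated convergence.
\<close>

lemma exp_dominated_improper_integral:
  fixes f :: "real \<Rightarrow> real"
  assumes cont: "continuous_on {t..} f" and "0 < \<alpha>"
    and bound: "\<And>s. t \<le> s \<Longrightarrow> \<bar>f s\<bar> \<le> C * exp (- \<alpha> * (s - t))"
  shows "f integrable_on {t..}"
    and "((\<lambda>T. integral {t..T} f) \<longlongrightarrow> integral {t..} f) at_top"
    and "\<bar>integral {t..} f\<bar> \<le> C / \<alpha>"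
proof -
  have g: "((\<lambda>s. C * exp (\<alpha> * t) * exp (- \<alpha> * s)) has_integral (C * exp (\<alpha> * t) * (exp (- \<alpha> * t) / \<alpha>))) {t..}"
    by (intro has_integral_mult_right has_integral_exp_minus_to_infinity \<open>0 < \<alpha>\<close>)
  have e1: "C * exp (\<alpha> * t) * exp (- \<alpha> * s) = C * exp (- \<alpha> * (s - t))" for s
    by (simp add: mult.assoc mult_exp_exp algebra_simps)
  have e2: "C * exp (\<alpha> * t) * (exp (- \<alpha> * t) / \<alpha>) = C / \<alpha>"
    by (simp add: mult.assoc mult_exp_exp)
  have g: "((\<lambda>s. C * exp (- \<alpha> * (s - t))) has_integral (C / \<alpha>)) {t..}" using g by (simp only: e1 e2)
  have ai: "f absolutely_integrable_on {t..}"
    using bound g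
    by (intro measurable_bounded_by_integrable_imp_absolutely_integrable
        continuous_imp_measurable_on_sets_lebesgue cont) auto
  then show fi: "f integrable_on {t..}" by (rule set_lebesgue_integral_eq_integral)
  have "((\<lambda>T. LINT s:{t..T}|lebesgue. f s) \<longlongrightarrow> (LINT s:{t..}|lebesgue. f s)) at_top"
    using ai by (intro tendsto_set_lebesgue_integral_at_top) auto
  moreover have "(LINT s:{t..T}|lebesgue. f s) = integral {t..T} f" for T
    by (intro set_lebesgue_integral_eq_integral(2) set_integrable_subset[OF ai]) auto
  ultimately show "((\<lambda>T. integral {t..T} f) \<longlongrightarrow> integral {t..} f) at_top"
    using set_lebesgue_integral_eq_integral(2)[OF ai] by simp
  have "norm (integral {t..} f) \<le> integral {t..} (\<lambda>s. C * exp (- \<alpha> * (s - t)))"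
    using bound g by (intro integral_norm_bound_integral fi) auto
  then show "\<bar>integral {t..} f\<bar> \<le> C / \<alpha>" using integral_unique[OF g] by simp
qed

lemma vnorm_nonneg [simp]: "0 \<le> vnorm v"
  by (simp add: vnorm_def scalar_prod_self_nonneg)

lemma vnorm_smult: "vnorm (c \<cdot>\<^sub>v v) = \<bar>c\<bar> * vnorm v"
  by (simp add: vnorm_def real_sqrt_mult mult.assoc[symmetric] power2_eq_square[symmetric])

locale stable_system = linear_system a n "\<lambda>t i j. A t $$ (i,j)" K
  for a n and A :: "real \<Rightarrow> rmat" and K +
  fixes \<Psi> :: "real \<Rightarrow> real \<Rightarrow> rmat"
  assumes n_pos: "0 < n"
    and A_carrier: "\<And>t. a \<le> t \<Longrightarrow> A t \<in> carrier_mat n n"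
    and trans: "transition_matrix a n A \<Psi>"
    and stable: "uniformly_asymptotically_stable a n A"
begin

abbreviation hsol where "hsol \<equiv> homogeneous_solution n A"

lemma hsol_iff_solves:
  assumes "a \<le> s"
  shows "hsol s \<xi> \<longleftrightarrow> (\<forall>t\<ge>s. \<xi> t \<in> carrier_vec n) \<and> solves s (\<lambda>_ _. 0) (\<lambda>i t. \<xi> t $ i)"
proof -
  have "has_vderiv s \<xi> (A t *\<^sub>v \<xi> t) t \<longleftrightarrow>
      (\<forall>i<n. ((\<lambda>r. \<xi> r $ i) has_real_derivative (\<Sum>j<n. A t $$ (i,j) * \<xi> t $ j) + 0) (at t within {s..}))"
    if "s \<le> t" "\<xi> t \<in> carrier_vec n" for t
    using A_carrier[of t] that assms
    by (auto simp: has_vderiv_def mult_mat_vec_sum simp del: index_mult_mat_vec)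
  then show ?thesis unfolding homogeneous_solution_def solves_def by auto
qed

lemma hsol_deriv:
  assumes "hsol s \<xi>" "a \<le> s" "s \<le> t" "i < n"
  shows "((\<lambda>r. \<xi> r $ i) has_real_derivative (\<Sum>j<n. A t $$ (i,j) * \<xi> t $ j) + 0) (at t within {s..})"
  using assms(1) assms(3,4) unfolding hsol_iff_solves[OF assms(2)] solves_def by blast

lemma hsol_carrier: "hsol s \<xi> \<Longrightarrow> s \<le> t \<Longrightarrow> \<xi> t \<in> carrier_vec n"
  unfolding homogeneous_solution_def by auto

lemma hsol_restart:
  assumes "hsol s \<xi>" "s \<le> s'" shows "hsol s' \<xi>"
  using assms unfolding homogeneous_solution_def has_vderiv_def
  by (auto intro: DERIV_subset[where s = "{s..}"] simp del: index_mult_mat_vec)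

lemma Psi_carrier: "a \<le> s \<Longrightarrow> a \<le> t \<Longrightarrow> \<Psi> t s \<in> carrier_mat n n"
  using trans unfolding transition_matrix_def by auto

lemma Psi_deriv:
  assumes "a \<le> s" "a \<le> t" "i < n" "j < n"
  shows "((\<lambda>r. \<Psi> r s $$ (i,j)) has_real_derivative (\<Sum>k<n. A t $$ (i,k) * \<Psi> t s $$ (k,j))) (at t within {a..})"
proof -
  have "has_mderiv a (\<lambda>r. \<Psi> r s) (A t * \<Psi> t s) t" using trans assms unfolding transition_matrix_def by auto
  then have "((\<lambda>r. \<Psi> r s $$ (i,j)) has_real_derivative (A t * \<Psi> t s) $$ (i,j)) (at t within {a..})"
    using assms Psi_carrier[of s t] unfolding has_mderiv_def by auto
  moreover have "(A t * \<Psi> t s) $$ (i,j) = (\<Sum>k<n. A t $$ (i,k) * \<Psi> t s $$ (k,j))"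
    using assms Psi_carrier[of s t] A_carrier[of t] by (simp add: scalar_prod_def atLeast0LessThan)
  ultimately show ?thesis by simp
qed

lemma Psi_cont:
  assumes "a \<le> s" "i < n" "j < n" shows "continuous_on {s..} (\<lambda>r. \<Psi> r s $$ (i,j))"
proof (rule continuous_on_subset)
  show "continuous_on {a..} (\<lambda>r. \<Psi> r s $$ (i,j))"
    using Psi_deriv[OF assms(1) _ assms(2,3)] by (rule continuous_on_halfline_of_deriv)
qed (use assms in auto)

lemma hsol_Psi:
  assumes "a \<le> s" "v \<in> carrier_vec n" shows "hsol s (\<lambda>t. \<Psi> t s *\<^sub>v v)"
  unfolding hsol_iff_solves[OF assms(1)] solves_def
proof (intro conjI allI impI)
  fix t i assume t: "s \<le> t" and i: "i < n"
  have at: "a \<le> t" using t assms by simp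
  have "((\<lambda>r. \<Sum>j<n. \<Psi> r s $$ (i,j) * v $ j) has_real_derivative
      (\<Sum>j<n. (\<Sum>k<n. A t $$ (i,k) * \<Psi> t s $$ (k,j)) * v $ j)) (at t within {s..})"
  proof (intro DERIV_sum DERIV_cmult_right)
    fix j assume "j \<in> {..<n}"
    then show "((\<lambda>r. \<Psi> r s $$ (i,j)) has_real_derivative (\<Sum>k<n. A t $$ (i,k) * \<Psi> t s $$ (k,j))) (at t within {s..})"
      using Psi_deriv[OF assms(1) at i, of j] assms(1) by (auto intro: DERIV_subset)
  qed
  moreover have "(\<Sum>j<n. (\<Sum>k<n. A t $$ (i,k) * \<Psi> t s $$ (k,j)) * v $ j) = (\<Sum>k<n. A t $$ (i,k) * (\<Psi> t s *\<^sub>v v) $ k) + 0"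
  proof -
    have "(\<Psi> t s *\<^sub>v v) $ k = (\<Sum>j<n. \<Psi> t s $$ (k,j) * v $ j)" if "k < n" for k
      using Psi_carrier[OF assms(1) at] assms(2) that by (rule mult_mat_vec_sum)
    then show ?thesis
      by (simp add: sum_distrib_left sum_distrib_right mult.assoc) (rule sum.swap)
  qed
  moreover have "(\<Psi> r s *\<^sub>v v) $ i = (\<Sum>j<n. \<Psi> r s $$ (i,j) * v $ j)" if "r \<in> {s..}" for r
    using Psi_carrier[OF assms(1), of r] assms that i by (intro mult_mat_vec_sum) auto
  ultimately show "((\<lambda>r. (\<Psi> r s *\<^sub>v v) $ i) has_real_derivative
      (\<Sum>k<n. A t $$ (i,k) * (\<Psi> t s *\<^sub>v v) $ k) + 0) (at t within {s..})"
    using t by (subst has_field_derivative_cong_eventually[where g = "\<lambda>r. \<Sum>j<n. \<Psi> r s $$ (i,j) * v $ j"])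
      (auto simp: eventually_at_filter)
next
  fix t assume "s \<le> t"
  then show "\<Psi> t s *\<^sub>v v \<in> carrier_vec n"
    using assms by (intro mult_mat_vec_carrier[OF Psi_carrier]) auto
qed

lemma hsol_unique:
  assumes "hsol s \<xi>" "a \<le> s" "s \<le> t"
  shows "\<xi> t = \<Psi> t s *\<^sub>v \<xi> s"
proof (rule eq_vecI)
  have c: "\<xi> s \<in> carrier_vec n" using hsol_carrier[OF assms(1)] by simp
  have ct: "\<xi> t \<in> carrier_vec n" using hsol_carrier[OF assms(1,3)] .
  show "dim_vec (\<xi> t) = dim_vec (\<Psi> t s *\<^sub>v \<xi> s)" using Psi_carrier[of s t] assms ct by auto
  fix i assume "i < dim_vec (\<Psi> t s *\<^sub>v \<xi> s)"
  then have i: "i < n" using Psi_carrier[of s t] assms by auto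
  have "\<Psi> s s = 1\<^sub>m n" using trans assms unfolding transition_matrix_def by auto
  then have "(\<Psi> s s *\<^sub>v \<xi> s) $ j = \<xi> s $ j" if "j < n" for j using c by simp
  then have init: "\<xi> s $ j = (\<Psi> s s *\<^sub>v \<xi> s) $ j" if "j < n" for j using that by simp
  have 1: "solves s (\<lambda>_ _. 0) (\<lambda>i t. \<xi> t $ i)"
    using assms(1) unfolding hsol_iff_solves[OF assms(2)] by (rule conjunct2)
  have 2: "solves s (\<lambda>_ _. 0) (\<lambda>i t. (\<Psi> t s *\<^sub>v \<xi> s) $ i)"
    using hsol_Psi[OF assms(2) c] unfolding hsol_iff_solves[OF assms(2)] by (rule conjunct2)
  show "\<xi> t $ i = (\<Psi> t s *\<^sub>v \<xi> s) $ i"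
    by (rule solution_unique[OF 1 2 assms(2,3) init i])
qed

lemma hsol_smult:
  assumes "hsol s \<xi>" "a \<le> s" shows "hsol s (\<lambda>t. c \<cdot>\<^sub>v \<xi> t)"
proof -
  have "((\<lambda>r. (c \<cdot>\<^sub>v \<xi> r) $ i) has_real_derivative (\<Sum>j<n. A t $$ (i,j) * (c \<cdot>\<^sub>v \<xi> t) $ j) + 0) (at t within {s..})"
    if "s \<le> t" "i < n" for t i
  proof -
    have "((\<lambda>r. \<xi> r $ i) has_real_derivative (\<Sum>j<n. A t $$ (i,j) * \<xi> t $ j)) (at t within {s..})"
      using assms that unfolding hsol_iff_solves[OF assms(2)] solves_def by auto
    then have "((\<lambda>r. c * \<xi> r $ i) has_real_derivative c * (\<Sum>j<n. A t $$ (i,j) * \<xi> t $ j)) (at t within {s..})"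
      by (rule DERIV_cmult)
    moreover have "c * (\<Sum>j<n. A t $$ (i,j) * \<xi> t $ j) = (\<Sum>j<n. A t $$ (i,j) * (c \<cdot>\<^sub>v \<xi> t) $ j) + 0"
      using hsol_carrier[OF assms(1) that(1)] by (simp add: sum_distrib_left mult_ac)
    moreover have "(c \<cdot>\<^sub>v \<xi> r) $ i = c * \<xi> r $ i" if "r \<in> {s..}" for r
      using hsol_carrier[OF assms(1), of r] that \<open>i < n\<close> by auto
    ultimately show ?thesis
      using that by (subst has_field_derivative_cong_eventually[where g = "\<lambda>r. c * \<xi> r $ i"])
        (auto simp: eventually_at_filter)
  qed
  then show ?thesis using assms hsol_carrier unfolding hsol_iff_solves[OF assms(2)] solves_def by auto
qed

lemma hsol_energy_sum: "hsol s \<xi> \<Longrightarrow> s \<le> t \<Longrightarrow> scalar_prod (\<xi> t) (\<xi> t) = (\<Sum>i<n. (\<xi> t $ i)\<^sup>2)"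
  using hsol_carrier by (simp add: scalar_prod_sum power2_eq_square)

lemma hsol_zero:
  assumes "hsol s \<xi>" "a \<le> s" "s \<le> t" "vnorm (\<xi> s) = 0" shows "vnorm (\<xi> t) = 0"
proof -
  have "\<xi> s = 0\<^sub>v n"
    using assms(4) hsol_carrier[OF assms(1) order_refl] scalar_prod_self_eq_0[of "\<xi> s" n]
    by (simp add: vnorm_def)
  then have "\<xi> t = 0\<^sub>v n" using hsol_unique[OF assms(1-3)] Psi_carrier[of s t] assms(2,3)
    by (intro eq_vecI) auto
  then show ?thesis by (simp add: vnorm_def)
qed

text \<open>
  Solutions form a linear space, so a bound for solutions that start on the sphere of radius \<open>\<delta>\<close>
  holds for all solutions after scaling.
\<close>

lemma scaled_bound:
  assumes h: "hsol s \<xi>" "a \<le> s" "s \<le> t" and "0 < \<delta>"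
    and bound: "\<And>\<zeta>. hsol s \<zeta> \<Longrightarrow> vnorm (\<zeta> s) = \<delta> \<Longrightarrow> vnorm (\<zeta> t) \<le> \<epsilon>"
  shows "vnorm (\<xi> t) \<le> \<epsilon> / \<delta> * vnorm (\<xi> s)"
proof (cases "vnorm (\<xi> s) = 0")
  case True then show ?thesis using hsol_zero[OF h] by simp
next
  case False
  then have p: "0 < vnorm (\<xi> s)" using vnorm_nonneg[of "\<xi> s"] by linarith
  define c where "c = \<delta> / vnorm (\<xi> s)"
  have c: "0 < c" using p \<open>0 < \<delta>\<close> by (simp add: c_def)
  have "vnorm (c \<cdot>\<^sub>v \<xi> t) \<le> \<epsilon>"
  proof (rule bound[OF hsol_smult[OF h(1,2)]])
    show "vnorm (c \<cdot>\<^sub>v \<xi> s) = \<delta>" using p \<open>0 < \<delta>\<close> by (simp add: vnorm_smult c_def)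
  qed
  then have "c * vnorm (\<xi> t) \<le> \<epsilon>" using c by (simp add: vnorm_smult)
  then show ?thesis using p \<open>0 < \<delta>\<close> by (simp add: c_def field_simps)
qed

text \<open>
  By uniform attractivity and scaling, every solution has halved after a time \<open>T\<close> that depends on
  neither the solution nor its initial time. Iterating this, and using uniform stability in between,
  gives decay at the rate \<open>ln 2 / T\<close>.
\<close>

lemma exponentially_stable:
  obtains \<kappa> \<alpha> where "0 < \<kappa>" "0 < \<alpha>"
    "\<And>s t \<xi>. hsol s \<xi> \<Longrightarrow> a \<le> s \<Longrightarrow> s \<le> t \<Longrightarrow> vnorm (\<xi> t) \<le> \<kappa> * exp (- \<alpha> * (t - s)) * vnorm (\<xi> s)"
proof -
  have us: "uniformly_stable a n A" using stable by (simp add: uniformly_asymptotically_stable_def)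
  have z1: "(0::real) < 1" by simp
  obtain \<delta> where d: "0 < \<delta>"
    "\<forall>s\<ge>a. \<forall>\<xi>. hsol s \<xi> \<and> vnorm (\<xi> s) < \<delta> \<longrightarrow> (\<forall>t\<ge>s. vnorm (\<xi> t) < 1)"
    using mp[OF spec[OF us[unfolded uniformly_stable_def], of 1] z1] by (elim exE conjE) (rule that)
  define B where "B = 1 / (\<delta> / 2)"
  have B: "0 < B" using d(1) by (simp add: B_def)
  have st: "vnorm (\<xi> t) \<le> B * vnorm (\<xi> s)" if "hsol s \<xi>" "a \<le> s" "s \<le> t" for s t \<xi>
    unfolding B_def
  proof (rule scaled_bound[OF that])
    fix \<zeta> assume "hsol s \<zeta>" "vnorm (\<zeta> s) = \<delta> / 2"
    then have "hsol s \<zeta> \<and> vnorm (\<zeta> s) < \<delta>" using d(1) by simp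
    from d(2)[rule_format, OF that(2) this that(3)]
    show "vnorm (\<zeta> t) \<le> 1" by simp
  qed (use d(1) in simp)
  have "uniformly_attractive a n A" using stable by (simp add: uniformly_asymptotically_stable_def)
  then obtain c where c: "0 < c"
    "\<forall>\<epsilon>>0. \<exists>T>0. \<forall>s\<ge>a. \<forall>\<xi>. hsol s \<xi> \<and> vnorm (\<xi> s) < c \<longrightarrow> (\<forall>t\<ge>s + T. vnorm (\<xi> t) < \<epsilon>)"
    unfolding uniformly_attractive_def by (elim exE conjE) (rule that)
  \<comment> \<open>Solutions that start at norm \<open>c / 2\<close> are within \<open>c / 4\<close> of zero after time \<open>T\<close>: a factor of one half.\<close>
  have c4: "0 < c / 4" using c(1) by simp
  obtain T where T: "0 < T"
    "\<forall>s\<ge>a. \<forall>\<xi>. hsol s \<xi> \<and> vnorm (\<xi> s) < c \<longrightarrow> (\<forall>t\<ge>s + T. vnorm (\<xi> t) < c / 4)"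
    using mp[OF spec[OF c(2), of "c / 4"] c4] by (elim exE conjE) (rule that)
  have half: "vnorm (\<xi> (s + T)) \<le> 1/2 * vnorm (\<xi> s)" if "hsol s \<xi>" "a \<le> s" for s \<xi>
  proof -
    have "vnorm (\<xi> (s + T)) \<le> (c / 4) / (c / 2) * vnorm (\<xi> s)"
    proof (rule scaled_bound[OF that])
      fix \<zeta> assume "hsol s \<zeta>" "vnorm (\<zeta> s) = c / 2"
      then have "hsol s \<zeta> \<and> vnorm (\<zeta> s) < c" using c(1) by simp
      from T(2)[rule_format, OF that(2) this order_refl]
      show "vnorm (\<zeta> (s + T)) \<le> c / 4" by simp
    qed (use c(1) T(1) in simp_all)
    also have "(c / 4) / (c / 2) = 1/2" using c(1) by (simp add: field_simps)
    finally show ?thesis .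
  qed
  have iter: "vnorm (\<xi> (s + real k * T)) \<le> (1/2) ^ k * vnorm (\<xi> s)" if "hsol s \<xi>" "a \<le> s" for s \<xi> k
  proof (induction k)
    case (Suc k)
    have le: "s \<le> s + real k * T" using T(1) by simp
    have "vnorm (\<xi> (s + real k * T + T)) \<le> 1/2 * vnorm (\<xi> (s + real k * T))"
      using hsol_restart[OF that(1) le] that(2) le by (intro half) auto
    also have "\<dots> \<le> 1/2 * ((1/2) ^ k * vnorm (\<xi> s))" using Suc by simp
    finally show ?case by (simp add: algebra_simps)
  qed simp
  define \<alpha> where "\<alpha> = ln 2 / T"
  have "vnorm (\<xi> t) \<le> 2 * B * exp (- \<alpha> * (t - s)) * vnorm (\<xi> s)" if h: "hsol s \<xi>" "a \<le> s" "s \<le> t" for s t \<xi>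
  proof -
    \<comment> \<open>The number of completed halving periods. It falls short of \<open>(t - s) / T\<close> by at most one, which costs the factor 2.\<close>
    define k where "k = nat \<lfloor>(t - s) / T\<rfloor>"
    have "0 \<le> (t - s) / T" using h(3) T(1) by simp
    then have k: "real k \<le> (t - s) / T" "(t - s) / T \<le> real k + 1" unfolding k_def by linarith+
    have kT: "s + real k * T \<le> t" using k(1) T(1) by (simp add: field_simps)
    have le: "s \<le> s + real k * T" using T(1) by simp
    have "vnorm (\<xi> t) \<le> B * vnorm (\<xi> (s + real k * T))"
      using hsol_restart[OF h(1) le] h(2) le kT by (intro st) auto
    also have "\<dots> \<le> B * ((1/2) ^ k * vnorm (\<xi> s))" using iter[OF h(1,2), of k] B by simp
    also have "\<dots> \<le> B * ((2 * exp (- \<alpha> * (t - s))) * vnorm (\<xi> s))"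
    proof -
      have "(1/2) ^ k = exp (- (real k * ln 2))"
        by (simp add: exp_minus exp_of_nat_mult power_one_over inverse_eq_divide)
      also have "\<dots> \<le> exp (ln 2 - \<alpha> * (t - s))"
      proof -
        have "(t - s) / T * ln 2 \<le> (real k + 1) * ln 2" using k(2) by (intro mult_right_mono) auto
        then show ?thesis by (simp add: \<alpha>_def algebra_simps)
      qed
      also have "\<dots> = 2 * exp (- \<alpha> * (t - s))" by (simp add: exp_diff exp_minus inverse_eq_divide)
      finally show ?thesis using B by (intro mult_left_mono mult_right_mono) auto
    qed
    finally show ?thesis by (simp add: mult_ac)
  qed
  moreover have "0 < \<alpha>" using T(1) by (simp add: \<alpha>_def)
  ultimately show ?thesis using that[of "2 * B" \<alpha>] B by simp
qed

definition energy :: "real \<Rightarrow> rvec \<Rightarrow> real \<Rightarrow> real" where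
  "energy t v s = scalar_prod (\<Psi> s t *\<^sub>v v) (\<Psi> s t *\<^sub>v v)"

lemma gramian_integrand_entry:
  assumes "a \<le> t" "t \<le> s" "i < n" "j < n"
  shows "gramian_integrand \<Psi> t s $$ (i,j) = (\<Sum>k<n. \<Psi> s t $$ (k,i) * \<Psi> s t $$ (k,j))"
  using assms Psi_carrier[of t s] by (simp add: gramian_integrand_def Let_def scalar_prod_def atLeast0LessThan)

lemma energy_entries:
  assumes "a \<le> t" "t \<le> s" "v \<in> carrier_vec n"
  shows "energy t v s = (\<Sum>i<n. \<Sum>j<n. v $ i * v $ j * gramian_integrand \<Psi> t s $$ (i,j))"
proof -
  have c: "\<Psi> s t \<in> carrier_mat n n" using Psi_carrier assms by simp
  have "energy t v s = (\<Sum>k<n. (\<Sum>i<n. \<Psi> s t $$ (k,i) * v $ i) * (\<Sum>j<n. \<Psi> s t $$ (k,j) * v $ j))"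
    unfolding energy_def using c assms
    by (subst scalar_prod_sum[of _ n]) (auto simp: mult_mat_vec_sum[OF c] simp del: index_mult_mat_vec)
  also have "\<dots> = (\<Sum>k<n. \<Sum>i<n. \<Sum>j<n. v $ i * v $ j * (\<Psi> s t $$ (k,i) * \<Psi> s t $$ (k,j)))"
    by (simp add: sum_product mult_ac)
  also have "\<dots> = (\<Sum>i<n. \<Sum>j<n. \<Sum>k<n. v $ i * v $ j * (\<Psi> s t $$ (k,i) * \<Psi> s t $$ (k,j)))"
    by (subst sum.swap, rule sum.cong[OF refl], rule sum.swap)
  also have "\<dots> = (\<Sum>i<n. \<Sum>j<n. v $ i * v $ j * gramian_integrand \<Psi> t s $$ (i,j))"
    using assms by (simp add: gramian_integrand_entry sum_distrib_left)
  finally show ?thesis .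
qed

lemma energy_bounds:
  obtains \<kappa> \<alpha> where "0 < \<kappa>" "0 < \<alpha>"
    "\<And>t s v. a \<le> t \<Longrightarrow> t \<le> s \<Longrightarrow> v \<in> carrier_vec n \<Longrightarrow> energy t v s \<le> \<kappa> * exp (- \<alpha> * (s - t)) * scalar_prod v v"
proof -
  obtain \<kappa> \<alpha> where k: "0 < \<kappa>" "0 < \<alpha>"
    "\<And>s t \<xi>. hsol s \<xi> \<Longrightarrow> a \<le> s \<Longrightarrow> s \<le> t \<Longrightarrow> vnorm (\<xi> t) \<le> \<kappa> * exp (- \<alpha> * (t - s)) * vnorm (\<xi> s)"
    using exponentially_stable by blast
  have "energy t v s \<le> \<kappa>\<^sup>2 * exp (- (2 * \<alpha>) * (s - t)) * scalar_prod v v"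
    if "a \<le> t" "t \<le> s" "v \<in> carrier_vec n" for t s v
  proof -
    have "\<Psi> t t *\<^sub>v v = v" using trans that unfolding transition_matrix_def by simp
    then have "vnorm (\<Psi> s t *\<^sub>v v) \<le> \<kappa> * exp (- \<alpha> * (s - t)) * vnorm v"
      using k(3)[OF hsol_Psi[OF that(1,3)] that(1,2)] by simp
    then have "(vnorm (\<Psi> s t *\<^sub>v v))\<^sup>2 \<le> (\<kappa> * exp (- \<alpha> * (s - t)) * vnorm v)\<^sup>2"
      by (intro power_mono vnorm_nonneg)
    also have "\<dots> = \<kappa>\<^sup>2 * (exp (- \<alpha> * (s - t)))\<^sup>2 * (vnorm v)\<^sup>2" by (simp only: power_mult_distrib)
    also have "(exp (- \<alpha> * (s - t)))\<^sup>2 = exp (- (2 * \<alpha>) * (s - t))" by (simp add: exp_double[symmetric])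
    finally show ?thesis by (simp only: energy_def vnorm_sq)
  qed
  then show ?thesis using that[of "\<kappa>\<^sup>2" "2 * \<alpha>"] k by simp
qed

lemma energy_lower:
  assumes "a \<le> t" "t \<le> s" "v \<in> carrier_vec n"
  shows "exp (- (2 * real n * \<bar>K\<bar> + 1) * (s - t)) * scalar_prod v v \<le> energy t v s"
proof -
  have h: "hsol t (\<lambda>s. \<Psi> s t *\<^sub>v v)" by (rule hsol_Psi[OF assms(1,3)])
  have "\<Psi> t t *\<^sub>v v = v" using trans assms unfolding transition_matrix_def by simp
  then show ?thesis
    using energy_decay_bound[of t "\<lambda>i s. (\<Psi> s t *\<^sub>v v) $ i" s] h assms
      hsol_energy_sum[OF h order_refl] hsol_energy_sum[OF h assms(2)]
    unfolding energy_def hsol_iff_solves[OF assms(1)] by simp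
qed

lemma integrand_cont:
  assumes "a \<le> t" "i < n" "j < n" shows "continuous_on {t..} (\<lambda>s. gramian_integrand \<Psi> t s $$ (i,j))"
proof -
  have "continuous_on {t..} (\<lambda>s. \<Sum>k<n. \<Psi> s t $$ (k,i) * \<Psi> s t $$ (k,j))"
    using Psi_cont assms by (intro continuous_on_sum continuous_on_mult) auto
  then show ?thesis by (rule continuous_on_eq) (use gramian_integrand_entry assms in auto)
qed

text \<open>
  The diagonal entries of the integrand are the energies of the solutions starting at unit vectors, and
  these dominate the other entries.
\<close>

lemma integrand_bound:
  assumes "a \<le> t" "t \<le> s" "i < n" "j < n"
  shows "2 * \<bar>gramian_integrand \<Psi> t s $$ (i,j)\<bar> \<le> energy t (unit_vec n i) s + energy t (unit_vec n j) s"
proof -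
  have c: "\<Psi> s t \<in> carrier_mat n n" using Psi_carrier assms by simp
  have e: "energy t (unit_vec n i) s = (\<Sum>k<n. (\<Psi> s t $$ (k,i))\<^sup>2)" if "i < n" for i
  proof -
    have "(\<Psi> s t *\<^sub>v unit_vec n i) $ k = \<Psi> s t $$ (k,i)" if "k < n" for k
      using c that \<open>i < n\<close> by simp
    then show ?thesis unfolding energy_def using c
      by (subst scalar_prod_sum[of _ n]) (auto simp: power2_eq_square simp del: index_mult_mat_vec)
  qed
  have "2 * \<bar>gramian_integrand \<Psi> t s $$ (i,j)\<bar> \<le> (\<Sum>k<n. 2 * \<bar>\<Psi> s t $$ (k,i) * \<Psi> s t $$ (k,j)\<bar>)"
    unfolding gramian_integrand_entry[OF assms] sum_distrib_left[symmetric] by simp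
  also have "\<dots> \<le> (\<Sum>k<n. (\<Psi> s t $$ (k,i))\<^sup>2 + (\<Psi> s t $$ (k,j))\<^sup>2)"
  proof (rule sum_mono)
    fix k
    show "2 * \<bar>\<Psi> s t $$ (k,i) * \<Psi> s t $$ (k,j)\<bar> \<le> (\<Psi> s t $$ (k,i))\<^sup>2 + (\<Psi> s t $$ (k,j))\<^sup>2"
      using sum_squares_bound[of "\<bar>\<Psi> s t $$ (k,i)\<bar>" "\<bar>\<Psi> s t $$ (k,j)\<bar>"] by (simp add: abs_mult)
  qed
  finally show ?thesis by (simp add: e assms sum.distrib)
qed

lemma gramian_exists:
  assumes "a \<le> t" "i < n" "j < n"
  shows "t \<le> T \<Longrightarrow> (\<lambda>s. gramian_integrand \<Psi> t s $$ (i,j)) integrable_on {t..T}"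
    and "((\<lambda>s. gramian_integrand \<Psi> t s $$ (i,j)) has_integral gramian n \<Psi> t $$ (i,j)) {t..}"
    and "((\<lambda>T. gramian_upto n \<Psi> t T $$ (i,j)) \<longlongrightarrow> gramian n \<Psi> t $$ (i,j)) at_top"
proof -
  obtain \<kappa> \<alpha> where k: "0 < \<kappa>" "0 < \<alpha>"
    "\<And>t s v. a \<le> t \<Longrightarrow> t \<le> s \<Longrightarrow> v \<in> carrier_vec n \<Longrightarrow> energy t v s \<le> \<kappa> * exp (- \<alpha> * (s - t)) * scalar_prod v v"
    using energy_bounds by blast
  have b: "\<bar>gramian_integrand \<Psi> t s $$ (i,j)\<bar> \<le> \<kappa> * exp (- \<alpha> * (s - t))" if "t \<le> s" for s
    using integrand_bound[OF assms(1) that assms(2,3)] k(3)[OF assms(1) that, of "unit_vec n i"]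
      k(3)[OF assms(1) that, of "unit_vec n j"] assms(2,3) by simp
  note I = exp_dominated_improper_integral[OF integrand_cont[OF assms] k(2) b]
  show "t \<le> T \<Longrightarrow> (\<lambda>s. gramian_integrand \<Psi> t s $$ (i,j)) integrable_on {t..T}"
    by (intro integrable_continuous_real continuous_on_subset[OF integrand_cont[OF assms]]) auto
  have up: "gramian_upto n \<Psi> t T $$ (i,j) = integral {t..T} (\<lambda>s. gramian_integrand \<Psi> t s $$ (i,j))" for T
    using assms by (simp add: gramian_upto_def)
  have lim: "((\<lambda>T. gramian_upto n \<Psi> t T $$ (i,j)) \<longlongrightarrow> integral {t..} (\<lambda>s. gramian_integrand \<Psi> t s $$ (i,j))) at_top"
    unfolding up by (rule I(2))
  then have g: "gramian n \<Psi> t $$ (i,j) = integral {t..} (\<lambda>s. gramian_integrand \<Psi> t s $$ (i,j))"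
    using assms by (simp add: gramian_def tendsto_Lim)
  show "((\<lambda>s. gramian_integrand \<Psi> t s $$ (i,j)) has_integral gramian n \<Psi> t $$ (i,j)) {t..}"
    unfolding g by (rule integrable_integral, rule I(1))
  show "((\<lambda>T. gramian_upto n \<Psi> t T $$ (i,j)) \<longlongrightarrow> gramian n \<Psi> t $$ (i,j)) at_top"
    using lim unfolding g .
qed

lemma gramian_carrier: "gramian n \<Psi> t \<in> carrier_mat n n" by (simp add: gramian_def)

lemma gramian_symmetric:
  assumes "a \<le> t" shows "(gramian n \<Psi> t)\<^sup>T = gramian n \<Psi> t"
proof (rule eq_matI)
  fix i j assume "i < dim_row (gramian n \<Psi> t)" "j < dim_col (gramian n \<Psi> t)"
  then have ij: "i < n" "j < n" by (simp_all add: gramian_def)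
  have "((\<lambda>s. gramian_integrand \<Psi> t s $$ (i,j)) has_integral gramian n \<Psi> t $$ (j,i)) {t..}"
  proof (rule has_integral_eq[OF _ gramian_exists(2)[OF assms ij(2,1)]])
    fix s assume "s \<in> {t..}"
    then show "gramian_integrand \<Psi> t s $$ (j,i) = gramian_integrand \<Psi> t s $$ (i,j)"
      using assms ij by (simp add: gramian_integrand_entry mult.commute)
  qed
  then have "gramian n \<Psi> t $$ (j,i) = gramian n \<Psi> t $$ (i,j)"
    using gramian_exists(2)[OF assms ij] by (rule has_integral_unique)
  then show "(gramian n \<Psi> t)\<^sup>T $$ (i,j) = gramian n \<Psi> t $$ (i,j)"
    using ij by (simp add: gramian_def)
qed (simp_all add: gramian_def)

text \<open>
  The identity that makes the Gramian a Lyapunov function: its quadratic form at \<open>v\<close> is the total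
  energy of the solution through \<open>v\<close> at time \<open>t\<close>.
\<close>

lemma gramian_quadratic_form:
  assumes "a \<le> t" "v \<in> carrier_vec n"
  shows "(energy t v has_integral scalar_prod v (gramian n \<Psi> t *\<^sub>v v)) {t..}"
proof -
  have "((\<lambda>s. \<Sum>i<n. \<Sum>j<n. v $ i * v $ j * gramian_integrand \<Psi> t s $$ (i,j)) has_integral
      (\<Sum>i<n. \<Sum>j<n. v $ i * v $ j * gramian n \<Psi> t $$ (i,j))) {t..}"
    using assms by (intro has_integral_sum has_integral_mult_right gramian_exists(2)) auto
  moreover have "(\<Sum>i<n. \<Sum>j<n. v $ i * v $ j * gramian n \<Psi> t $$ (i,j)) = scalar_prod v (gramian n \<Psi> t *\<^sub>v v)"
    using assms gramian_carrier[of t]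
    by (subst scalar_prod_sum[of _ n])
      (auto simp: mult_mat_vec_sum sum_distrib_left mult_ac simp del: index_mult_mat_vec)
  ultimately have "((\<lambda>s. \<Sum>i<n. \<Sum>j<n. v $ i * v $ j * gramian_integrand \<Psi> t s $$ (i,j)) has_integral
      scalar_prod v (gramian n \<Psi> t *\<^sub>v v)) {t..}" by simp
  then show ?thesis
    by (rule has_integral_eq[rotated]) (use energy_entries assms in auto)
qed

text \<open>
  Integrals of the exponential upper and lower bounds on the energy of a solution.
\<close>

lemma gramian_bounds:
  obtains c C where "0 < c" "0 < C"
    "\<And>t v. a \<le> t \<Longrightarrow> v \<in> carrier_vec n \<Longrightarrow> c * scalar_prod v v \<le> scalar_prod v (gramian n \<Psi> t *\<^sub>v v)"
    "\<And>t v. a \<le> t \<Longrightarrow> v \<in> carrier_vec n \<Longrightarrow> scalar_prod v (gramian n \<Psi> t *\<^sub>v v) \<le> C * scalar_prod v v"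
proof -
  obtain \<kappa> \<alpha> where k: "0 < \<kappa>" "0 < \<alpha>"
    "\<And>t s v. a \<le> t \<Longrightarrow> t \<le> s \<Longrightarrow> v \<in> carrier_vec n \<Longrightarrow> energy t v s \<le> \<kappa> * exp (- \<alpha> * (s - t)) * scalar_prod v v"
    using energy_bounds by blast
  have expi: "((\<lambda>s. exp (- b * (s - t))) has_integral 1 / b) {t..}" if "0 < b" for b t :: real
  proof -
    have "((\<lambda>s. exp (b * t) * exp (- b * s)) has_integral (exp (b * t) * (exp (- b * t) / b))) {t..}"
      by (intro has_integral_mult_right has_integral_exp_minus_to_infinity that)
    moreover have "exp (b * t) * exp (- b * s) = exp (- b * (s - t))" for s
      by (simp add: mult_exp_exp algebra_simps)
    moreover have "exp (b * t) * (exp (- b * t) / b) = 1 / b" by (simp add: mult_exp_exp)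
    ultimately show ?thesis by (simp only:)
  qed
  \<comment> \<open>The rate in \<open>energy_lower\<close>.\<close>
  define \<mu> where "\<mu> = 2 * real n * \<bar>K\<bar> + 1"
  have mu: "0 < \<mu>" unfolding \<mu>_def by (simp add: add_nonneg_pos)
  have low: "1 / \<mu> * scalar_prod v v \<le> scalar_prod v (gramian n \<Psi> t *\<^sub>v v)"
    if "a \<le> t" "v \<in> carrier_vec n" for t v
    using has_integral_mult_left[OF expi[OF mu]] gramian_quadratic_form[OF that]
    by (rule has_integral_le) (use energy_lower that in \<open>auto simp: \<mu>_def\<close>)
  have up: "scalar_prod v (gramian n \<Psi> t *\<^sub>v v) \<le> \<kappa> * (1 / \<alpha>) * scalar_prod v v"
    if "a \<le> t" "v \<in> carrier_vec n" for t v
    using gramian_quadratic_form[OF that] has_integral_mult_left[OF has_integral_mult_right[OF expi[OF k(2)]]]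
    by (rule has_integral_le) (use k(3) that in auto)
  show ?thesis using that[of "1 / \<mu>" "\<kappa> * (1 / \<alpha>)"] mu k(1,2) low up by simp
qed

lemma gramian_pos_def: assumes "a \<le> t" shows "pos_def n (gramian n \<Psi> t)"
proof -
  obtain c C where c: "0 < c" "0 < C"
    "\<And>t v. a \<le> t \<Longrightarrow> v \<in> carrier_vec n \<Longrightarrow> c * scalar_prod v v \<le> scalar_prod v (gramian n \<Psi> t *\<^sub>v v)"
    "\<And>t v. a \<le> t \<Longrightarrow> v \<in> carrier_vec n \<Longrightarrow> scalar_prod v (gramian n \<Psi> t *\<^sub>v v) \<le> C * scalar_prod v v"
    using gramian_bounds by blast
  have "0 < scalar_prod v (gramian n \<Psi> t *\<^sub>v v)" if v: "v \<in> carrier_vec n" "v \<noteq> 0\<^sub>v n" for v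
  proof -
    have "0 < scalar_prod v v" using v scalar_prod_self_eq_0[of v n] scalar_prod_self_nonneg[of v] by linarith
    then show ?thesis using c(3)[OF assms v(1)] mult_pos_pos[OF c(1)] by fastforce
  qed
  then show ?thesis unfolding pos_def_def using gramian_carrier gramian_symmetric[OF assms] by blast
qed

lemma gramian_spectrum:
  shows "bdd_above ((\<lambda>t. lam_max (gramian n \<Psi> t)) ` {a..})"
    and "bdd_below ((\<lambda>t. lam_min (gramian n \<Psi> t)) ` {a..})"
    and "0 < sup_lam_max a (gramian n \<Psi>)" and "0 < inf_lam_min a (gramian n \<Psi>)"
    and "\<And>t v. a \<le> t \<Longrightarrow> v \<in> carrier_vec n \<Longrightarrow>
      scalar_prod v (gramian n \<Psi> t *\<^sub>v v) \<le> sup_lam_max a (gramian n \<Psi>) * scalar_prod v v"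
    and "\<And>t v. a \<le> t \<Longrightarrow> v \<in> carrier_vec n \<Longrightarrow>
      inf_lam_min a (gramian n \<Psi>) * scalar_prod v v \<le> scalar_prod v (gramian n \<Psi> t *\<^sub>v v)"
proof -
  obtain c C where c: "0 < c" "0 < C"
    "\<And>t v. a \<le> t \<Longrightarrow> v \<in> carrier_vec n \<Longrightarrow> c * scalar_prod v v \<le> scalar_prod v (gramian n \<Psi> t *\<^sub>v v)"
    "\<And>t v. a \<le> t \<Longrightarrow> v \<in> carrier_vec n \<Longrightarrow> scalar_prod v (gramian n \<Psi> t *\<^sub>v v) \<le> C * scalar_prod v v"
    using gramian_bounds by blast
  note R = Rayleigh_bounds[OF gramian_carrier gramian_symmetric n_pos c(4) c(3)]
  have le: "lam_max (gramian n \<Psi> t) \<le> C" "c \<le> lam_min (gramian n \<Psi> t)"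
    "lam_min (gramian n \<Psi> t) \<le> lam_max (gramian n \<Psi> t)" if "a \<le> t" for t
    using R(1-3)[of t] that by blast+
  show ba: "bdd_above ((\<lambda>t. lam_max (gramian n \<Psi> t)) ` {a..})"
    using le by (intro bdd_aboveI2[of _ _ C]) auto
  show bb: "bdd_below ((\<lambda>t. lam_min (gramian n \<Psi> t)) ` {a..})"
    using le by (intro bdd_belowI2[of _ c]) auto
  have "c \<le> inf_lam_min a (gramian n \<Psi>)"
    unfolding inf_lam_min_def using le by (intro cINF_greatest) auto
  then show "0 < inf_lam_min a (gramian n \<Psi>)" using c(1) by simp
  have up: "lam_max (gramian n \<Psi> t) \<le> sup_lam_max a (gramian n \<Psi>)" if "a \<le> t" for t
    unfolding sup_lam_max_def using that ba by (intro cSUP_upper) auto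
  have lo: "inf_lam_min a (gramian n \<Psi>) \<le> lam_min (gramian n \<Psi> t)" if "a \<le> t" for t
    unfolding inf_lam_min_def using that bb by (intro cINF_lower) auto
  show "0 < sup_lam_max a (gramian n \<Psi>)" using up[of a] le(2,3)[of a] c(1) by simp
  fix t and v :: rvec assume tv: "a \<le> t" "v \<in> carrier_vec n"
  have "scalar_prod v (gramian n \<Psi> t *\<^sub>v v) \<le> lam_max (gramian n \<Psi> t) * scalar_prod v v"
    by (rule R(4)) (use tv in auto)
  also have "\<dots> \<le> sup_lam_max a (gramian n \<Psi>) * scalar_prod v v"
    using up[OF tv(1)] by (rule mult_right_mono) (rule scalar_prod_self_nonneg)
  finally show "scalar_prod v (gramian n \<Psi> t *\<^sub>v v) \<le> sup_lam_max a (gramian n \<Psi>) * scalar_prod v v" .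
  have "inf_lam_min a (gramian n \<Psi>) * scalar_prod v v \<le> lam_min (gramian n \<Psi> t) * scalar_prod v v"
    using lo[OF tv(1)] by (rule mult_right_mono) (rule scalar_prod_self_nonneg)
  also have "\<dots> \<le> scalar_prod v (gramian n \<Psi> t *\<^sub>v v)"
    by (rule R(5)) (use tv in auto)
  finally show "inf_lam_min a (gramian n \<Psi>) * scalar_prod v v \<le> scalar_prod v (gramian n \<Psi> t *\<^sub>v v)" .
qed

text \<open>
  The Lyapunov function \<open>J(t)\<close> is the energy that the solution has left from time \<open>t\<close> on, so \<open>J' = - \<bar>\<xi>\<bar>\<^sup>2\<close>;
  together with \<open>J \<le> \<lambda> \<bar>\<xi>\<bar>\<^sup>2\<close> this makes \<open>J exp(t / \<lambda>)\<close> nonincreasing.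
\<close>

lemma solution_decay:
  assumes h: "hsol a \<xi>" and "a \<le> t"
  shows "vnorm (\<xi> t) \<le> sqrt (scalar_prod (\<xi> a) (gramian n \<Psi> a *\<^sub>v \<xi> a) / inf_lam_min a (gramian n \<Psi>)) *
    exp (- (1 / (2 * sup_lam_max a (gramian n \<Psi>))) * (t - a))"
proof -
  define J where "J = (\<lambda>t. scalar_prod (\<xi> t) (gramian n \<Psi> t *\<^sub>v \<xi> t))"
  define N where "N = (\<lambda>s. scalar_prod (\<xi> s) (\<xi> s))"
  define L where "L = sup_lam_max a (gramian n \<Psi>)"
  define l where "l = inf_lam_min a (gramian n \<Psi>)"
  have L: "0 < L" and l: "0 < l" unfolding L_def l_def by (rule gramian_spectrum)+
  have car: "\<xi> s \<in> carrier_vec n" if "a \<le> s" for s using hsol_carrier[OF h that] .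
  have Ncont: "continuous_on {a..} N"
  proof -
    have "continuous_on {a..} (\<lambda>t. \<Sum>i<n. (\<xi> t $ i)\<^sup>2)"
    proof (intro continuous_on_sum continuous_on_power)
      fix i assume "i \<in> {..<n}"
      then have i: "i < n" by simp
      show "continuous_on {a..} (\<lambda>t. \<xi> t $ i)"
        by (rule continuous_on_halfline_of_deriv[OF hsol_deriv[OF h order_refl _ i]])
    qed
    then show ?thesis unfolding N_def by (rule continuous_on_eq) (use hsol_energy_sum[OF h] in auto)
  qed
  have JN: "(N has_integral J s) {s..}" if s: "a \<le> s" for s
  proof -
    have eq: "energy s (\<xi> s) r = N r" if "r \<in> {s..}" for r
    proof -
      have "s \<le> r" using that by simp
      from hsol_unique[OF hsol_restart[OF h s] s this] show ?thesis by (simp only: energy_def N_def)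
    qed
    show ?thesis
      unfolding J_def by (rule has_integral_eq[OF eq gramian_quadratic_form[OF s car[OF s]]])
  qed
  have J_eq: "J s = J a - integral {a..s} N" if s: "a \<le> s" for s
  proof -
    have "(N has_integral integral {a..s} N) {a..s}"
      by (intro integrable_integral integrable_continuous_real continuous_on_subset[OF Ncont]) auto
    then have "(N has_integral (integral {a..s} N + J s)) ({a..s} \<union> {s..})"
    proof (rule has_integral_Un[OF _ JN[OF s]])
      have "{a..s} \<inter> {s..} = {s}" using s by auto
      then show "negligible ({a..s} \<inter> {s..})" by simp
    qed
    moreover have "{a..s} \<union> {s..} = {a..}" using s by auto
    ultimately have "integral {a..s} N + J s = J a" using has_integral_unique[OF _ JN[OF order_refl]] by simp
    then show ?thesis by simp
  qed
  have dJ: "(J has_real_derivative - N s) (at s within {a..})" if s: "a \<le> s" for s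
  proof -
    have "((\<lambda>s. J a - integral {a..s} N) has_real_derivative 0 - N s) (at s within {a..})"
      by (intro DERIV_diff DERIV_const integral_deriv_on_halfline Ncont s)
    then have "((\<lambda>s. J a - integral {a..s} N) has_real_derivative - N s) (at s within {a..})" by simp
    then show ?thesis by (rule deriv_cong_halfline[OF _ s J_eq])
  qed
  have "J t * exp ((t - a) / L) \<le> J a * exp ((a - a) / L)"
  proof (rule nonincreasing_on_halfline[where g = "\<lambda>s. J s * exp ((s - a) / L)" and
        g' = "\<lambda>s. exp ((s - a) / L) * (J s / L - N s)"])
    fix s assume s: "a \<le> s" "s \<le> t"
    show "((\<lambda>s. J s * exp ((s - a) / L)) has_real_derivative exp ((s - a) / L) * (J s / L - N s)) (at s within {a..})"
    proof -
      have "((\<lambda>s. exp ((s - a) / L)) has_real_derivative exp ((s - a) / L) * (1 / L)) (at s within {a..})"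
        using L by (auto intro!: derivative_eq_intros)
      from DERIV_mult[OF dJ[OF s(1)] this] show ?thesis
        by (rule DERIV_cong) (simp add: algebra_simps)
    qed
    have "J s \<le> L * N s" unfolding J_def L_def N_def by (rule gramian_spectrum(5)[OF s(1) car[OF s(1)]])
    then have "J s / L - N s \<le> 0" using L by (simp add: field_simps)
    then show "exp ((s - a) / L) * (J s / L - N s) \<le> 0" by (simp add: mult_le_0_iff)
  qed (fact \<open>a \<le> t\<close>)
  then have "J t \<le> J a * exp (- ((t - a) / L))" by (simp add: exp_minus field_simps)
  moreover have "l * N t \<le> J t" unfolding J_def l_def N_def by (rule gramian_spectrum(6)[OF \<open>a \<le> t\<close> car[OF \<open>a \<le> t\<close>]])
  ultimately have "l * N t \<le> J a * exp (- ((t - a) / L))" by linarith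
  then have "N t \<le> J a / l * exp (- ((t - a) / L))" using l by (simp add: field_simps)
  then have "sqrt (N t) \<le> sqrt (J a / l * exp (- ((t - a) / L)))" by (rule real_sqrt_le_mono)
  also have "\<dots> = sqrt (J a / l) * sqrt (exp (- ((t - a) / L)))" by (rule real_sqrt_mult)
  also have "sqrt (exp (- ((t - a) / L))) = exp (- (1 / (2 * L)) * (t - a))"
  proof (rule real_sqrt_unique)
    show "(exp (- (1 / (2 * L)) * (t - a)))\<^sup>2 = exp (- ((t - a) / L))"
    proof -
      have "2 * (- (1 / (2 * L)) * (t - a)) = - ((t - a) / L)" using L by (simp add: field_simps)
      then show ?thesis by (simp only: exp_double[symmetric])
    qed
  qed simp
  finally show ?thesis unfolding N_def J_def L_def l_def vnorm_def .
qed

end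

section \<open>Calculus of matrix and vector functions\<close>

lemma minv_inverse:
  assumes A: "A \<in> carrier_mat n n" and "invertible_mat A"
  shows "minv A \<in> carrier_mat n n" "A * minv A = 1\<^sub>m n" "minv A * A = 1\<^sub>m n"
proof -
  obtain B where B: "A * B = 1\<^sub>m (dim_row A)" "B * A = 1\<^sub>m (dim_row B)"
    using assms(2) unfolding invertible_mat_def inverts_mat_def by auto
  have "dim_col B = n" using arg_cong[OF B(1), of dim_col] A by simp
  moreover have "dim_row B = n" using arg_cong[OF B(2), of dim_col] A by simp
  ultimately have Bc: "B \<in> carrier_mat n n" by auto
  have "A \<in> Units (ring_mat TYPE(real) n ())"
    unfolding Units_def using A B Bc by (auto simp: ring_mat_def intro!: bexI[of _ B])
  then obtain N where "mat_inverse A = Some N" using mat_inverse(1)[OF A, where b = "()"] by auto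
  then show "minv A \<in> carrier_mat n n" "A * minv A = 1\<^sub>m n" "minv A * A = 1\<^sub>m n"
    using mat_inverse(2)[OF A] by (auto simp: minv_def)
qed

text \<open>
  Cramer's rule, from which continuity of the inverse follows.
\<close>

lemma minv_entry:
  assumes A: "A \<in> carrier_mat n n" and "invertible_mat A" and ij: "i < n" "j < n"
  shows "det A \<noteq> 0" and "minv A $$ (i,j) = cofactor A j i / det A"
proof -
  note I = minv_inverse[OF assms(1,2)]
  have "det A * det (minv A) = 1" using det_mult[OF A I(1)] I(2) by simp
  then show d: "det A \<noteq> 0" by auto
  have "minv A * (A * adj_mat A) = minv A * (det A \<cdot>\<^sub>m 1\<^sub>m n)" using adj_mat[OF A] by simp
  moreover have "minv A * (A * adj_mat A) = adj_mat A"
    using assoc_mult_mat[OF I(1) A adj_mat(1)[OF A]] I(3) adj_mat(1)[OF A] by simp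
  moreover have "minv A * (det A \<cdot>\<^sub>m 1\<^sub>m n) = det A \<cdot>\<^sub>m minv A"
    using mult_smult_distrib[OF I(1) one_carrier_mat[of n]] I(1) by simp
  ultimately have "adj_mat A $$ (i,j) = (det A \<cdot>\<^sub>m minv A) $$ (i,j)" by simp
  then have "cofactor A j i = det A * minv A $$ (i,j)" using A I(1) ij by (simp add: adj_mat_def)
  then show "minv A $$ (i,j) = cofactor A j i / det A" using d by simp
qed

definition continuous_mat :: "real \<Rightarrow> nat \<Rightarrow> nat \<Rightarrow> (real \<Rightarrow> rmat) \<Rightarrow> bool" where
  "continuous_mat a r c F \<longleftrightarrow> matrix_fun a r c F \<and>
     (\<forall>i<r. \<forall>j<c. continuous_on {a..} (\<lambda>t. F t $$ (i,j)))"

lemma continuous_mat_carrier: "continuous_mat a r c F \<Longrightarrow> a \<le> t \<Longrightarrow> F t \<in> carrier_mat r c"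
  unfolding continuous_mat_def matrix_fun_def by auto

lemma continuous_matI:
  assumes "\<And>t. a \<le> t \<Longrightarrow> F t \<in> carrier_mat r c"
    and "\<And>i j. i < r \<Longrightarrow> j < c \<Longrightarrow> continuous_on {a..} (f i j)"
    and "\<And>t i j. a \<le> t \<Longrightarrow> i < r \<Longrightarrow> j < c \<Longrightarrow> F t $$ (i,j) = f i j t"
  shows "continuous_mat a r c F"
  unfolding continuous_mat_def matrix_fun_def
proof (intro conjI allI impI)
  fix i j assume ij: "i < r" "j < c"
  show "continuous_on {a..} (\<lambda>t. F t $$ (i,j))"
    by (rule continuous_on_eq[OF assms(2)[OF ij]]) (use assms(3) ij in auto)
qed (use assms(1) in auto)

lemma continuous_mat_entry:
  "continuous_mat a r c F \<Longrightarrow> i < r \<Longrightarrow> j < c \<Longrightarrow> continuous_on {a..} (\<lambda>t. F t $$ (i,j))"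
  unfolding continuous_mat_def by auto

lemma continuous_mat_cong:
  assumes "continuous_mat a r c F" "\<And>t. a \<le> t \<Longrightarrow> F t = G t" shows "continuous_mat a r c G"
  using assms(2) continuous_mat_carrier[OF assms(1)] continuous_mat_entry[OF assms(1)]
  by (intro continuous_matI[where f = "\<lambda>i j t. F t $$ (i,j)"]) auto

lemma continuous_mat_const: "A \<in> carrier_mat r c \<Longrightarrow> continuous_mat a r c (\<lambda>t. A)"
  unfolding continuous_mat_def matrix_fun_def by auto

lemma continuous_mat_deriv:
  assumes "matrix_fun a r c F" and "\<And>t. a \<le> t \<Longrightarrow> \<exists>F'. has_mderiv a F F' t"
  shows "continuous_mat a r c F"
  unfolding continuous_mat_def
proof (intro conjI allI impI)
  fix i j assume ij: "i < r" "j < c"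
  show "continuous_on {a..} (\<lambda>t. F t $$ (i,j))"
    unfolding continuous_on_eq_continuous_within
  proof
    fix t assume "t \<in> {a..}"
    then have t: "a \<le> t" by simp
    obtain F' where "has_mderiv a F F' t" using assms(2)[OF t] by blast
    moreover have "F t \<in> carrier_mat r c" using assms(1) t unfolding matrix_fun_def by auto
    ultimately have "((\<lambda>t. F t $$ (i,j)) has_real_derivative F' $$ (i,j)) (at t within {a..})"
      using ij unfolding has_mderiv_def by auto
    then show "continuous (at t within {a..}) (\<lambda>t. F t $$ (i,j))" by (rule DERIV_continuous)
  qed
qed fact

lemma continuous_mat_mult:
  assumes F: "continuous_mat a r k F" and G: "continuous_mat a k c G"
  shows "continuous_mat a r c (\<lambda>t. F t * G t)"
proof (rule continuous_matI[where f = "\<lambda>i j t. \<Sum>l<k. F t $$ (i,l) * G t $$ (l,j)"])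
  fix t assume "a \<le> t"
  note c = continuous_mat_carrier[OF F this] continuous_mat_carrier[OF G this]
  show "F t * G t \<in> carrier_mat r c" using c by auto
  show "(F t * G t) $$ (i,j) = (\<Sum>l<k. F t $$ (i,l) * G t $$ (l,j))" if "i < r" "j < c" for i j
    using c that by (simp add: scalar_prod_def atLeast0LessThan)
next
  fix i j assume "i < r" "j < c"
  then show "continuous_on {a..} (\<lambda>t. \<Sum>l<k. F t $$ (i,l) * G t $$ (l,j))"
    by (intro continuous_on_sum continuous_on_mult continuous_mat_entry[OF F] continuous_mat_entry[OF G]) auto
qed

lemma continuous_mat_add:
  assumes F: "continuous_mat a r c F" and G: "continuous_mat a r c G"
  shows "continuous_mat a r c (\<lambda>t. F t + G t)"
proof (rule continuous_matI[where f = "\<lambda>i j t. F t $$ (i,j) + G t $$ (i,j)"])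
  fix t i j assume t: "a \<le> t" and "i < r" "j < c"
  then show "(F t + G t) $$ (i,j) = F t $$ (i,j) + G t $$ (i,j)"
    using continuous_mat_carrier[OF F t] continuous_mat_carrier[OF G t] by auto
qed (use continuous_mat_carrier[OF F] continuous_mat_carrier[OF G] continuous_mat_entry[OF F] continuous_mat_entry[OF G]
      in \<open>auto intro!: continuous_on_add\<close>)

lemma continuous_mat_minus:
  assumes F: "continuous_mat a r c F" and G: "continuous_mat a r c G"
  shows "continuous_mat a r c (\<lambda>t. F t - G t)"
proof (rule continuous_matI[where f = "\<lambda>i j t. F t $$ (i,j) - G t $$ (i,j)"])
  fix t i j assume t: "a \<le> t" and "i < r" "j < c"
  then show "(F t - G t) $$ (i,j) = F t $$ (i,j) - G t $$ (i,j)"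
    using continuous_mat_carrier[OF F t] continuous_mat_carrier[OF G t] by auto
next
  fix t assume t: "a \<le> t"
  show "F t - G t \<in> carrier_mat r c" using continuous_mat_carrier[OF G t] by (rule minus_carrier_mat)
qed (use continuous_mat_entry[OF F] continuous_mat_entry[OF G] in \<open>auto intro!: continuous_on_diff\<close>)

lemma continuous_mat_transpose:
  assumes F: "continuous_mat a r c F" shows "continuous_mat a c r (\<lambda>t. (F t)\<^sup>T)"
proof (rule continuous_matI[where f = "\<lambda>i j t. F t $$ (j,i)"])
  fix t i j assume t: "a \<le> t" and "i < c" "j < r"
  then show "(F t)\<^sup>T $$ (i,j) = F t $$ (j,i)" using continuous_mat_carrier[OF F t] by auto
qed (use continuous_mat_carrier[OF F] continuous_mat_entry[OF F] in auto)

lemma continuous_mat_hcat: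
  assumes F: "continuous_mat a r c F" and G: "continuous_mat a r d G"
  shows "continuous_mat a r (c + d) (\<lambda>t. hcat (F t) (G t))"
proof (rule continuous_matI[where f = "\<lambda>i j t. if j < c then F t $$ (i,j) else G t $$ (i,j - c)"])
  fix t i j assume t: "a \<le> t" and "i < r" "j < c + d"
  then show "hcat (F t) (G t) $$ (i,j) = (if j < c then F t $$ (i,j) else G t $$ (i,j - c))"
    using continuous_mat_carrier[OF F t] continuous_mat_carrier[OF G t] by (simp add: hcat_def)
next
  fix t assume t: "a \<le> t"
  show "hcat (F t) (G t) \<in> carrier_mat r (c + d)"
    using continuous_mat_carrier[OF F t] continuous_mat_carrier[OF G t] by (auto simp: hcat_def)
next
  fix i j assume "i < r" "j < c + d"
  then show "continuous_on {a..} (\<lambda>t. if j < c then F t $$ (i,j) else G t $$ (i,j - c))"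
    using continuous_mat_entry[OF F, of i j] continuous_mat_entry[OF G, of i "j - c"] by (cases "j < c") auto
qed

lemma continuous_on_det:
  assumes F: "continuous_mat a n n F" shows "continuous_on {a..} (\<lambda>t. det (F t))"
proof (rule continuous_on_eq)
  show "continuous_on {a..} (\<lambda>t. \<Sum>p\<in>{p. p permutes {0..<n}}. signof p * (\<Prod>i = 0..<n. F t $$ (i, p i)))"
  proof (intro continuous_on_sum continuous_on_mult continuous_on_const continuous_on_prod)
    fix p i assume "p \<in> {p. p permutes {0..<n}}" "i \<in> {0..<n}"
    then have "p i < n" "i < n" using permutes_in_image[of p "{0..<n}" i] by auto
    then show "continuous_on {a..} (\<lambda>t. F t $$ (i, p i))" by (intro continuous_mat_entry[OF F])
  qed
  fix t assume "t \<in> {a..}"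
  then show "(\<Sum>p\<in>{p. p permutes {0..<n}}. signof p * (\<Prod>i = 0..<n. F t $$ (i, p i))) = det (F t)"
    using continuous_mat_carrier[OF F, of t] by (simp add: det_def')
qed

lemma continuous_mat_minv:
  assumes F: "continuous_mat a n n F" and inv: "\<And>t. a \<le> t \<Longrightarrow> invertible_mat (F t)"
  shows "continuous_mat a n n (\<lambda>t. minv (F t))"
proof (rule continuous_matI[where f = "\<lambda>i j t. cofactor (F t) j i / det (F t)"])
  fix i j assume ij: "i < n" "j < n"
  have D: "continuous_mat a (n - 1) (n - 1) (\<lambda>t. mat_delete (F t) j i)"
  proof (rule continuous_matI[where f = "\<lambda>k l t. F t $$ (if k < j then k else Suc k, if l < i then l else Suc l)"])
    fix t k l assume "a \<le> t" "k < n - 1" "l < n - 1"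
    then show "mat_delete (F t) j i $$ (k,l) = F t $$ (if k < j then k else Suc k, if l < i then l else Suc l)"
      using continuous_mat_carrier[OF F, of t] by (simp add: mat_delete_def)
  next
    fix t assume "a \<le> t"
    then show "mat_delete (F t) j i \<in> carrier_mat (n - 1) (n - 1)"
      using continuous_mat_carrier[OF F, of t] by (simp add: mat_delete_def)
  next
    fix k l assume "k < n - 1" "l < n - 1"
    then show "continuous_on {a..} (\<lambda>t. F t $$ (if k < j then k else Suc k, if l < i then l else Suc l))"
      by (intro continuous_mat_entry[OF F]) auto
  qed
  show "continuous_on {a..} (\<lambda>t. cofactor (F t) j i / det (F t))"
    unfolding cofactor_def
  proof (intro continuous_on_divide continuous_on_mult continuous_on_const continuous_on_det[OF D] continuous_on_det[OF F] ballI)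
    fix t assume "t \<in> {a..}"
    then show "det (F t) \<noteq> 0"
      using minv_entry(1)[OF continuous_mat_carrier[OF F] inv ij] by auto
  qed
next
  fix t i j assume t: "a \<le> t" and ij: "i < n" "j < n"
  show "minv (F t) $$ (i,j) = cofactor (F t) j i / det (F t)"
    by (rule minv_entry(2)[OF continuous_mat_carrier[OF F t] inv[OF t] ij])
next
  fix t assume t: "a \<le> t"
  show "minv (F t) \<in> carrier_mat n n"
    by (rule minv_inverse(1)[OF continuous_mat_carrier[OF F t] inv[OF t]])
qed

lemma has_mderiv_mderiv:
  assumes "\<exists>F'. has_mderiv a F F' t" "a \<le> t" shows "has_mderiv a F (mderiv a F t) t"
proof -
  obtain F' where F': "has_mderiv a F F' t" using assms(1) by blast
  have "mderiv a F t = F'"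
  proof (rule eq_matI)
    fix i j assume ij: "i < dim_row F'" "j < dim_col F'"
    then have ij': "i < dim_row (F t)" "j < dim_col (F t)" using F' by (simp_all add: has_mderiv_def)
    have "((\<lambda>s. F s $$ (i,j)) has_vector_derivative F' $$ (i,j)) (at t within {a..})"
      using F' ij' by (simp add: has_mderiv_def has_real_derivative_iff_has_vector_derivative)
    then have "vector_derivative (\<lambda>s. F s $$ (i,j)) (at t within {a..}) = F' $$ (i,j)"
      by (rule vector_derivative_within[OF at_within_halfline_nontrivial[OF \<open>a \<le> t\<close>]])
    then show "mderiv a F t $$ (i,j) = F' $$ (i,j)"
      using ij' by (simp add: mderiv_def)
  qed (use F' in \<open>simp_all add: mderiv_def has_mderiv_def\<close>)
  then show ?thesis using F' by simp
qed

lemma has_vderivI: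
  fixes f :: "real \<Rightarrow> rvec" and f' :: rvec
  assumes "\<And>s. a \<le> s \<Longrightarrow> f s \<in> carrier_vec n" and "f' \<in> carrier_vec n" and "a \<le> t"
    and "\<And>i. i < n \<Longrightarrow> (\<phi> i has_real_derivative f' $ i) (at t within {a..})"
    and "\<And>s i. a \<le> s \<Longrightarrow> i < n \<Longrightarrow> f s $ i = \<phi> i s"
  shows "has_vderiv a f f' t"
  unfolding has_vderiv_def
proof (intro conjI allI impI)
  show "dim_vec f' = dim_vec (f t)" using assms(1)[OF \<open>a \<le> t\<close>] assms(2) by auto
  fix i assume "i < dim_vec (f t)"
  then have i: "i < n" using assms(1)[OF \<open>a \<le> t\<close>] by auto
  show "((\<lambda>s. f s $ i) has_real_derivative f' $ i) (at t within {a..})"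
    by (rule deriv_cong_halfline[OF assms(4)[OF i] \<open>a \<le> t\<close>]) (rule assms(5)[OF _ i])
qed

lemma has_vderivD:
  fixes f :: "real \<Rightarrow> rvec" and f' :: rvec
  assumes "has_vderiv a f f' t" "f t \<in> carrier_vec n"
  shows "f' \<in> carrier_vec n" "\<And>i. i < n \<Longrightarrow> ((\<lambda>s. f s $ i) has_real_derivative f' $ i) (at t within {a..})"
proof -
  show "f' \<in> carrier_vec n" using assms unfolding has_vderiv_def carrier_vec_def by simp
  show "\<And>i. i < n \<Longrightarrow> ((\<lambda>s. f s $ i) has_real_derivative f' $ i) (at t within {a..})"
    using assms unfolding has_vderiv_def by simp
qed

lemma has_mderivD:
  assumes "has_mderiv a F F' t" "F t \<in> carrier_mat r c"
  shows "F' \<in> carrier_mat r c"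
    "\<And>i j. i < r \<Longrightarrow> j < c \<Longrightarrow> ((\<lambda>s. F s $$ (i,j)) has_real_derivative F' $$ (i,j)) (at t within {a..})"
proof -
  show "F' \<in> carrier_mat r c" using assms unfolding has_mderiv_def carrier_mat_def by simp
  show "\<And>i j. i < r \<Longrightarrow> j < c \<Longrightarrow> ((\<lambda>s. F s $$ (i,j)) has_real_derivative F' $$ (i,j)) (at t within {a..})"
    using assms unfolding has_mderiv_def by simp
qed

lemma has_vderiv_add:
  assumes f: "has_vderiv a f f' t" "\<And>s. a \<le> s \<Longrightarrow> f s \<in> carrier_vec n"
    and g: "has_vderiv a g g' t" "\<And>s. a \<le> s \<Longrightarrow> g s \<in> carrier_vec n" and t: "a \<le> t"
  shows "has_vderiv a (\<lambda>s. f s + g s) (f' + g') t"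
proof (rule has_vderivI[where \<phi> = "\<lambda>i s. f s $ i + g s $ i"])
  note F = has_vderivD[OF f(1) f(2)[OF t]] and G = has_vderivD[OF g(1) g(2)[OF t]]
  show "f' + g' \<in> carrier_vec n" using F(1) G(1) by simp
  fix i assume i: "i < n"
  have "(f' + g') $ i = f' $ i + g' $ i" using G(1) i by simp
  then show "((\<lambda>s. f s $ i + g s $ i) has_real_derivative (f' + g') $ i) (at t within {a..})"
    using DERIV_add[OF F(2)[OF i] G(2)[OF i]] by simp
next
  fix s i assume "a \<le> s" "i < n"
  then show "(f s + g s) $ i = f s $ i + g s $ i" using g(2)[of s] by simp
qed (use f(2) g(2) t in auto)

lemma has_vderiv_diff:
  assumes f: "has_vderiv a f f' t" "\<And>s. a \<le> s \<Longrightarrow> f s \<in> carrier_vec n"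
    and g: "has_vderiv a g g' t" "\<And>s. a \<le> s \<Longrightarrow> g s \<in> carrier_vec n" and t: "a \<le> t"
  shows "has_vderiv a (\<lambda>s. f s - g s) (f' - g') t"
proof (rule has_vderivI[where \<phi> = "\<lambda>i s. f s $ i - g s $ i"])
  note F = has_vderivD[OF f(1) f(2)[OF t]] and G = has_vderivD[OF g(1) g(2)[OF t]]
  show "f' - g' \<in> carrier_vec n" using F(1) G(1) by simp
  fix i assume i: "i < n"
  have "(f' - g') $ i = f' $ i - g' $ i" using G(1) i by simp
  then show "((\<lambda>s. f s $ i - g s $ i) has_real_derivative (f' - g') $ i) (at t within {a..})"
    using DERIV_diff[OF F(2)[OF i] G(2)[OF i]] by simp
next
  fix s i assume "a \<le> s" "i < n"
  then show "(f s - g s) $ i = f s $ i - g s $ i" using g(2)[of s] by simp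
qed (use f(2) g(2) t in auto)

lemma has_vderiv_mult_mat_vec:
  assumes F: "has_mderiv a F F' t" "\<And>s. a \<le> s \<Longrightarrow> F s \<in> carrier_mat r c"
    and f: "has_vderiv a f f' t" "\<And>s. a \<le> s \<Longrightarrow> f s \<in> carrier_vec c" and t: "a \<le> t"
  shows "has_vderiv a (\<lambda>s. F s *\<^sub>v f s) (F' *\<^sub>v f t + F t *\<^sub>v f') t"
proof (rule has_vderivI[where \<phi> = "\<lambda>i s. \<Sum>j<c. F s $$ (i,j) * f s $ j"])
  note DF = has_mderivD[OF F(1) F(2)[OF t]] and Df = has_vderivD[OF f(1) f(2)[OF t]]
  show "F' *\<^sub>v f t + F t *\<^sub>v f' \<in> carrier_vec r" using DF(1) Df(1) F(2)[OF t] f(2)[OF t] by simp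
  fix i assume i: "i < r"
  have "(F' *\<^sub>v f t + F t *\<^sub>v f') $ i = (F' *\<^sub>v f t) $ i + (F t *\<^sub>v f') $ i"
    using F(2)[OF t] i by simp
  also have "\<dots> = (\<Sum>j<c. F' $$ (i,j) * f t $ j) + (\<Sum>j<c. F t $$ (i,j) * f' $ j)"
    by (simp only: mult_mat_vec_sum[OF DF(1) f(2)[OF t] i] mult_mat_vec_sum[OF F(2)[OF t] Df(1) i])
  also have "\<dots> = (\<Sum>j<c. F' $$ (i,j) * f t $ j + f' $ j * F t $$ (i,j))"
    by (simp add: sum.distrib mult.commute)
  finally have eq: "(F' *\<^sub>v f t + F t *\<^sub>v f') $ i = (\<Sum>j<c. F' $$ (i,j) * f t $ j + f' $ j * F t $$ (i,j))" .
  have "((\<lambda>s. \<Sum>j<c. F s $$ (i,j) * f s $ j) has_real_derivative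
      (\<Sum>j<c. F' $$ (i,j) * f t $ j + f' $ j * F t $$ (i,j))) (at t within {a..})"
    by (intro DERIV_sum DERIV_mult DF(2) Df(2)) (use i in auto)
  then show "((\<lambda>s. \<Sum>j<c. F s $$ (i,j) * f s $ j) has_real_derivative (F' *\<^sub>v f t + F t *\<^sub>v f') $ i) (at t within {a..})"
    unfolding eq .
next
  fix s i assume "a \<le> s" "i < r"
  then show "(F s *\<^sub>v f s) $ i = (\<Sum>j<c. F s $$ (i,j) * f s $ j)"
    using F(2) f(2) by (intro mult_mat_vec_sum) auto
next
  fix s assume "a \<le> s"
  then show "F s *\<^sub>v f s \<in> carrier_vec r" using mult_mat_vec_carrier[OF F(2) f(2)] by simp
qed (fact t)

lemma has_vderiv_cong:
  assumes "has_vderiv a f f' t" "\<And>s. a \<le> s \<Longrightarrow> f s \<in> carrier_vec n" "\<And>s. a \<le> s \<Longrightarrow> g s = f s" "a \<le> t"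
  shows "has_vderiv a g f' t"
  using assms has_vderivD[OF assms(1) assms(2)[OF assms(4)]]
  by (intro has_vderivI[where \<phi> = "\<lambda>i s. f s $ i"]) auto

lemma has_vderiv_append:
  assumes f: "has_vderiv a f f' t" "\<And>s. a \<le> s \<Longrightarrow> f s \<in> carrier_vec j"
    and g: "has_vderiv a g g' t" "\<And>s. a \<le> s \<Longrightarrow> g s \<in> carrier_vec k" and t: "a \<le> t"
  shows "has_vderiv a (\<lambda>s. f s @\<^sub>v g s) (f' @\<^sub>v g') t"
proof (rule has_vderivI[where \<phi> = "\<lambda>i s. if i < j then f s $ i else g s $ (i - j)"])
  note F = has_vderivD[OF f(1) f(2)[OF t]] and G = has_vderivD[OF g(1) g(2)[OF t]]
  show "f' @\<^sub>v g' \<in> carrier_vec (j + k)" using F(1) G(1) by simp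
  fix i assume i: "i < j + k"
  show "((\<lambda>s. if i < j then f s $ i else g s $ (i - j)) has_real_derivative (f' @\<^sub>v g') $ i) (at t within {a..})"
  proof (cases "i < j")
    case True
    then have "(f' @\<^sub>v g') $ i = f' $ i" using F(1) G(1) i by simp
    then show ?thesis using True F(2)[OF True] by simp
  next
    case False
    then have "(f' @\<^sub>v g') $ i = g' $ (i - j)" using F(1) G(1) i by simp
    then show ?thesis using False G(2)[of "i - j"] i by simp
  qed
next
  fix s i assume "a \<le> s" "i < j + k"
  then show "(f s @\<^sub>v g s) $ i = (if i < j then f s $ i else g s $ (i - j))"
    using f(2)[of s] g(2)[of s] by simp
next
  fix s assume "a \<le> s"
  then show "f s @\<^sub>v g s \<in> carrier_vec (j + k)" using f(2) g(2) by simp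
qed (fact t)

lemma has_vderiv_unique:
  assumes "has_vderiv a f f' t" "has_vderiv a g g' t" and t: "a \<le> t"
    and f: "\<And>s. a \<le> s \<Longrightarrow> f s \<in> carrier_vec n" and eq: "\<And>s. a \<le> s \<Longrightarrow> f s = g s"
  shows "f' = g'"
proof (rule eq_vecI)
  have g: "g t \<in> carrier_vec n" using f[OF t] eq[OF t] by simp
  note F = has_vderivD[OF assms(1) f[OF t]] and G = has_vderivD[OF assms(2) g]
  show "dim_vec f' = dim_vec g'" using F(1) G(1) by simp
  fix i assume "i < dim_vec g'"
  then have i: "i < n" using G(1) by simp
  have "((\<lambda>s. f s $ i) has_real_derivative g' $ i) (at t within {a..})"
    by (rule deriv_cong_halfline[OF G(2)[OF i] t]) (simp add: eq)
  then show "f' $ i = g' $ i"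
    using vector_derivative_unique_within[OF at_within_halfline_nontrivial[OF t]] F(2)[OF i]
    by (simp add: has_real_derivative_iff_has_vector_derivative)
qed

text \<open>
  This and the following variants of the algebraic laws have side conditions on dimensions
  only, which simplification evaluates; the usual side conditions, membership in carriers, leave the inner dimensions to be
  guessed.
\<close>

lemma mult_mat_assoc_dim:
  "dim_col A = dim_row B \<Longrightarrow> dim_col B = dim_row C \<Longrightarrow> (A * B) * C = A * (B * (C :: rmat))"
  by (rule assoc_mult_mat[of A "dim_row A" "dim_row B" B "dim_row C" C "dim_col C"]) auto

lemma zero_mult_mat_vec_dim: "dim_vec v = c \<Longrightarrow> 0\<^sub>m r c *\<^sub>v v = (0\<^sub>v r :: rvec)"
  by (intro eq_vecI) (auto simp: scalar_prod_def)

lemma mult_mat_vec_assoc_dim: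
  "dim_col A = dim_row B \<Longrightarrow> dim_col B = dim_vec v \<Longrightarrow> (A * B) *\<^sub>v v = A *\<^sub>v (B *\<^sub>v (v :: rvec))"
  by (rule assoc_mult_mat_vec[of A "dim_row A" "dim_row B" B "dim_vec v" v]) (auto intro: carrier_vecI)

lemma add_mult_mat_vec_dim:
  "dim_row A = dim_row B \<Longrightarrow> dim_col A = dim_col B \<Longrightarrow> dim_col B = dim_vec v \<Longrightarrow>
    (A + B) *\<^sub>v v = A *\<^sub>v v + B *\<^sub>v (v :: rvec)"
  by (rule add_mult_distrib_mat_vec[of A "dim_row B" "dim_vec v"]) (auto intro: carrier_vecI)

lemma minus_mult_mat_vec_dim:
  "dim_row A = dim_row B \<Longrightarrow> dim_col A = dim_col B \<Longrightarrow> dim_col B = dim_vec v \<Longrightarrow>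
    (A - B) *\<^sub>v v = A *\<^sub>v v - B *\<^sub>v (v :: rvec)"
  by (rule minus_mult_distrib_mat_vec[of A "dim_row B" "dim_vec v"]) (auto intro: carrier_vecI)

lemma mult_mat_vec_add_dim:
  "dim_col A = dim_vec v \<Longrightarrow> dim_vec v = dim_vec w \<Longrightarrow> A *\<^sub>v (v + w) = A *\<^sub>v v + A *\<^sub>v (w :: rvec)"
  by (rule mult_add_distrib_mat_vec[of A "dim_row A" "dim_vec w"]) (auto intro: carrier_vecI)

lemma mult_mat_vec_minus_dim:
  "dim_col A = dim_vec v \<Longrightarrow> dim_vec v = dim_vec w \<Longrightarrow> A *\<^sub>v (v - w) = A *\<^sub>v v - A *\<^sub>v (w :: rvec)"
  by (rule mult_minus_distrib_mat_vec[of A "dim_row A" "dim_vec w"]) (auto intro: carrier_vecI)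

lemma one_mult_mat_vec_dim: "dim_vec v = n \<Longrightarrow> 1\<^sub>m n *\<^sub>v v = (v :: rvec)"
  by (rule one_mult_mat_vec) (auto intro: carrier_vecI)

lemma mult_mat_vec_zero_dim: "dim_col A = n \<Longrightarrow> A *\<^sub>v 0\<^sub>v n = (0\<^sub>v (dim_row A) :: rvec)"
  by (intro eq_vecI) auto

lemma uminus_mult_mat_vec_dim: "dim_col A = dim_vec v \<Longrightarrow> (- A) *\<^sub>v v = - (A *\<^sub>v (v :: rvec))"
  by (intro eq_vecI) (auto simp: uminus_scalar_prod)

lemmas mat_vec_expand = mult_mat_vec_assoc_dim add_mult_mat_vec_dim minus_mult_mat_vec_dim
  mult_mat_vec_add_dim mult_mat_vec_minus_dim one_mult_mat_vec_dim mult_mat_vec_zero_dim uminus_mult_mat_vec_dim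

section \<open>Block matrices and orthogonal factors\<close>

lemma sum_lessThan_add: "(\<Sum>k<c + d. f k) = (\<Sum>k<c. f k) + (\<Sum>k<d. f (c + k :: nat) :: real)"
  by (induction d) (simp_all add: add.assoc)

lemma mult_mat_entry:
  "(A :: rmat) \<in> carrier_mat r k \<Longrightarrow> B \<in> carrier_mat k c \<Longrightarrow> i < r \<Longrightarrow> j < c \<Longrightarrow>
    (A * B) $$ (i,j) = (\<Sum>l<k. A $$ (i,l) * B $$ (l,j))"
  by (simp add: scalar_prod_def atLeast0LessThan)

lemma hcat_carrier: "A \<in> carrier_mat r c \<Longrightarrow> B \<in> carrier_mat r d \<Longrightarrow> hcat A B \<in> carrier_mat r (c + d)"
  by (auto simp: hcat_def)

lemma hcat_entry:
  "A \<in> carrier_mat r c \<Longrightarrow> B \<in> carrier_mat r d \<Longrightarrow> i < r \<Longrightarrow> j < c + d \<Longrightarrow>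
    hcat A B $$ (i,j) = (if j < c then A $$ (i,j) else B $$ (i,j - c))"
  by (simp add: hcat_def)

lemma hcat_mult_transpose:
  assumes A: "A \<in> carrier_mat r c" and B: "B \<in> carrier_mat r d" and C: "C \<in> carrier_mat s c" and D: "D \<in> carrier_mat s d"
  shows "hcat A B * (hcat C D)\<^sup>T = A * C\<^sup>T + B * D\<^sup>T"
proof (rule eq_matI)
  fix i j assume "i < dim_row (A * C\<^sup>T + B * D\<^sup>T)" "j < dim_col (A * C\<^sup>T + B * D\<^sup>T)"
  then have ij: "i < r" "j < s" using B D by auto
  note H = hcat_carrier[OF A B] hcat_carrier[OF C D]
  have "(hcat A B * (hcat C D)\<^sup>T) $$ (i,j) = (\<Sum>k<c + d. hcat A B $$ (i,k) * hcat C D $$ (j,k))"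
    using H ij by (subst mult_mat_entry[of _ r "c + d" _ s]) auto
  also have "\<dots> = (\<Sum>k<c. A $$ (i,k) * C $$ (j,k)) + (\<Sum>k<d. B $$ (i,k) * D $$ (j,k))"
    using ij by (simp add: sum_lessThan_add hcat_entry[OF A B] hcat_entry[OF C D])
  also have "\<dots> = (A * C\<^sup>T + B * D\<^sup>T) $$ (i,j)"
    using A B C D ij by (simp add: mult_mat_entry[of _ r c _ s] mult_mat_entry[of _ r d _ s] del: index_mult_mat(1))
  finally show "(hcat A B * (hcat C D)\<^sup>T) $$ (i,j) = (A * C\<^sup>T + B * D\<^sup>T) $$ (i,j)" .
qed (use A B C D in \<open>simp_all add: hcat_def\<close>)

lemma hcat_mult_block_diag:
  assumes A: "A \<in> carrier_mat r c" and B: "B \<in> carrier_mat r d" and S: "S \<in> carrier_mat c c"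
  shows "hcat A B * four_block_mat S (0\<^sub>m c e) (0\<^sub>m d c) (0\<^sub>m d e) = hcat (A * S) (0\<^sub>m r e)"
proof (rule eq_matI)
  define F where "F = four_block_mat S (0\<^sub>m c e) (0\<^sub>m d c) (0\<^sub>m d e)"
  have F: "F \<in> carrier_mat (c + d) (c + e)" using S by (auto simp: F_def)
  have AS: "A * S \<in> carrier_mat r c" using A S by simp
  fix i j assume "i < dim_row (hcat (A * S) (0\<^sub>m r e))" "j < dim_col (hcat (A * S) (0\<^sub>m r e))"
  then have ij: "i < r" "j < c + e" using hcat_carrier[OF AS zero_carrier_mat[of r e]] by auto
  have "(hcat A B * F) $$ (i,j) = (\<Sum>k<c + d. hcat A B $$ (i,k) * F $$ (k,j))"
    by (rule mult_mat_entry[OF hcat_carrier[OF A B] F ij])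
  also have "\<dots> = (\<Sum>k<c. A $$ (i,k) * F $$ (k,j)) + (\<Sum>k<d. B $$ (i,k) * F $$ (c + k,j))"
    using ij by (simp add: sum_lessThan_add hcat_entry[OF A B])
  also have "(\<Sum>k<d. B $$ (i,k) * F $$ (c + k,j)) = 0"
    using S ij by (intro sum.neutral) (auto simp: F_def)
  also have "(\<Sum>k<c. A $$ (i,k) * F $$ (k,j)) = (\<Sum>k<c. A $$ (i,k) * (if j < c then S $$ (k,j) else 0))"
    using S ij by (intro sum.cong) (auto simp: F_def)
  also have "\<dots> + 0 = hcat (A * S) (0\<^sub>m r e) $$ (i,j)"
    using ij by (simp add: hcat_entry[OF AS zero_carrier_mat] mult_mat_entry[OF A S] del: index_mult_mat(1))
  finally show "(hcat A B * four_block_mat S (0\<^sub>m c e) (0\<^sub>m d c) (0\<^sub>m d e)) $$ (i,j) = hcat (A * S) (0\<^sub>m r e) $$ (i,j)"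
    unfolding F_def .
qed (use A B S in \<open>simp_all add: hcat_def\<close>)

lemma hcat_orthonormal_columns:
  assumes A: "A \<in> carrier_mat r c" and B: "B \<in> carrier_mat r d" and o: "(hcat A B)\<^sup>T * hcat A B = 1\<^sub>m r"
    and r: "r = c + d"
  shows "A\<^sup>T * A = 1\<^sub>m c" "B\<^sup>T * A = 0\<^sub>m d c" "B\<^sup>T * B = 1\<^sub>m d"
proof -
  note H = hcat_carrier[OF A B]
  have e: "(\<Sum>k<r. hcat A B $$ (k,i) * hcat A B $$ (k,j)) = (if i = j then 1 else 0)" if "i < c + d" "j < c + d" for i j
  proof -
    have "((hcat A B)\<^sup>T * hcat A B) $$ (i,j) = (\<Sum>k<r. hcat A B $$ (k,i) * hcat A B $$ (k,j))"
      using H that by (subst mult_mat_entry[of _ "c + d" r _ "c + d"]) auto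
    moreover have "(1\<^sub>m r :: rmat) $$ (i,j) = (if i = j then 1 else 0)"
      using that r by (intro index_one_mat) auto
    ultimately show ?thesis unfolding o by (simp only:)
  qed
  show "A\<^sup>T * A = 1\<^sub>m c"
  proof (rule eq_matI)
    fix i j assume "i < dim_row (1\<^sub>m c :: rmat)" "j < dim_col (1\<^sub>m c :: rmat)"
    then have ij: "i < c" "j < c" by auto
    have "(A\<^sup>T * A) $$ (i,j) = (\<Sum>k<r. A $$ (k,i) * A $$ (k,j))"
      using A ij by (subst mult_mat_entry[of _ c r _ c]) auto
    also have "\<dots> = (\<Sum>k<r. hcat A B $$ (k,i) * hcat A B $$ (k,j))"
      using ij by (simp add: hcat_entry[OF A B])
    finally show "(A\<^sup>T * A) $$ (i,j) = 1\<^sub>m c $$ (i,j)" using e[of i j] ij by simp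
  qed (use A in auto)
  show "B\<^sup>T * A = 0\<^sub>m d c"
  proof (rule eq_matI)
    fix i j assume "i < dim_row (0\<^sub>m d c :: rmat)" "j < dim_col (0\<^sub>m d c :: rmat)"
    then have ij: "i < d" "j < c" by auto
    have "(B\<^sup>T * A) $$ (i,j) = (\<Sum>k<r. B $$ (k,i) * A $$ (k,j))"
      using A B ij by (subst mult_mat_entry[of _ d r _ c]) auto
    also have "\<dots> = (\<Sum>k<r. hcat A B $$ (k,c + i) * hcat A B $$ (k,j))"
      using ij by (simp add: hcat_entry[OF A B])
    finally show "(B\<^sup>T * A) $$ (i,j) = 0\<^sub>m d c $$ (i,j)" using e[of "c + i" j] ij by simp
  qed (use A B in auto)
  show "B\<^sup>T * B = 1\<^sub>m d"
  proof (rule eq_matI)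
    fix i j assume "i < dim_row (1\<^sub>m d :: rmat)" "j < dim_col (1\<^sub>m d :: rmat)"
    then have ij: "i < d" "j < d" by auto
    have "(B\<^sup>T * B) $$ (i,j) = (\<Sum>k<r. B $$ (k,i) * B $$ (k,j))"
      using B ij by (subst mult_mat_entry[of _ d r _ d]) auto
    also have "\<dots> = (\<Sum>k<r. hcat A B $$ (k,c + i) * hcat A B $$ (k,c + j))"
      using ij by (simp add: hcat_entry[OF A B])
    finally show "(B\<^sup>T * B) $$ (i,j) = 1\<^sub>m d $$ (i,j)" using e[of "c + i" "c + j"] ij by simp
  qed (use B in auto)
qed

lemma selL_mult:
  assumes "T \<in> carrier_mat r l" shows "T * hcat (1\<^sub>m l) (0\<^sub>m l l) = selL T"
proof (rule eq_matI)
  note H = hcat_carrier[OF one_carrier_mat zero_carrier_mat, of l l]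
  fix i j assume "i < dim_row (selL T)" "j < dim_col (selL T)"
  then have ij: "i < r" "j < l + l" using assms by (auto simp: selL_def hcat_def)
  have "(T * hcat (1\<^sub>m l) (0\<^sub>m l l)) $$ (i,j) = (\<Sum>k<l. T $$ (i,k) * hcat (1\<^sub>m l) (0\<^sub>m l l) $$ (k,j))"
    by (rule mult_mat_entry[OF assms H ij])
  also have "\<dots> = (\<Sum>k<l. if k = j then T $$ (i,k) else 0)"
    using ij by (intro sum.cong) (auto simp: hcat_def)
  also have "\<dots> = selL T $$ (i,j)" using assms ij by (auto simp: selL_def hcat_def)
  finally show "(T * hcat (1\<^sub>m l) (0\<^sub>m l l)) $$ (i,j) = selL T $$ (i,j)" .
qed (use assms in \<open>auto simp: selL_def hcat_def\<close>)

section \<open>Pathwise dynamics of the estimation error\<close>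

text \<open>
  The algebra behind the error dynamics at a fixed time. The three facts on \<open>T2\<close>, \<open>M1\<close> and \<open>M2\<close> are what
  removes the unknown input \<open>d = V\<^sub>1 d\<^sub>1 + V\<^sub>2 d\<^sub>2\<close>; the vector \<open>yd\<close> stands for the derivative of
  the output, of which only the image under \<open>T2\<close> is known. Once every product is expanded into
  successive applications of matrices to vectors, the two sides agree term by term.
\<close>

lemma error_dynamics_identity:
  fixes A B G1 G2 W C D H T1 T2 M1 M2 Cd Dd L :: rmat and x xh u ud d d1 d2 w v vd y yd :: rvec
  assumes dims: "A \<in> carrier_mat n n" "B \<in> carrier_mat n m" "G1 \<in> carrier_mat n r" "G2 \<in> carrier_mat n g"
    "W \<in> carrier_mat n q" "C \<in> carrier_mat l n" "D \<in> carrier_mat l m" "H \<in> carrier_mat l p"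
    "T1 \<in> carrier_mat r l" "T2 \<in> carrier_mat k l" "M1 \<in> carrier_mat r r" "M2 \<in> carrier_mat g k"
    "Cd \<in> carrier_mat l n" "Dd \<in> carrier_mat l m" "L \<in> carrier_mat n k"
    and vecs: "x \<in> carrier_vec n" "xh \<in> carrier_vec n" "u \<in> carrier_vec m" "ud \<in> carrier_vec m"
    "d \<in> carrier_vec p" "d1 \<in> carrier_vec r" "d2 \<in> carrier_vec g" "w \<in> carrier_vec q"
    "v \<in> carrier_vec l" "vd \<in> carrier_vec l" "yd \<in> carrier_vec l"
    and T2H: "T2 *\<^sub>v (H *\<^sub>v d) = 0\<^sub>v k" and T1H: "M1 *\<^sub>v (T1 *\<^sub>v (H *\<^sub>v d)) = d1"
    and M2: "M2 *\<^sub>v (T2 *\<^sub>v (C *\<^sub>v (G2 *\<^sub>v d2))) = d2"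
    and xd: "xd = A *\<^sub>v x + B *\<^sub>v u + (G1 *\<^sub>v d1 + G2 *\<^sub>v d2) + W *\<^sub>v w"
    and y: "y = C *\<^sub>v x + D *\<^sub>v u + H *\<^sub>v d + v"
    and yd: "T2 *\<^sub>v yd = T2 *\<^sub>v (Cd *\<^sub>v x + C *\<^sub>v xd + (Dd *\<^sub>v u + D *\<^sub>v ud) + vd)"
    and P: "P = 1\<^sub>m n - G2 * M2 * (T2 * C)"
    and Abar: "Abar = P * (A - G1 * M1 * (T1 * C)) - G2 * M2 * T2 * Cd"
    and Bbar: "Bbar = P * (B - G1 * M1 * (T1 * D)) - G2 * M2 * T2 * Dd"
    and xhd: "xhd = (Abar - L * (T2 * C)) *\<^sub>v xh + (Bbar - L * (T2 * D)) *\<^sub>v u + (P * G1) *\<^sub>v (M1 *\<^sub>v (T1 *\<^sub>v y))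
      + L *\<^sub>v (T2 *\<^sub>v y) + G2 *\<^sub>v (M2 *\<^sub>v (T2 *\<^sub>v yd)) - G2 *\<^sub>v (M2 *\<^sub>v ((T2 * D) *\<^sub>v ud))"
  shows "xd - xhd = (Abar - L * (T2 * C)) *\<^sub>v (x - xh)
    + ((P * W) *\<^sub>v w - (P * G1 * M1 * T1 + L * T2) *\<^sub>v v - (G2 * M2 * T2) *\<^sub>v vd)"
proof -
  have dim: "dim_row A = n" "dim_col A = n" "dim_row B = n" "dim_col B = m" "dim_row G1 = n" "dim_col G1 = r"
    "dim_row G2 = n" "dim_col G2 = g" "dim_row W = n" "dim_col W = q" "dim_row C = l" "dim_col C = n"
    "dim_row D = l" "dim_col D = m" "dim_row H = l" "dim_col H = p" "dim_row T1 = r" "dim_col T1 = l"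
    "dim_row T2 = k" "dim_col T2 = l" "dim_row M1 = r" "dim_col M1 = r" "dim_row M2 = g" "dim_col M2 = k"
    "dim_row Cd = l" "dim_col Cd = n" "dim_row Dd = l" "dim_col Dd = m" "dim_row L = n" "dim_col L = k"
    "dim_vec x = n" "dim_vec xh = n" "dim_vec u = m" "dim_vec ud = m" "dim_vec d = p" "dim_vec d1 = r"
    "dim_vec d2 = g" "dim_vec w = q" "dim_vec v = l" "dim_vec vd = l" "dim_vec yd = l"
    using dims vecs by auto
  have dxd: "dim_vec xd = n" by (simp add: xd dim)
  have dP: "dim_row P = n" "dim_col P = n" by (simp_all add: P dim)
  have Pv: "P *\<^sub>v z = z - G2 *\<^sub>v (M2 *\<^sub>v (T2 *\<^sub>v (C *\<^sub>v z)))" if "dim_vec z = n" for z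
    using that by (simp add: P mat_vec_expand dim)
  show ?thesis
    unfolding Abar Bbar xhd
    apply (rule eq_vecI)
    apply (simp_all add: dim dxd dP mat_vec_expand Pv yd y T1H T2H del: index_mult_mat_vec)
    apply (simp add: xd dim mat_vec_expand M2 del: index_mult_mat_vec)
    done
qed

text \<open>
  The part of the setting that is not random. The abbreviations are the dimensions: \<open>n\<close> of the state,
  \<open>m\<close> of the known input, \<open>l\<close> of the output, \<open>r\<close> the rank of \<open>H\<close>, \<open>k\<close> of the part of the output that \<open>H\<close>
  does not reach, \<open>g\<close> of the part of the unknown input that \<open>H\<close> does not transmit.
\<close>

locale alise_filter =
  fixes Z :: alise
  assumes plant: "plant Z" and decoupling: "decoupling Z"
    and noise_covariances: "noise_covariances Z" and filter_gains: "filter_gains Z"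
begin

abbreviation "t0 \<equiv> ti Z"
abbreviation "n \<equiv> nx Z"
abbreviation "m \<equiv> nu Z"
abbreviation "l \<equiv> ny Z"
abbreviation "r \<equiv> pH Z"
abbreviation "k \<equiv> ny Z - pH Z"
abbreviation "g \<equiv> nd Z - pH Z"

lemma n_pos: "0 < n"
proof -
  have "l \<le> n" "1 \<le> l" using plant unfolding plant_def by - (elim conjE, assumption)+
  then show ?thesis by simp
qed

lemma plant_carrier:
  assumes "t0 \<le> t"
  shows "mA Z t \<in> carrier_mat n n" "mB Z t \<in> carrier_mat n m" "mG Z t \<in> carrier_mat n (nd Z)"
    "mC Z t \<in> carrier_mat l n" "mD Z t \<in> carrier_mat l m" "mW Z t \<in> carrier_mat n (nw Z)"
    "mH Z t \<in> carrier_mat l (nd Z)" "inp Z t \<in> carrier_vec m" "unk Z t \<in> carrier_vec (nd Z)"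
    "Pv Z t \<in> carrier_mat (2 * l) (2 * l)" "Px Z t \<in> carrier_mat n n"
proof -
  have "matrix_fun t0 n n (mA Z)" "matrix_fun t0 n m (mB Z)" "matrix_fun t0 n (nd Z) (mG Z)"
    "matrix_fun t0 l n (mC Z)" "matrix_fun t0 l m (mD Z)" "matrix_fun t0 n (nw Z) (mW Z)"
    "matrix_fun t0 l (nd Z) (mH Z)" "vector_fun t0 m (inp Z)" "vector_fun t0 (nd Z) (unk Z)"
    using plant unfolding plant_def by - (elim conjE, assumption)+
  moreover have "matrix_fun t0 (2 * l) (2 * l) (Pv Z)"
    using noise_covariances unfolding noise_covariances_def by (elim conjE) assumption
  moreover have "matrix_fun t0 n n (Px Z)"
    using filter_gains unfolding filter_gains_def by (elim conjE) assumption
  ultimately show "mA Z t \<in> carrier_mat n n" "mB Z t \<in> carrier_mat n m" "mG Z t \<in> carrier_mat n (nd Z)"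
    "mC Z t \<in> carrier_mat l n" "mD Z t \<in> carrier_mat l m" "mW Z t \<in> carrier_mat n (nw Z)"
    "mH Z t \<in> carrier_mat l (nd Z)" "inp Z t \<in> carrier_vec m" "unk Z t \<in> carrier_vec (nd Z)"
    "Pv Z t \<in> carrier_mat (2 * l) (2 * l)" "Px Z t \<in> carrier_mat n n"
    using assms unfolding matrix_fun_def vector_fun_def by simp_all
qed

lemma svd_carrier:
  assumes "t0 \<le> t"
  shows "U1 Z t \<in> carrier_mat l r" "U2 Z t \<in> carrier_mat l k" "V1 Z t \<in> carrier_mat (nd Z) r"
    "V2 Z t \<in> carrier_mat (nd Z) g" "Sig Z t \<in> carrier_mat r r"
proof -
  have "matrix_fun t0 l r (U1 Z)" "matrix_fun t0 l k (U2 Z)" "matrix_fun t0 (nd Z) r (V1 Z)"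
    "matrix_fun t0 (nd Z) g (V2 Z)" "matrix_fun t0 r r (Sig Z)"
    using decoupling unfolding decoupling_def by - (elim conjE, assumption)+
  then show "U1 Z t \<in> carrier_mat l r" "U2 Z t \<in> carrier_mat l k" "V1 Z t \<in> carrier_mat (nd Z) r"
    "V2 Z t \<in> carrier_mat (nd Z) g" "Sig Z t \<in> carrier_mat r r"
    using assms unfolding matrix_fun_def by simp_all
qed

lemma svd_facts:
  assumes "t0 \<le> t"
  shows "orthogonal_matrix l (hcat (U1 Z t) (U2 Z t))" "orthogonal_matrix (nd Z) (hcat (V1 Z t) (V2 Z t))"
    "invertible_mat (Sig Z t)"
    "mH Z t = hcat (U1 Z t) (U2 Z t) * four_block_mat (Sig Z t) (0\<^sub>m r g) (0\<^sub>m k r) (0\<^sub>m k g) * (hcat (V1 Z t) (V2 Z t))\<^sup>T"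
    "has_mderiv t0 (U2 Z) (0\<^sub>m l k) t" "\<exists>F'. has_mderiv t0 (U1 Z) F' t"
    "\<exists>F'. has_mderiv t0 (V1 Z) F' t" "\<exists>F'. has_mderiv t0 (Sig Z) F' t"
proof -
  note D = decoupling[unfolded decoupling_def, THEN conjunct2, THEN conjunct2, THEN conjunct2,
      THEN conjunct2, THEN conjunct2, THEN conjunct2, THEN conjunct2]
  show "\<exists>F'. has_mderiv t0 (Sig Z) F' t"
    using decoupling[unfolded decoupling_def, THEN conjunct2, THEN conjunct2, THEN conjunct2,
      THEN conjunct2, THEN conjunct2, THEN conjunct2, THEN conjunct1] assms
    unfolding mdifferentiable_def by blast
  note E = D[THEN spec, THEN mp, OF assms]
  show "orthogonal_matrix l (hcat (U1 Z t) (U2 Z t))" "orthogonal_matrix (nd Z) (hcat (V1 Z t) (V2 Z t))"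
    "invertible_mat (Sig Z t)"
    "mH Z t = hcat (U1 Z t) (U2 Z t) * four_block_mat (Sig Z t) (0\<^sub>m r g) (0\<^sub>m k r) (0\<^sub>m k g) * (hcat (V1 Z t) (V2 Z t))\<^sup>T"
    "has_mderiv t0 (U2 Z) (0\<^sub>m l k) t"
    using E by - (elim conjE, assumption)+
  show "\<exists>F'. has_mderiv t0 (U1 Z) F' t" "\<exists>F'. has_mderiv t0 (V1 Z) F' t"
    using E by - (elim conjE exE, intro exI, assumption)+
qed

lemma gain_facts:
  assumes "t0 \<le> t"
  shows "invertible_mat (R2 Z t)" "invertible_mat (R2_tilde Z t)" "invertible_mat (normal_mat Z t)"
    "\<exists>F'. has_mderiv t0 (Px Z) F' t" "\<exists>F'. has_mderiv t0 (Phi1 Z) F' t" "\<exists>F'. has_mderiv t0 (Phi2 Z) F' t"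
    "\<exists>F'. has_mderiv t0 (Pv Z) F' t"
proof -
  note F = filter_gains[unfolded filter_gains_def, THEN conjunct2, THEN conjunct2]
  note E = F[THEN conjunct2, THEN conjunct2, THEN spec, THEN mp, OF assms]
  show "invertible_mat (R2 Z t)" "invertible_mat (R2_tilde Z t)" "invertible_mat (normal_mat Z t)"
    using E by - (elim conjE, assumption)+
  show "\<exists>F'. has_mderiv t0 (Px Z) F' t" using E by (elim conjE) (rule exI)
  show "\<exists>F'. has_mderiv t0 (Phi1 Z) F' t" "\<exists>F'. has_mderiv t0 (Phi2 Z) F' t"
    using F[THEN conjunct1] F[THEN conjunct2, THEN conjunct1] assms unfolding mdifferentiable_def by simp_all
  show "\<exists>F'. has_mderiv t0 (Pv Z) F' t"
    using noise_covariances[unfolded noise_covariances_def, THEN conjunct2, THEN conjunct2, THEN conjunct2,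
      THEN conjunct2, THEN spec, THEN mp, OF assms] by (elim conjE) (rule exI)
qed

text \<open>
  Orthogonality of \<open>[U\<^sub>1 U\<^sub>2]\<close> makes the truncated subtraction in the number \<open>k\<close> of columns of \<open>U\<^sub>2\<close> exact.
\<close>

lemma l_split: "l = r + k"
proof -
  have "hcat (U1 Z t0) (U2 Z t0) \<in> carrier_mat l (r + k)" using svd_carrier by (intro hcat_carrier) auto
  then show ?thesis using svd_facts(1)[of t0] unfolding orthogonal_matrix_def by auto
qed

lemma T2_carrier: "t0 \<le> t \<Longrightarrow> T2 Z t \<in> carrier_mat k l"
  using svd_carrier by (simp add: T2_def)

lemma U_orthonormal:
  assumes t: "t0 \<le> t"
  shows "(U1 Z t)\<^sup>T * U1 Z t = 1\<^sub>m r" "T2 Z t * U1 Z t = 0\<^sub>m k r" "T2 Z t * U2 Z t = 1\<^sub>m k"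
proof -
  have o: "(hcat (U1 Z t) (U2 Z t))\<^sup>T * hcat (U1 Z t) (U2 Z t) = 1\<^sub>m l"
    using svd_facts(1)[OF t] unfolding orthogonal_matrix_def by (elim conjE)
  note H = hcat_orthonormal_columns[OF svd_carrier(1,2)[OF t] o l_split]
  show "(U1 Z t)\<^sup>T * U1 Z t = 1\<^sub>m r" "T2 Z t * U1 Z t = 0\<^sub>m k r" "T2 Z t * U2 Z t = 1\<^sub>m k"
    unfolding T2_def by (rule H)+
qed

lemma H_eq: assumes t: "t0 \<le> t" shows "mH Z t = U1 Z t * Sig Z t * (V1 Z t)\<^sup>T"
proof -
  have US: "U1 Z t * Sig Z t \<in> carrier_mat l r" using svd_carrier[OF t] by simp
  have "mH Z t = hcat (U1 Z t * Sig Z t) (0\<^sub>m l g) * (hcat (V1 Z t) (V2 Z t))\<^sup>T"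
    using svd_facts(4)[OF t] hcat_mult_block_diag[OF svd_carrier(1,2,5)[OF t], of g] by simp
  also have "\<dots> = U1 Z t * Sig Z t * (V1 Z t)\<^sup>T + 0\<^sub>m l g * (V2 Z t)\<^sup>T"
    by (rule hcat_mult_transpose[OF US zero_carrier_mat svd_carrier(3,4)[OF t]])
  also have "\<dots> = U1 Z t * Sig Z t * (V1 Z t)\<^sup>T" using US svd_carrier[OF t] by simp
  finally show ?thesis .
qed

lemma V_complete:
  assumes t: "t0 \<le> t" and d: "d \<in> carrier_vec (nd Z)"
  shows "V1 Z t *\<^sub>v ((V1 Z t)\<^sup>T *\<^sub>v d) + V2 Z t *\<^sub>v ((V2 Z t)\<^sup>T *\<^sub>v d) = d"
proof -
  have "V1 Z t * (V1 Z t)\<^sup>T + V2 Z t * (V2 Z t)\<^sup>T = 1\<^sub>m (nd Z)"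
    using svd_facts(2)[OF t] hcat_mult_transpose[OF svd_carrier(3,4)[OF t] svd_carrier(3,4)[OF t]]
    unfolding orthogonal_matrix_def by simp
  then have "(V1 Z t * (V1 Z t)\<^sup>T + V2 Z t * (V2 Z t)\<^sup>T) *\<^sub>v d = d" using d by simp
  then show ?thesis using svd_carrier[OF t] d by (simp add: mat_vec_expand)
qed

lemma Rn_carrier: "t0 \<le> t \<Longrightarrow> Rn Z t \<in> carrier_mat l l"
  unfolding Rn_def Let_def by (rule carrier_matI) (simp_all add: hcat_def)

text \<open>
  The matrix inverted in \<open>T1\<close> is \<open>R2\<close>, whose invertibility is part of the assumptions on the gains.
\<close>

lemma R2_eq: assumes t: "t0 \<le> t" shows "(U2 Z t)\<^sup>T * Rn Z t * U2 Z t = R2 Z t"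
proof -
  define S :: rmat where "S = hcat (1\<^sub>m l) (0\<^sub>m l l)"
  have S: "S \<in> carrier_mat l (2 * l)" using hcat_carrier[OF one_carrier_mat zero_carrier_mat, of l l] by (simp add: S_def mult_2)
  note T = T2_carrier[OF t] and P = plant_carrier(10)[OF t]
  have "R2 Z t = (T2 Z t * S) * Pv Z t * (T2 Z t * S)\<^sup>T"
    unfolding R2_def S_def by (simp only: selL_mult[OF T])
  also have "\<dots> = (T2 Z t * S) * Pv Z t * (S\<^sup>T * (T2 Z t)\<^sup>T)" by (simp only: transpose_mult[OF T S])
  also have "\<dots> = T2 Z t * (S * Pv Z t * S\<^sup>T) * (T2 Z t)\<^sup>T"
    using carrier_matD[OF S] carrier_matD[OF T] carrier_matD[OF P] by (simp add: mult_mat_assoc_dim)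
  finally show ?thesis unfolding Rn_def Let_def S_def T2_def by simp
qed

lemma R_inverse:
  assumes t: "t0 \<le> t"
  shows "R2 Z t \<in> carrier_mat k k" "minv (R2 Z t) \<in> carrier_mat k k"
proof -
  have "(U2 Z t)\<^sup>T * Rn Z t * U2 Z t \<in> carrier_mat k k" using svd_carrier[OF t] Rn_carrier[OF t] by simp
  then show R: "R2 Z t \<in> carrier_mat k k" by (simp only: R2_eq[OF t])
  show "minv (R2 Z t) \<in> carrier_mat k k"
    by (rule minv_inverse(1)[OF R gain_facts(1)[OF t]])
qed

lemma T1_eq:
  assumes t: "t0 \<le> t"
  shows "T1 Z t = (U1 Z t)\<^sup>T - (U1 Z t)\<^sup>T * Rn Z t * U2 Z t * minv (R2 Z t) * T2 Z t"
  unfolding T1_def R2_eq[OF t] T2_def ..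

lemma gain_carrier:
  assumes t: "t0 \<le> t"
  shows "T1 Z t \<in> carrier_mat r l" "G1 Z t \<in> carrier_mat n r" "G2 Z t \<in> carrier_mat n g"
    "M1 Z t \<in> carrier_mat r r" "R2_tilde Z t \<in> carrier_mat k k" "minv (R2_tilde Z t) \<in> carrier_mat k k"
    "normal_mat Z t \<in> carrier_mat g g" "M2 Z t \<in> carrier_mat g k" "L_gain Z t \<in> carrier_mat n k"
    "Proj Z t \<in> carrier_mat n n" "A_breve Z t \<in> carrier_mat n n"
proof -
  note c = plant_carrier[OF t] svd_carrier[OF t] T2_carrier[OF t] R_inverse[OF t]
  note d = carrier_matD[OF c(1)] carrier_matD[OF c(2)] carrier_matD[OF c(3)] carrier_matD[OF c(4)] carrier_matD[OF c(5)]
    carrier_matD[OF c(6)] carrier_matD[OF c(10)] carrier_matD[OF c(11)] carrier_matD[OF c(12)] carrier_matD[OF c(13)] carrier_matD[OF c(14)]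
    carrier_matD[OF c(15)] carrier_matD[OF c(16)] carrier_matD[OF c(17)] carrier_matD[OF c(18)] carrier_matD[OF c(19)]
  show T1: "T1 Z t \<in> carrier_mat r l" unfolding T1_eq[OF t] by (rule carrier_matI) (simp_all add: d)
  show G1: "G1 Z t \<in> carrier_mat n r" unfolding G1_def by (rule carrier_matI) (simp_all add: d)
  show G2: "G2 Z t \<in> carrier_mat n g" unfolding G2_def by (rule carrier_matI) (simp_all add: d)
  show M1: "M1 Z t \<in> carrier_mat r r" unfolding M1_def by (rule minv_inverse(1)[OF svd_carrier(5)[OF t] svd_facts(3)[OF t]])
  note d = d carrier_matD[OF T1] carrier_matD[OF G1] carrier_matD[OF G2] carrier_matD[OF M1]
  note inv = gain_facts(2,3)[OF t]
  show Rt: "R2_tilde Z t \<in> carrier_mat k k"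
    unfolding R2_tilde_def Let_def
    by (rule carrier_matI) (simp_all add: C2_def R12_grave_def selR_def hcat_def d)
  show Rti: "minv (R2_tilde Z t) \<in> carrier_mat k k" by (rule minv_inverse(1)[OF Rt inv(1)])
  show N: "normal_mat Z t \<in> carrier_mat g g" unfolding normal_mat_def by (rule carrier_matI) (simp_all add: d)
  have Ni: "minv (normal_mat Z t) \<in> carrier_mat g g" by (rule minv_inverse(1)[OF N inv(2)])
  show M2: "M2 Z t \<in> carrier_mat g k" unfolding M2_def
    by (rule carrier_matI) (simp_all add: d carrier_matD[OF Ni] carrier_matD[OF Rti])
  show L: "L_gain Z t \<in> carrier_mat n k" unfolding L_gain_def
    by (rule carrier_matI) (simp_all add: d C2_def)
  show P: "Proj Z t \<in> carrier_mat n n" unfolding Proj_def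
    by (rule carrier_matI) (simp_all add: d C2_def)
  show "A_breve Z t \<in> carrier_mat n n" unfolding A_breve_def
    by (rule carrier_matI) (simp_all add: d C2_def carrier_matD[OF L])
qed

lemma plant_deriv:
  assumes t: "t0 \<le> t"
  shows "has_mderiv t0 (mC Z) (mderiv t0 (mC Z) t) t" "has_mderiv t0 (mD Z) (mderiv t0 (mD Z) t) t"
    "has_mderiv t0 (Phi1 Z) (mderiv t0 (Phi1 Z) t) t" "has_mderiv t0 (Phi2 Z) (mderiv t0 (Phi2 Z) t) t"
    "\<exists>F'. has_mderiv t0 (mC Z) F' t" "\<exists>F'. has_mderiv t0 (mG Z) F' t" "\<exists>F'. has_mderiv t0 (mW Z) F' t"
proof -
  have s: "\<exists>F'. has_mderiv t0 F F' t" if "F \<in> {mA Z, mB Z, mG Z, mC Z, mD Z, mW Z}" for F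
  proof -
    have "\<forall>F\<in>{mA Z, mB Z, mG Z, mC Z, mD Z, mW Z}. smooth_matrix t0 F"
      using plant unfolding plant_def by (elim conjE) assumption
    then have "smooth_matrix t0 F" using that by (rule bspec)
    then obtain D where "D 0 = F" "\<forall>k. \<forall>t\<ge>t0. has_mderiv t0 (D k) (D (Suc k) t) t"
      unfolding smooth_matrix_def by blast
    then have "has_mderiv t0 F (D (Suc 0) t) t" using t by metis
    then show ?thesis by blast
  qed
  show "\<exists>F'. has_mderiv t0 (mC Z) F' t" "\<exists>F'. has_mderiv t0 (mG Z) F' t" "\<exists>F'. has_mderiv t0 (mW Z) F' t"
    by (rule s, simp)+
  show "has_mderiv t0 (mC Z) (mderiv t0 (mC Z) t) t" "has_mderiv t0 (mD Z) (mderiv t0 (mD Z) t) t"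
    by (rule has_mderiv_mderiv[OF s t], simp)+
  note p = gain_facts(5,6)[OF t]
  show "has_mderiv t0 (Phi1 Z) (mderiv t0 (Phi1 Z) t) t" "has_mderiv t0 (Phi2 Z) (mderiv t0 (Phi2 Z) t) t"
    by (rule has_mderiv_mderiv[OF p(1) t], rule has_mderiv_mderiv[OF p(2) t])
qed

lemma T2_H: "t0 \<le> t \<Longrightarrow> d \<in> carrier_vec (nd Z) \<Longrightarrow> T2 Z t *\<^sub>v (mH Z t *\<^sub>v d) = 0\<^sub>v k"
proof -
  assume t: "t0 \<le> t" and d: "d \<in> carrier_vec (nd Z)"
  note S = svd_carrier[OF t] and T = T2_carrier[OF t]
  have "T2 Z t *\<^sub>v (mH Z t *\<^sub>v d) = (T2 Z t * U1 Z t) *\<^sub>v (Sig Z t *\<^sub>v ((V1 Z t)\<^sup>T *\<^sub>v d))"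
    using carrier_matD[OF S(1)] carrier_matD[OF S(3)] carrier_matD[OF S(5)] carrier_matD[OF T] carrier_vecD[OF d]
    by (simp add: H_eq[OF t] mat_vec_expand)
  also have "\<dots> = 0\<^sub>v k" unfolding U_orthonormal(2)[OF t]
    using carrier_matD[OF S(5)] by (intro zero_mult_mat_vec_dim) simp
  finally show ?thesis .
qed

text \<open>
  The correction term in \<open>T1\<close> applies \<open>T2\<close> first, which annihilates \<open>H\<close>; what is left is \<open>U\<^sub>1\<^sup>T H = \<Sigma> V\<^sub>1\<^sup>T\<close>.
\<close>

lemma T1_H: "t0 \<le> t \<Longrightarrow> d \<in> carrier_vec (nd Z) \<Longrightarrow> M1 Z t *\<^sub>v (T1 Z t *\<^sub>v (mH Z t *\<^sub>v d)) = (V1 Z t)\<^sup>T *\<^sub>v d"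
proof -
  assume t: "t0 \<le> t" and d: "d \<in> carrier_vec (nd Z)"
  note S = svd_carrier[OF t] and T = T2_carrier[OF t] and R = R_inverse(2)[OF t] and Rn = Rn_carrier[OF t]
  note dims = carrier_matD[OF S(1)] carrier_matD[OF S(2)] carrier_matD[OF S(3)] carrier_matD[OF S(5)] carrier_matD[OF T]
    carrier_vecD[OF d] carrier_matD[OF R] carrier_matD[OF Rn] carrier_matD[OF plant_carrier(7)[OF t]]
  define z where "z = Sig Z t *\<^sub>v ((V1 Z t)\<^sup>T *\<^sub>v d)"
  have z: "dim_vec z = r" using dims by (simp add: z_def)
  have Hd: "mH Z t *\<^sub>v d = U1 Z t *\<^sub>v z"
    using dims by (simp add: H_eq[OF t] mat_vec_expand z_def)
  have "T1 Z t *\<^sub>v (mH Z t *\<^sub>v d) = (U1 Z t)\<^sup>T *\<^sub>v (mH Z t *\<^sub>v d)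
      - (U1 Z t)\<^sup>T *\<^sub>v (Rn Z t *\<^sub>v (U2 Z t *\<^sub>v (minv (R2 Z t) *\<^sub>v (T2 Z t *\<^sub>v (mH Z t *\<^sub>v d)))))"
    unfolding T1_eq[OF t] using dims by (simp add: mat_vec_expand)
  also have "(U1 Z t)\<^sup>T *\<^sub>v (Rn Z t *\<^sub>v (U2 Z t *\<^sub>v (minv (R2 Z t) *\<^sub>v (T2 Z t *\<^sub>v (mH Z t *\<^sub>v d))))) = 0\<^sub>v r"
    using dims by (simp add: T2_H[OF t d] mult_mat_vec_zero_dim)
  also have "(U1 Z t)\<^sup>T *\<^sub>v (mH Z t *\<^sub>v d) = ((U1 Z t)\<^sup>T * U1 Z t) *\<^sub>v z"
    unfolding Hd using dims z by (simp add: mult_mat_vec_assoc_dim)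
  also have "\<dots> - 0\<^sub>v r = z" unfolding U_orthonormal(1)[OF t] one_mult_mat_vec_dim[OF z]
    using z by (intro eq_vecI) auto
  finally have "T1 Z t *\<^sub>v (mH Z t *\<^sub>v d) = z" .
  moreover have "M1 Z t *\<^sub>v z = (V1 Z t)\<^sup>T *\<^sub>v d"
  proof -
    have "M1 Z t *\<^sub>v z = (M1 Z t * Sig Z t) *\<^sub>v ((V1 Z t)\<^sup>T *\<^sub>v d)"
      using dims carrier_matD[OF gain_carrier(4)[OF t]] by (simp add: z_def mult_mat_vec_assoc_dim)
    then show ?thesis using minv_inverse(3)[OF S(5) svd_facts(3)[OF t]] dims by (simp add: M1_def one_mult_mat_vec_dim)
  qed
  ultimately show ?thesis by simp
qed

lemma M2_left_inverse:
  assumes t: "t0 \<le> t" and d: "d \<in> carrier_vec g"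
  shows "M2 Z t *\<^sub>v (T2 Z t *\<^sub>v (mC Z t *\<^sub>v (G2 Z t *\<^sub>v d))) = d"
proof -
  note inv = gain_facts(3)[OF t]
  note c = gain_carrier[OF t]
  note N = minv_inverse[OF c(7) inv]
  note dims = carrier_matD[OF c(3)] carrier_matD[OF c(6)] carrier_matD[OF c(7)] carrier_matD[OF N(1)]
    carrier_matD[OF T2_carrier[OF t]] carrier_matD[OF plant_carrier(4)[OF t]] carrier_vecD[OF d]
  have "M2 Z t *\<^sub>v (T2 Z t *\<^sub>v (mC Z t *\<^sub>v (G2 Z t *\<^sub>v d))) = minv (normal_mat Z t) *\<^sub>v (normal_mat Z t *\<^sub>v d)"
  proof -
    have "normal_mat Z t *\<^sub>v d = (G2 Z t)\<^sup>T *\<^sub>v ((C2 Z t)\<^sup>T *\<^sub>v (minv (R2_tilde Z t) *\<^sub>v (C2 Z t *\<^sub>v (G2 Z t *\<^sub>v d))))"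
      unfolding normal_mat_def using dims by (simp add: mult_mat_vec_assoc_dim C2_def)
    moreover have "M2 Z t *\<^sub>v (C2 Z t *\<^sub>v (G2 Z t *\<^sub>v d)) = minv (normal_mat Z t) *\<^sub>v
        ((G2 Z t)\<^sup>T *\<^sub>v ((C2 Z t)\<^sup>T *\<^sub>v (minv (R2_tilde Z t) *\<^sub>v (C2 Z t *\<^sub>v (G2 Z t *\<^sub>v d)))))"
      unfolding M2_def using dims by (simp add: mult_mat_vec_assoc_dim C2_def)
    moreover have "C2 Z t *\<^sub>v (G2 Z t *\<^sub>v d) = T2 Z t *\<^sub>v (mC Z t *\<^sub>v (G2 Z t *\<^sub>v d))"
      using dims by (simp add: mult_mat_vec_assoc_dim C2_def)
    ultimately show ?thesis by simp
  qed
  also have "\<dots> = (minv (normal_mat Z t) * normal_mat Z t) *\<^sub>v d"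
    using dims by (simp add: mult_mat_vec_assoc_dim)
  also have "\<dots> = d" unfolding N(3) using dims by (simp add: one_mult_mat_vec_dim)
  finally show ?thesis .
qed

text \<open>
  The coefficient, up to sign, with which the measurement noise \<open>v\<close> itself enters the error dynamics.
\<close>

definition v_coeff :: "real \<Rightarrow> rmat" where
  "v_coeff t = Proj Z t * G1 Z t * M1 Z t * T1 Z t + L_gain Z t * T2 Z t"

lemma Phi1_carrier: assumes t: "t0 \<le> t" shows "Phi1 Z t \<in> carrier_mat n l"
  unfolding Phi1_def using gain_carrier(3,8)[OF t] T2_carrier[OF t] by simp

text \<open>
  Continuity is needed because centred processes may only be multiplied by coefficients that are bounded
  on compact intervals, and such bounds on the gains come from their continuity. The product \<open>G\<^sub>2 M\<^sub>2\<close> is recovered from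
  the differentiable \<open>\<Phi>\<^sub>1 = G\<^sub>2 M\<^sub>2 T\<^sub>2\<close> by multiplying with \<open>U\<^sub>2\<close>, which avoids the inverses in the definition
  of \<open>M\<^sub>2\<close>.
\<close>

lemma coefficients_continuous:
  "continuous_mat t0 n (nw Z) (\<lambda>t. Proj Z t * mW Z t)" "continuous_mat t0 n l v_coeff" "continuous_mat t0 n l (Phi1 Z)"
proof -
  have cC: "continuous_mat t0 l n (mC Z)" and cG: "continuous_mat t0 n (nd Z) (mG Z)" and cW: "continuous_mat t0 n (nw Z) (mW Z)"
    using plant_carrier(3,4,6) plant_deriv(5-7) by (auto intro!: continuous_mat_deriv simp: matrix_fun_def)
  have cU1: "continuous_mat t0 l r (U1 Z)" and cU2: "continuous_mat t0 l k (U2 Z)" and cV1: "continuous_mat t0 (nd Z) r (V1 Z)"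
    and cSig: "continuous_mat t0 r r (Sig Z)"
    using svd_carrier svd_facts(6,7,8) exI[of "\<lambda>F'. has_mderiv t0 (U2 Z) F' t" for t, OF svd_facts(5)]
    by (auto intro!: continuous_mat_deriv simp: matrix_fun_def)
  have cPv: "continuous_mat t0 (2 * l) (2 * l) (Pv Z)"
    using plant_carrier(10) gain_facts(7) by (auto intro!: continuous_mat_deriv simp: matrix_fun_def)
  have cPx: "continuous_mat t0 n n (Px Z)"
    using plant_carrier(11) gain_facts(4) by (auto intro!: continuous_mat_deriv simp: matrix_fun_def)
  show cPhi: "continuous_mat t0 n l (Phi1 Z)"
    using Phi1_carrier gain_facts(5) by (auto intro!: continuous_mat_deriv simp: matrix_fun_def)
  have cT2: "continuous_mat t0 k l (T2 Z)"
    using continuous_mat_transpose[OF cU2] by (simp add: T2_def[abs_def])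
  have cG1: "continuous_mat t0 n r (G1 Z)" using continuous_mat_mult[OF cG cV1] by (simp add: G1_def[abs_def])
  have cM1: "continuous_mat t0 r r (M1 Z)"
    using continuous_mat_minv[OF cSig] svd_facts(3) by (simp add: M1_def[abs_def])
  have cS: "continuous_mat t0 l (2 * l) (\<lambda>t. hcat (1\<^sub>m l) (0\<^sub>m l l))"
    using hcat_carrier[OF one_carrier_mat zero_carrier_mat, of l l] by (intro continuous_mat_const) (simp add: mult_2)
  have cRn: "continuous_mat t0 l l (Rn Z)"
    using continuous_mat_mult[OF continuous_mat_mult[OF cS cPv] continuous_mat_transpose[OF cS]]
    by (simp add: Rn_def[abs_def] Let_def)
  have cR2: "continuous_mat t0 k k (R2 Z)"
  proof -
    have "continuous_mat t0 k k (\<lambda>t. (U2 Z t)\<^sup>T * Rn Z t * U2 Z t)"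
      by (intro continuous_mat_mult[OF continuous_mat_mult[OF continuous_mat_transpose[OF cU2] cRn] cU2])
    then show ?thesis by (rule continuous_mat_cong) (rule R2_eq)
  qed
  have cR2i: "continuous_mat t0 k k (\<lambda>t. minv (R2 Z t))"
    by (rule continuous_mat_minv[OF cR2 gain_facts(1)])
  have cT1: "continuous_mat t0 r l (T1 Z)"
  proof -
    have "continuous_mat t0 r l (\<lambda>t. (U1 Z t)\<^sup>T - (U1 Z t)\<^sup>T * Rn Z t * U2 Z t * minv (R2 Z t) * T2 Z t)"
      by (intro continuous_mat_minus continuous_mat_transpose[OF cU1] continuous_mat_mult[OF continuous_mat_mult[OF
          continuous_mat_mult[OF continuous_mat_mult[OF continuous_mat_transpose[OF cU1] cRn] cU2] cR2i] cT2])
    then show ?thesis by (rule continuous_mat_cong) (rule T1_eq[symmetric])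
  qed
  have cP: "continuous_mat t0 n n (Proj Z)"
  proof -
    have "continuous_mat t0 n n (\<lambda>t. 1\<^sub>m n - Phi1 Z t * mC Z t)"
      by (intro continuous_mat_minus continuous_mat_const one_carrier_mat continuous_mat_mult[OF cPhi cC])
    then show ?thesis
    proof (rule continuous_mat_cong)
      fix t assume t: "t0 \<le> t"
      note d = carrier_matD[OF gain_carrier(3)[OF t]] carrier_matD[OF gain_carrier(8)[OF t]]
        carrier_matD[OF T2_carrier[OF t]] carrier_matD[OF plant_carrier(4)[OF t]]
      show "1\<^sub>m n - Phi1 Z t * mC Z t = Proj Z t"
        unfolding Proj_def Phi1_def C2_def by (simp add: mult_mat_assoc_dim d)
    qed
  qed
  have cR2g: "continuous_mat t0 k k (R2_grave Z)"
  proof -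
    have z: "continuous_mat t0 k l (\<lambda>t. 0\<^sub>m k l)" by (intro continuous_mat_const) simp
    have "continuous_mat t0 k (2 * l) (\<lambda>t. hcat (T2 Z t) (0\<^sub>m k l))" "continuous_mat t0 k (2 * l) (\<lambda>t. hcat (0\<^sub>m k l) (T2 Z t))"
      using continuous_mat_hcat[OF cT2 z] continuous_mat_hcat[OF z cT2] by (simp_all add: mult_2)
    then have "continuous_mat t0 k k (\<lambda>t. hcat (T2 Z t) (0\<^sub>m k l) * Pv Z t * (hcat (0\<^sub>m k l) (T2 Z t))\<^sup>T)"
      by (intro continuous_mat_mult[OF continuous_mat_mult[OF _ cPv] continuous_mat_transpose])
    then show ?thesis
    proof (rule continuous_mat_cong)
      fix t assume t: "t0 \<le> t"
      show "hcat (T2 Z t) (0\<^sub>m k l) * Pv Z t * (hcat (0\<^sub>m k l) (T2 Z t))\<^sup>T = R2_grave Z t"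
        by (simp add: R2_grave_def selL_def selR_def carrier_matD[OF T2_carrier[OF t]])
    qed
  qed
  have cL: "continuous_mat t0 n k (L_gain Z)"
  proof -
    have "continuous_mat t0 n k (\<lambda>t. (Px Z t * (T2 Z t * mC Z t)\<^sup>T - (Phi1 Z t * U2 Z t) * (R2_grave Z t)\<^sup>T) * minv (R2 Z t))"
      by (intro continuous_mat_mult[OF continuous_mat_minus[OF continuous_mat_mult[OF cPx continuous_mat_transpose[OF
          continuous_mat_mult[OF cT2 cC]]] continuous_mat_mult[OF continuous_mat_mult[OF cPhi cU2] continuous_mat_transpose[OF cR2g]]] cR2i])
    then show ?thesis
    proof (rule continuous_mat_cong)
      fix t assume t: "t0 \<le> t"
      note d = carrier_matD[OF gain_carrier(3)[OF t]] carrier_matD[OF gain_carrier(8)[OF t]]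
        carrier_matD[OF T2_carrier[OF t]] carrier_matD[OF svd_carrier(2)[OF t]]
      \<comment> \<open>\<open>T\<^sub>2 U\<^sub>2 = 1\<close>, so multiplying \<open>\<Phi>\<^sub>1\<close> by \<open>U\<^sub>2\<close> removes \<open>T\<^sub>2\<close>.\<close>
      have GM: "G2 Z t * M2 Z t \<in> carrier_mat n k" using gain_carrier(3,8)[OF t] by simp
      have "Phi1 Z t * U2 Z t = (G2 Z t * M2 Z t) * (T2 Z t * U2 Z t)"
        unfolding Phi1_def by (simp add: mult_mat_assoc_dim d)
      also have "\<dots> = G2 Z t * M2 Z t" unfolding U_orthonormal(3)[OF t] by (rule right_mult_one_mat[OF GM])
      finally show "(Px Z t * (T2 Z t * mC Z t)\<^sup>T - (Phi1 Z t * U2 Z t) * (R2_grave Z t)\<^sup>T) * minv (R2 Z t) = L_gain Z t"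
        unfolding L_gain_def C2_def by simp
    qed
  qed
  show "continuous_mat t0 n (nw Z) (\<lambda>t. Proj Z t * mW Z t)" by (rule continuous_mat_mult[OF cP cW])
  show "continuous_mat t0 n l v_coeff"
    unfolding v_coeff_def[abs_def]
    by (intro continuous_mat_add continuous_mat_mult[OF continuous_mat_mult[OF continuous_mat_mult[OF cP cG1] cM1] cT1]
        continuous_mat_mult[OF cL cT2])
qed

text \<open>
  Differentiating \<open>\<theta> + \<Phi>\<^sub>1 y + \<Phi>\<^sub>2 u\<close>, the terms with \<open>\<Phi>\<^sub>1'\<close> and \<open>\<Phi>\<^sub>2'\<close> in the filter equation cancel and \<open>\<Phi>\<^sub>1 y'\<close>
  appears. It is evaluated by differentiating \<open>T\<^sub>2 y = T\<^sub>2 (C x + D u + v)\<close> in two ways.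
\<close>

lemma error_ode:
  fixes x v vd w \<theta> y :: "real \<Rightarrow> rvec" and xhat0 :: rvec
  assumes car: "\<And>t. t0 \<le> t \<Longrightarrow> x t \<in> carrier_vec n" "\<And>t. t0 \<le> t \<Longrightarrow> v t \<in> carrier_vec l"
      "\<And>t. t0 \<le> t \<Longrightarrow> vd t \<in> carrier_vec l" "\<And>t. t0 \<le> t \<Longrightarrow> w t \<in> carrier_vec (nw Z)"
      "\<And>t. t0 \<le> t \<Longrightarrow> \<theta> t \<in> carrier_vec n"
    and dx: "\<And>t. t0 \<le> t \<Longrightarrow> has_vderiv t0 x
      (mA Z t *\<^sub>v x t + mB Z t *\<^sub>v inp Z t + mG Z t *\<^sub>v unk Z t + mW Z t *\<^sub>v w t) t"
    and dv: "\<And>t. t0 \<le> t \<Longrightarrow> has_vderiv t0 v (vd t) t"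
    and y: "\<And>t. y t = mC Z t *\<^sub>v x t + mD Z t *\<^sub>v inp Z t + mH Z t *\<^sub>v unk Z t + v t"
    and dy: "vdifferentiable t0 y" and fp: "filter_path Z y xhat0 \<theta>" and t: "t0 \<le> t"
  shows "has_vderiv t0 (\<lambda>s. x s - state_estimate Z y \<theta> s)
    (A_breve Z t *\<^sub>v (x t - state_estimate Z y \<theta> t)
      + ((Proj Z t * mW Z t) *\<^sub>v w t - v_coeff t *\<^sub>v v t - Phi1 Z t *\<^sub>v vd t)) t"
proof -
  obtain yd where yd: "has_vderiv t0 y yd t" using dy t unfolding vdifferentiable_def by blast
  have "vdifferentiable t0 (inp Z)" using plant unfolding plant_def by (elim conjE) assumption
  then obtain ud where ud: "has_vderiv t0 (inp Z) ud t" using t unfolding vdifferentiable_def by blast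
  have yc: "y s \<in> carrier_vec l" if "t0 \<le> s" for s unfolding y
    using car(2)[OF that] by (intro add_carrier_vec mult_mat_vec_carrier[OF plant_carrier(4)[OF that] car(1)[OF that]]
      mult_mat_vec_carrier[OF plant_carrier(5)[OF that] plant_carrier(8)[OF that]]
      mult_mat_vec_carrier[OF plant_carrier(7)[OF that] plant_carrier(9)[OF that]])
  \<comment> \<open>The output without its part \<open>H d\<close>, which \<open>T\<^sub>2\<close> annihilates.\<close>
  define z where "z = (\<lambda>s. mC Z s *\<^sub>v x s + mD Z s *\<^sub>v inp Z s + v s)"
  have Cx: "mC Z s *\<^sub>v x s \<in> carrier_vec l" if "t0 \<le> s" for s
    by (rule mult_mat_vec_carrier[OF plant_carrier(4)[OF that] car(1)[OF that]])
  have Du: "mD Z s *\<^sub>v inp Z s \<in> carrier_vec l" if "t0 \<le> s" for s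
    by (rule mult_mat_vec_carrier[OF plant_carrier(5)[OF that] plant_carrier(8)[OF that]])
  have zc: "z s \<in> carrier_vec l" if "t0 \<le> s" for s
    unfolding z_def by (intro add_carrier_vec Cx Du car(2) that)
  define xd where "xd = mA Z t *\<^sub>v x t + mB Z t *\<^sub>v inp Z t + mG Z t *\<^sub>v unk Z t + mW Z t *\<^sub>v w t"
  define Cd where "Cd = mderiv t0 (mC Z) t"
  define Dd where "Dd = mderiv t0 (mD Z) t"
  define zd where "zd = (Cd *\<^sub>v x t + mC Z t *\<^sub>v xd) + (Dd *\<^sub>v inp Z t + mD Z t *\<^sub>v ud) + vd t"
  have dC: "has_mderiv t0 (mC Z) Cd t" and dD: "has_mderiv t0 (mD Z) Dd t"
    unfolding Cd_def Dd_def by (rule plant_deriv(1)[OF t], rule plant_deriv(2)[OF t])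
  have dxt: "has_vderiv t0 x xd t" unfolding xd_def by (rule dx[OF t])
  have zdv: "has_vderiv t0 z zd t"
    unfolding z_def zd_def
    by (rule has_vderiv_add[OF has_vderiv_add[OF has_vderiv_mult_mat_vec[OF dC plant_carrier(4) dxt car(1) t] Cx
          has_vderiv_mult_mat_vec[OF dD plant_carrier(5) ud plant_carrier(8) t] Du t]
          add_carrier_vec[OF Cx Du] dv[OF t] car(2) t])
  have dT2: "has_mderiv t0 (T2 Z) (0\<^sub>m k l) t"
    unfolding has_mderiv_def
  proof (intro conjI allI impI)
    fix i j assume "i < dim_row (T2 Z t)" "j < dim_col (T2 Z t)"
    then have ij: "i < k" "j < l" using T2_carrier[OF t] by auto
    have "((\<lambda>s. U2 Z s $$ (j,i)) has_real_derivative (0\<^sub>m l k) $$ (j,i)) (at t within {t0..})"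
      by (rule has_mderivD(2)[OF svd_facts(5)[OF t] svd_carrier(2)[OF t] ij(2,1)])
    then have "((\<lambda>s. U2 Z s $$ (j,i)) has_real_derivative (0\<^sub>m k l) $$ (i,j)) (at t within {t0..})"
      using ij by simp
    then show "((\<lambda>s. T2 Z s $$ (i,j)) has_real_derivative (0\<^sub>m k l) $$ (i,j)) (at t within {t0..})"
    proof (rule deriv_cong_halfline[OF _ t])
      fix s assume "t0 \<le> s"
      then show "T2 Z s $$ (i,j) = U2 Z s $$ (j,i)"
        using ij carrier_matD[OF svd_carrier(2)] by (simp add: T2_def)
    qed
  qed (use T2_carrier[OF t] in auto)
  have T2c: "T2 Z s *\<^sub>v y s \<in> carrier_vec k" if "t0 \<le> s" for s
    by (rule mult_mat_vec_carrier[OF T2_carrier[OF that] yc[OF that]])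
  have T2yz: "T2 Z s *\<^sub>v y s = T2 Z s *\<^sub>v z s" if s: "t0 \<le> s" for s
  proof -
    note d = carrier_vecD[OF Cx[OF s]] carrier_vecD[OF Du[OF s]] carrier_vecD[OF car(2)[OF s]] carrier_matD[OF T2_carrier[OF s]]
      carrier_matD[OF plant_carrier(7)[OF s]] carrier_matD[OF plant_carrier(4)[OF s]] carrier_matD[OF plant_carrier(5)[OF s]]
    show ?thesis
      unfolding y z_def
      by (rule eq_vecI) (simp_all add: d mult_mat_vec_add_dim T2_H[OF s plant_carrier(9)[OF s]] del: index_mult_mat_vec)
  qed
  have ydc: "yd \<in> carrier_vec l" by (rule has_vderivD(1)[OF yd yc[OF t]])
  have udc: "ud \<in> carrier_vec m" by (rule has_vderivD(1)[OF ud plant_carrier(8)[OF t]])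
  have zdc: "zd \<in> carrier_vec l" by (rule has_vderivD(1)[OF zdv zc[OF t]])
  have "0\<^sub>m k l *\<^sub>v y t + T2 Z t *\<^sub>v yd = 0\<^sub>m k l *\<^sub>v z t + T2 Z t *\<^sub>v zd"
    by (rule has_vderiv_unique[OF has_vderiv_mult_mat_vec[OF dT2 T2_carrier yd yc t]
          has_vderiv_mult_mat_vec[OF dT2 T2_carrier zdv zc t] t T2c T2yz])
  then have T2yd: "T2 Z t *\<^sub>v yd = T2 Z t *\<^sub>v zd"
    using zero_mult_mat_vec_dim[OF carrier_vecD[OF yc[OF t]], of k] zero_mult_mat_vec_dim[OF carrier_vecD[OF zc[OF t]], of k]
      left_zero_vec[OF mult_mat_vec_carrier[OF T2_carrier[OF t] ydc]] left_zero_vec[OF mult_mat_vec_carrier[OF T2_carrier[OF t] zdc]]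
    by simp
  note gc = gain_carrier[OF t]
  have Phi2c: "Phi2 Z s \<in> carrier_mat n m" if s: "t0 \<le> s" for s
    unfolding Phi2_def D2_def using gain_carrier(3,8)[OF s] T2_carrier[OF s] plant_carrier(5)[OF s]
    by (intro uminus_carrier_mat) (rule mult_carrier_mat[OF mult_carrier_mat mult_carrier_mat])
  have se_eq: "state_estimate Z y \<theta> s = Phi1 Z s *\<^sub>v y s + Phi2 Z s *\<^sub>v inp Z s + \<theta> s" if s: "t0 \<le> s" for s
  proof -
    note d = carrier_matD[OF gain_carrier(3)[OF s]] carrier_matD[OF gain_carrier(8)[OF s]] carrier_matD[OF T2_carrier[OF s]]
      carrier_matD[OF plant_carrier(5)[OF s]] carrier_vecD[OF plant_carrier(8)[OF s]] carrier_vecD[OF yc[OF s]] carrier_vecD[OF car(5)[OF s]]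
    show ?thesis
      unfolding state_estimate_def Phi1_def Phi2_def D2_def
      by (rule eq_vecI) (simp_all add: d mat_vec_expand del: index_mult_mat_vec)
  qed
  have Py: "Phi1 Z s *\<^sub>v y s \<in> carrier_vec n" if "t0 \<le> s" for s
    by (rule mult_mat_vec_carrier[OF Phi1_carrier[OF that] yc[OF that]])
  have Pu: "Phi2 Z s *\<^sub>v inp Z s \<in> carrier_vec n" if "t0 \<le> s" for s
    by (rule mult_mat_vec_carrier[OF Phi2c[OF that] plant_carrier(8)[OF that]])
  define \<theta>d where "\<theta>d = (A_bar Z t - L_gain Z t * C2 Z t) *\<^sub>v state_estimate Z y \<theta> t
           + (B_bar Z t - L_gain Z t * D2 Z t) *\<^sub>v inp Z t
           + G_bar Z t *\<^sub>v (M1 Z t *\<^sub>v (T1 Z t *\<^sub>v y t))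
           + L_gain Z t *\<^sub>v (T2 Z t *\<^sub>v y t)
           - mderiv t0 (Phi1 Z) t *\<^sub>v y t
           - mderiv t0 (Phi2 Z) t *\<^sub>v inp Z t"
  have d\<theta>: "has_vderiv t0 \<theta> \<theta>d t"
    using fp t unfolding filter_path_def \<theta>d_def by blast
  define xhd where "xhd = (mderiv t0 (Phi1 Z) t *\<^sub>v y t + Phi1 Z t *\<^sub>v yd)
    + (mderiv t0 (Phi2 Z) t *\<^sub>v inp Z t + Phi2 Z t *\<^sub>v ud) + \<theta>d"
  have "has_vderiv t0 (\<lambda>s. Phi1 Z s *\<^sub>v y s + Phi2 Z s *\<^sub>v inp Z s + \<theta> s) xhd t"
    unfolding xhd_def
    by (rule has_vderiv_add[OF has_vderiv_add[OF has_vderiv_mult_mat_vec[OF plant_deriv(3)[OF t] Phi1_carrier yd yc t] Py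
          has_vderiv_mult_mat_vec[OF plant_deriv(4)[OF t] Phi2c ud plant_carrier(8) t] Pu t]
          add_carrier_vec[OF Py Pu] d\<theta> car(5) t])
  then have dse: "has_vderiv t0 (state_estimate Z y \<theta>) xhd t"
    by (rule has_vderiv_cong[OF _ add_carrier_vec[OF add_carrier_vec[OF Py Pu] car(5)] se_eq t])
  have sec: "state_estimate Z y \<theta> s \<in> carrier_vec n" if "t0 \<le> s" for s
    unfolding se_eq[OF that] by (intro add_carrier_vec Py Pu car(5) that)
  have main: "has_vderiv t0 (\<lambda>s. x s - state_estimate Z y \<theta> s) (xd - xhd) t"
    by (rule has_vderiv_diff[OF dxt car(1) dse sec t])
  define d1 where "d1 = (V1 Z t)\<^sup>T *\<^sub>v unk Z t"
  define d2 where "d2 = (V2 Z t)\<^sup>T *\<^sub>v unk Z t"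
  have d1c: "d1 \<in> carrier_vec r" unfolding d1_def
    by (rule mult_mat_vec_carrier[OF _ plant_carrier(9)[OF t]]) (simp add: svd_carrier(3)[OF t])
  have d2c: "d2 \<in> carrier_vec g" unfolding d2_def
    by (rule mult_mat_vec_carrier[OF _ plant_carrier(9)[OF t]]) (simp add: svd_carrier(4)[OF t])
  have Gd: "mG Z t *\<^sub>v unk Z t = G1 Z t *\<^sub>v d1 + G2 Z t *\<^sub>v d2"
  proof -
    note d = carrier_matD[OF plant_carrier(3)[OF t]] carrier_matD[OF svd_carrier(3)[OF t]] carrier_matD[OF svd_carrier(4)[OF t]]
      carrier_vecD[OF d1c] carrier_vecD[OF d2c]
    have "mG Z t *\<^sub>v unk Z t = mG Z t *\<^sub>v (V1 Z t *\<^sub>v d1 + V2 Z t *\<^sub>v d2)"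
      unfolding d1_def d2_def V_complete[OF t plant_carrier(9)[OF t]] ..
    then show ?thesis by (simp add: G1_def G2_def mat_vec_expand d)
  qed
  have Cdc: "Cd \<in> carrier_mat l n" by (rule has_mderivD(1)[OF dC plant_carrier(4)[OF t]])
  have Ddc: "Dd \<in> carrier_mat l m" by (rule has_mderivD(1)[OF dD plant_carrier(5)[OF t]])
  have P1dc: "mderiv t0 (Phi1 Z) t \<in> carrier_mat n l" by (rule has_mderivD(1)[OF plant_deriv(3)[OF t] Phi1_carrier[OF t]])
  have P2dc: "mderiv t0 (Phi2 Z) t \<in> carrier_mat n m" by (rule has_mderivD(1)[OF plant_deriv(4)[OF t] Phi2c[OF t]])
  have xd_eq: "xd = mA Z t *\<^sub>v x t + mB Z t *\<^sub>v inp Z t + (G1 Z t *\<^sub>v d1 + G2 Z t *\<^sub>v d2) + mW Z t *\<^sub>v w t"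
    unfolding xd_def Gd ..
  have T2yd': "T2 Z t *\<^sub>v yd = T2 Z t *\<^sub>v (Cd *\<^sub>v x t + mC Z t *\<^sub>v xd + (Dd *\<^sub>v inp Z t + mD Z t *\<^sub>v ud) + vd t)"
    unfolding T2yd zd_def ..
  have xhd_eq: "xhd = (A_bar Z t - L_gain Z t * (T2 Z t * mC Z t)) *\<^sub>v state_estimate Z y \<theta> t
      + (B_bar Z t - L_gain Z t * (T2 Z t * mD Z t)) *\<^sub>v inp Z t
      + (Proj Z t * G1 Z t) *\<^sub>v (M1 Z t *\<^sub>v (T1 Z t *\<^sub>v y t))
      + L_gain Z t *\<^sub>v (T2 Z t *\<^sub>v y t) + G2 Z t *\<^sub>v (M2 Z t *\<^sub>v (T2 Z t *\<^sub>v yd))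
      - G2 Z t *\<^sub>v (M2 Z t *\<^sub>v ((T2 Z t * mD Z t) *\<^sub>v ud))"
  proof -
    define a1 where "a1 = (A_bar Z t - L_gain Z t * (T2 Z t * mC Z t)) *\<^sub>v state_estimate Z y \<theta> t"
    define a2 where "a2 = (B_bar Z t - L_gain Z t * (T2 Z t * mD Z t)) *\<^sub>v inp Z t"
    define a3 where "a3 = (Proj Z t * G1 Z t) *\<^sub>v (M1 Z t *\<^sub>v (T1 Z t *\<^sub>v y t))"
    define a4 where "a4 = L_gain Z t *\<^sub>v (T2 Z t *\<^sub>v y t)"
    define b1 where "b1 = mderiv t0 (Phi1 Z) t *\<^sub>v y t"
    define b2 where "b2 = mderiv t0 (Phi2 Z) t *\<^sub>v inp Z t"
    define c1 where "c1 = G2 Z t *\<^sub>v (M2 Z t *\<^sub>v (T2 Z t *\<^sub>v yd))"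
    define c2 where "c2 = G2 Z t *\<^sub>v (M2 Z t *\<^sub>v ((T2 Z t * mD Z t) *\<^sub>v ud))"
    note d = carrier_matD[OF gc(3)] carrier_matD[OF gc(8)] carrier_matD[OF T2_carrier[OF t]]
      carrier_matD[OF plant_carrier(5)[OF t]] carrier_vecD[OF ydc] carrier_vecD[OF udc]
    have e1: "Phi1 Z t *\<^sub>v yd = c1" unfolding Phi1_def c1_def by (simp add: mat_vec_expand d)
    have e2: "Phi2 Z t *\<^sub>v ud = - c2" unfolding Phi2_def c2_def D2_def
      by (rule eq_vecI) (simp_all add: mat_vec_expand d del: index_mult_mat_vec)
    have dims: "dim_vec a1 = n" "dim_vec a2 = n" "dim_vec a3 = n" "dim_vec a4 = n"
      "dim_vec b1 = n" "dim_vec b2 = n" "dim_vec c1 = n" "dim_vec c2 = n"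
      unfolding a1_def a2_def a3_def a4_def b1_def b2_def c1_def c2_def B_bar_def
      using carrier_matD[OF gc(9)] carrier_matD[OF gc(10)] carrier_matD[OF P1dc] carrier_matD[OF P2dc] d by simp_all
    have "xhd = (b1 + c1) + (b2 + - c2) + (a1 + a2 + a3 + a4 - b1 - b2)"
      unfolding xhd_def \<theta>d_def e1 e2 b1_def[symmetric] b2_def[symmetric]
      unfolding a1_def a2_def a3_def a4_def C2_def D2_def G_bar_def ..
    also have "\<dots> = a1 + a2 + a3 + a4 + c1 - c2"
      by (rule eq_vecI) (simp_all add: dims)
    finally show ?thesis unfolding a1_def a2_def a3_def a4_def c1_def c2_def .
  qed
  have "xd - xhd = (A_bar Z t - L_gain Z t * (T2 Z t * mC Z t)) *\<^sub>v (x t - state_estimate Z y \<theta> t)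
    + ((Proj Z t * mW Z t) *\<^sub>v w t - (Proj Z t * G1 Z t * M1 Z t * T1 Z t + L_gain Z t * T2 Z t) *\<^sub>v v t
      - (G2 Z t * M2 Z t * T2 Z t) *\<^sub>v vd t)"
  proof (rule error_dynamics_identity[OF plant_carrier(1,2)[OF t] gc(2,3) plant_carrier(6,4,5,7)[OF t] gc(1) T2_carrier[OF t]
        gc(4,8) Cdc Ddc gc(9) car(1)[OF t] sec[OF t] plant_carrier(8)[OF t] udc plant_carrier(9)[OF t] d1c d2c car(4,2,3)[OF t] ydc
        T2_H[OF t plant_carrier(9)[OF t]] T1_H[OF t plant_carrier(9)[OF t], folded d1_def] M2_left_inverse[OF t d2c]
        xd_eq y T2yd' _ _ _ xhd_eq])
    show "Proj Z t = 1\<^sub>m n - G2 Z t * M2 Z t * (T2 Z t * mC Z t)" unfolding Proj_def C2_def ..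
    show "A_bar Z t = Proj Z t * (mA Z t - G1 Z t * M1 Z t * (T1 Z t * mC Z t)) - G2 Z t * M2 Z t * T2 Z t * Cd"
      unfolding A_bar_def A_hat_def C1_def Cd_def ..
    show "B_bar Z t = Proj Z t * (mB Z t - G1 Z t * M1 Z t * (T1 Z t * mD Z t)) - G2 Z t * M2 Z t * T2 Z t * Dd"
      unfolding B_bar_def D1_def Dd_def ..
  qed
  then have "xd - xhd = A_breve Z t *\<^sub>v (x t - state_estimate Z y \<theta> t)
    + ((Proj Z t * mW Z t) *\<^sub>v w t - v_coeff t *\<^sub>v v t - Phi1 Z t *\<^sub>v vd t)"
    unfolding A_breve_def C2_def v_coeff_def Phi1_def .
  then show ?thesis using main by simp
qed

lemma initial_estimate:
  assumes "filter_path Z y xhat0 \<theta>" "xhat0 \<in> carrier_vec n" "y t0 \<in> carrier_vec l"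
  shows "state_estimate Z y \<theta> t0 = xhat0"
proof -
  have "\<theta> t0 = xhat0 - G2 Z t0 *\<^sub>v (M2 Z t0 *\<^sub>v (T2 Z t0 *\<^sub>v y t0)) + G2 Z t0 *\<^sub>v (M2 Z t0 *\<^sub>v (D2 Z t0 *\<^sub>v inp Z t0))"
    using assms(1) unfolding filter_path_def by blast
  moreover have "dim_row (G2 Z t0) = n" using gain_carrier(3)[of t0] by auto
  ultimately show ?thesis
    using assms(2) unfolding state_estimate_def
    by (intro eq_vecI) (auto simp del: index_mult_mat_vec)
qed

end

section \<open>Centred vector processes\<close>

lemma random_vector_carrier: "random_vector M k X \<Longrightarrow> \<omega> \<in> space M \<Longrightarrow> X \<omega> \<in> carrier_vec k"
  unfolding random_vector_def by blast

lemma random_vector_measurable: "random_vector M k X \<Longrightarrow> i < k \<Longrightarrow> (\<lambda>\<omega>. X \<omega> $ i) \<in> borel_measurable M"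
  unfolding random_vector_def by blast

lemma random_vectorI:
  fixes X :: "'w \<Rightarrow> rvec"
  assumes "\<And>\<omega>. \<omega> \<in> space M \<Longrightarrow> X \<omega> \<in> carrier_vec k"
    and "\<And>i. i < k \<Longrightarrow> f i \<in> borel_measurable M"
    and "\<And>i \<omega>. i < k \<Longrightarrow> \<omega> \<in> space M \<Longrightarrow> X \<omega> $ i = f i \<omega>"
  shows "random_vector M k X"
  unfolding random_vector_def
proof (intro conjI ballI allI impI)
  fix i assume "i < k"
  then show "(\<lambda>\<omega>. X \<omega> $ i) \<in> borel_measurable M"
    using assms(2)[of i] assms(3)[of i] by (subst measurable_cong[where g = "f i"]) auto
qed (fact assms(1))

lemma random_vector_const: "c \<in> carrier_vec k \<Longrightarrow> random_vector M k (\<lambda>\<omega>. c)"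
  by (rule random_vectorI[where f = "\<lambda>i \<omega>. c $ i"]) auto

lemma random_vector_add:
  assumes X: "random_vector M k X" and Y: "random_vector M k Y"
  shows "random_vector M k (\<lambda>\<omega>. X \<omega> + Y \<omega>)"
proof (rule random_vectorI[where f = "\<lambda>i \<omega>. X \<omega> $ i + Y \<omega> $ i"])
  fix i \<omega> assume "i < k" "\<omega> \<in> space M"
  then show "(X \<omega> + Y \<omega>) $ i = X \<omega> $ i + Y \<omega> $ i" using random_vector_carrier[OF Y, of \<omega>] by simp
qed (use random_vector_carrier[OF X] random_vector_carrier[OF Y] random_vector_measurable[OF X] random_vector_measurable[OF Y]
      in \<open>auto intro!: borel_measurable_add\<close>)

lemma random_vector_diff:
  assumes X: "random_vector M k X" and Y: "random_vector M k Y"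
  shows "random_vector M k (\<lambda>\<omega>. X \<omega> - Y \<omega>)"
proof (rule random_vectorI[where f = "\<lambda>i \<omega>. X \<omega> $ i - Y \<omega> $ i"])
  fix i \<omega> assume "i < k" "\<omega> \<in> space M"
  then show "(X \<omega> - Y \<omega>) $ i = X \<omega> $ i - Y \<omega> $ i" using random_vector_carrier[OF Y, of \<omega>] by simp
qed (use random_vector_carrier[OF X] random_vector_carrier[OF Y] random_vector_measurable[OF X] random_vector_measurable[OF Y]
      in \<open>auto intro!: borel_measurable_diff\<close>)

lemma random_vector_mult:
  assumes A: "A \<in> carrier_mat r k" and X: "random_vector M k X"
  shows "random_vector M r (\<lambda>\<omega>. A *\<^sub>v X \<omega>)"
proof (rule random_vectorI[where f = "\<lambda>i \<omega>. \<Sum>j<k. A $$ (i,j) * X \<omega> $ j"])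
  fix i \<omega> assume "i < r" "\<omega> \<in> space M"
  then show "(A *\<^sub>v X \<omega>) $ i = (\<Sum>j<k. A $$ (i,j) * X \<omega> $ j)"
    using A random_vector_carrier[OF X] by (intro mult_mat_vec_sum) auto
next
  fix i
  show "(\<lambda>\<omega>. \<Sum>j<k. A $$ (i,j) * X \<omega> $ j) \<in> borel_measurable M"
    using random_vector_measurable[OF X] by (intro borel_measurable_sum borel_measurable_times borel_measurable_const) auto
next
  fix \<omega> assume "\<omega> \<in> space M"
  then show "A *\<^sub>v X \<omega> \<in> carrier_vec r" using mult_mat_vec_carrier[OF A random_vector_carrier[OF X]] by blast
qed

lemma random_vector_append:
  assumes X: "random_vector M j X" and Y: "random_vector M k Y"
  shows "random_vector M (j + k) (\<lambda>\<omega>. X \<omega> @\<^sub>v Y \<omega>)"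
proof (rule random_vectorI[where f = "\<lambda>i \<omega>. if i < j then X \<omega> $ i else Y \<omega> $ (i - j)"])
  fix i \<omega> assume "i < j + k" "\<omega> \<in> space M"
  then show "(X \<omega> @\<^sub>v Y \<omega>) $ i = (if i < j then X \<omega> $ i else Y \<omega> $ (i - j))"
    using random_vector_carrier[OF X, of \<omega>] random_vector_carrier[OF Y, of \<omega>] by simp
next
  fix i assume "i < j + k"
  then show "(\<lambda>\<omega>. if i < j then X \<omega> $ i else Y \<omega> $ (i - j)) \<in> borel_measurable M"
    using random_vector_measurable[OF X, of i] random_vector_measurable[OF Y, of "i - j"] by (cases "i < j") auto
next
  fix \<omega> assume "\<omega> \<in> space M"
  then show "X \<omega> @\<^sub>v Y \<omega> \<in> carrier_vec (j + k)"
    using random_vector_carrier[OF X] random_vector_carrier[OF Y] by simp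
qed

lemma entry_le_fnorm:
  assumes "A \<in> carrier_mat r c" "i < r" "j < c" shows "\<bar>A $$ (i,j)\<bar> \<le> fnorm A"
proof -
  have "(A $$ (i,j))\<^sup>2 \<le> (\<Sum>j<c. (A $$ (i,j))\<^sup>2)" using assms by (intro member_le_sum) auto
  also have "\<dots> \<le> (\<Sum>i<r. \<Sum>j<c. (A $$ (i,j))\<^sup>2)"
    using assms by (intro member_le_sum[of i _ "\<lambda>i. \<Sum>j<c. (A $$ (i,j))\<^sup>2"]) (auto intro: sum_nonneg)
  finally have "sqrt ((A $$ (i,j))\<^sup>2) \<le> sqrt (\<Sum>i<r. \<Sum>j<c. (A $$ (i,j))\<^sup>2)" by (rule real_sqrt_le_mono)
  then show ?thesis using assms by (simp add: fnorm_def)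
qed

context prob_space
begin

definition centered_vector_process :: "real \<Rightarrow> nat \<Rightarrow> (real \<Rightarrow> 'a \<Rightarrow> rvec) \<Rightarrow> bool" where
  "centered_vector_process a k X \<longleftrightarrow>
     (\<forall>t\<ge>a. \<forall>\<omega>\<in>space M. X t \<omega> \<in> carrier_vec k) \<and> (\<forall>i<k. centered_process a (\<lambda>t \<omega>. X t \<omega> $ i))"

lemma centered_vector_processD:
  fixes X :: "real \<Rightarrow> 'a \<Rightarrow> rvec"
  assumes "centered_vector_process a k X"
  shows "a \<le> t \<Longrightarrow> \<omega> \<in> space M \<Longrightarrow> X t \<omega> \<in> carrier_vec k"
    and "i < k \<Longrightarrow> centered_process a (\<lambda>t \<omega>. X t \<omega> $ i)"
  using assms unfolding centered_vector_process_def by blast+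

lemma centered_vector_processI:
  fixes X :: "real \<Rightarrow> 'a \<Rightarrow> rvec"
  assumes "\<And>t \<omega>. a \<le> t \<Longrightarrow> \<omega> \<in> space M \<Longrightarrow> X t \<omega> \<in> carrier_vec k"
    and "\<And>i. i < k \<Longrightarrow> centered_process a (f i)"
    and "\<And>i t \<omega>. i < k \<Longrightarrow> a \<le> t \<Longrightarrow> \<omega> \<in> space M \<Longrightarrow> f i t \<omega> = X t \<omega> $ i"
  shows "centered_vector_process a k X"
  unfolding centered_vector_process_def
proof (intro conjI allI impI ballI)
  fix i assume i: "i < k"
  show "centered_process a (\<lambda>t \<omega>. X t \<omega> $ i)"
    by (rule centered_process_cong[OF assms(2)[OF i] assms(3)[OF i]])
qed (rule assms(1))

lemma centered_vector_process_mult: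
  assumes F: "continuous_mat a r k F" and X: "centered_vector_process a k X"
  shows "centered_vector_process a r (\<lambda>t \<omega>. F t *\<^sub>v X t \<omega>)"
proof (rule centered_vector_processI[where f = "\<lambda>i t \<omega>. \<Sum>j<k. F t $$ (i,j) * X t \<omega> $ j"])
  fix t \<omega> assume t: "a \<le> t" "\<omega> \<in> space M"
  note c = continuous_mat_carrier[OF F t(1)] centered_vector_processD(1)[OF X t]
  show "F t *\<^sub>v X t \<omega> \<in> carrier_vec r" by (rule mult_mat_vec_carrier[OF c])
  fix i assume "i < r"
  then show "(\<Sum>j<k. F t $$ (i,j) * X t \<omega> $ j) = (F t *\<^sub>v X t \<omega>) $ i" by (rule mult_mat_vec_sum[OF c, symmetric])
next
  fix i assume i: "i < r"
  show "centered_process a (\<lambda>t \<omega>. \<Sum>j<k. F t $$ (i,j) * X t \<omega> $ j)"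
    using i by (intro centered_process_sum centered_process_mult centered_vector_processD(2)[OF X] continuous_mat_entry[OF F]) auto
qed

lemma centered_vector_process_diff:
  assumes X: "centered_vector_process a k X" and Y: "centered_vector_process a k Y"
  shows "centered_vector_process a k (\<lambda>t \<omega>. X t \<omega> - Y t \<omega>)"
proof (rule centered_vector_processI[where f = "\<lambda>i t \<omega>. X t \<omega> $ i - Y t \<omega> $ i"])
  fix t \<omega> i assume t: "a \<le> t" "\<omega> \<in> space M" and "i < k"
  then show "X t \<omega> $ i - Y t \<omega> $ i = (X t \<omega> - Y t \<omega>) $ i" using centered_vector_processD(1)[OF Y t] by simp
next
  fix t \<omega> assume t: "a \<le> t" "\<omega> \<in> space M"
  show "X t \<omega> - Y t \<omega> \<in> carrier_vec k" using centered_vector_processD(1)[OF X t] centered_vector_processD(1)[OF Y t] by simp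
next
  fix i assume i: "i < k"
  show "centered_process a (\<lambda>t \<omega>. X t \<omega> $ i - Y t \<omega> $ i)"
    by (rule centered_process_diff[OF centered_vector_processD(2)[OF X i] centered_vector_processD(2)[OF Y i]])
qed

lemma centered_vector_process_add:
  assumes X: "centered_vector_process a k X" and Y: "centered_vector_process a k Y"
  shows "centered_vector_process a k (\<lambda>t \<omega>. X t \<omega> + Y t \<omega>)"
proof (rule centered_vector_processI[where f = "\<lambda>i t \<omega>. X t \<omega> $ i + Y t \<omega> $ i"])
  fix t \<omega> i assume t: "a \<le> t" "\<omega> \<in> space M" and "i < k"
  then show "X t \<omega> $ i + Y t \<omega> $ i = (X t \<omega> + Y t \<omega>) $ i" using centered_vector_processD(1)[OF Y t] by simp
next
  fix t \<omega> assume t: "a \<le> t" "\<omega> \<in> space M"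
  show "X t \<omega> + Y t \<omega> \<in> carrier_vec k" using centered_vector_processD(1)[OF X t] centered_vector_processD(1)[OF Y t] by simp
next
  fix i assume i: "i < k"
  show "centered_process a (\<lambda>t \<omega>. X t \<omega> $ i + Y t \<omega> $ i)"
    by (rule centered_process_add[OF centered_vector_processD(2)[OF X i] centered_vector_processD(2)[OF Y i]])
qed

lemma centered_vector_process_append:
  assumes X: "centered_vector_process a j X" and Y: "centered_vector_process a k Y"
  shows "centered_vector_process a (j + k) (\<lambda>t \<omega>. X t \<omega> @\<^sub>v Y t \<omega>)"
proof (rule centered_vector_processI[where f = "\<lambda>i t \<omega>. if i < j then X t \<omega> $ i else Y t \<omega> $ (i - j)"])
  fix t \<omega> i assume t: "a \<le> t" "\<omega> \<in> space M" and "i < j + k"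
  then show "(if i < j then X t \<omega> $ i else Y t \<omega> $ (i - j)) = (X t \<omega> @\<^sub>v Y t \<omega>) $ i"
    using centered_vector_processD(1)[OF X t] centered_vector_processD(1)[OF Y t] by simp
next
  fix t \<omega> assume t: "a \<le> t" "\<omega> \<in> space M"
  show "X t \<omega> @\<^sub>v Y t \<omega> \<in> carrier_vec (j + k)" using centered_vector_processD(1)[OF X t] centered_vector_processD(1)[OF Y t] by simp
next
  fix i assume i: "i < j + k"
  show "centered_process a (\<lambda>t \<omega>. if i < j then X t \<omega> $ i else Y t \<omega> $ (i - j))"
    using centered_vector_processD(2)[OF X, of i] centered_vector_processD(2)[OF Y, of "i - j"] i by (cases "i < j") auto
qed

lemma centered_vector_solution:
  fixes A :: "real \<Rightarrow> rmat" and X f :: "real \<Rightarrow> 'a \<Rightarrow> rvec"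
  assumes A: "\<And>t. a \<le> t \<Longrightarrow> A t \<in> carrier_mat k k"
    and K: "\<And>t i j. a \<le> t \<Longrightarrow> i < k \<Longrightarrow> j < k \<Longrightarrow> \<bar>A t $$ (i,j)\<bar> \<le> K"
    and X: "\<And>t. a \<le> t \<Longrightarrow> random_vector M k (X t)" and f: "centered_vector_process a k f"
    and der: "\<And>t \<omega>. a \<le> t \<Longrightarrow> \<omega> \<in> space M \<Longrightarrow> has_vderiv a (\<lambda>s. X s \<omega>) (A t *\<^sub>v X t \<omega> + f t \<omega>) t"
    and sq: "\<And>i. i < k \<Longrightarrow> integrable M (\<lambda>\<omega>. (X a \<omega> $ i)\<^sup>2)"
    and mean: "\<And>i. i < k \<Longrightarrow> expectation (\<lambda>\<omega>. X a \<omega> $ i) = 0"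
  shows "centered_vector_process a k X"
  unfolding centered_vector_process_def
proof (intro conjI allI impI ballI)
  interpret random_linear_system M a k "\<lambda>t i j. A t $$ (i,j)" K
    by unfold_locales (rule K)
  fix i assume i: "i < k"
  show "centered_process a (\<lambda>t \<omega>. X t \<omega> $ i)"
  proof (rule centered_solution[where f = "\<lambda>i t \<omega>. f t \<omega> $ i" and X = "\<lambda>i t \<omega>. X t \<omega> $ i"])
    fix \<omega> assume w: "\<omega> \<in> space M"
    show "solves a (\<lambda>i t. f t \<omega> $ i) (\<lambda>i t. X t \<omega> $ i)"
      unfolding solves_def
    proof (intro allI impI)
      fix t i assume t: "a \<le> t" and i: "i < k"
      note c = random_vector_carrier[OF X[OF t] w] centered_vector_processD(1)[OF f t w]
      have "((\<lambda>s. X s \<omega> $ i) has_real_derivative (A t *\<^sub>v X t \<omega> + f t \<omega>) $ i) (at t within {a..})"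
        by (rule has_vderivD(2)[OF der[OF t w] c(1) i])
      also have "(A t *\<^sub>v X t \<omega> + f t \<omega>) $ i = (A t *\<^sub>v X t \<omega>) $ i + f t \<omega> $ i" using c(2) i by simp
      also have "(A t *\<^sub>v X t \<omega>) $ i = (\<Sum>j<k. A t $$ (i,j) * X t \<omega> $ j)" by (rule mult_mat_vec_sum[OF A[OF t] c(1) i])
      finally show "((\<lambda>s. X s \<omega> $ i) has_real_derivative (\<Sum>j<k. A t $$ (i,j) * X t \<omega> $ j) + f t \<omega> $ i) (at t within {a..})" .
    qed
  next
    fix i t assume "i < k" "a \<le> t"
    then show "(\<lambda>\<omega>. X t \<omega> $ i) \<in> borel_measurable M" by (intro random_vector_measurable[OF X])
  qed (use centered_vector_processD(2)[OF f] sq mean i in auto)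
qed (rule random_vector_carrier[OF X])

lemma mean_vec_zeroD:
  fixes X :: "'a \<Rightarrow> rvec"
  assumes "mean_vec M k X = 0\<^sub>v k" "i < k" shows "expectation (\<lambda>\<omega>. X \<omega> $ i) = 0"
proof -
  have "mean_vec M k X $ i = 0" using assms by simp
  then show ?thesis using assms(2) by (simp add: mean_vec_def)
qed

text \<open>
  The second moments are read off from the covariance of the increment over the interval from \<open>a\<close> to
  \<open>t\<close>.
\<close>

lemma centered_white_noise:
  fixes \<beta> :: "real \<Rightarrow> 'a \<Rightarrow> rvec"
  assumes "integrated_white_noise M a k Q \<beta>"
  shows "centered_vector_process a k \<beta>"
    and "\<And>t. a \<le> t \<Longrightarrow> random_vector M k (\<beta> t)" and "\<And>\<omega>. \<omega> \<in> space M \<Longrightarrow> \<beta> a \<omega> = 0\<^sub>v k"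
proof -
  note W = assms[unfolded integrated_white_noise_def]
  have 1: "square_integrable M k (\<beta> t)" "mean_vec M k (\<beta> t) = 0\<^sub>v k" if "a \<le> t" for t
    using W[THEN conjunct1, THEN spec, THEN mp, OF that] by - (elim conjE, assumption)+
  have 2: "\<beta> a \<omega> = 0\<^sub>v k" "\<forall>i<k. continuous_on {a..} (\<lambda>t. \<beta> t \<omega> $ i)" if "\<omega> \<in> space M" for \<omega>
    using bspec[OF W[THEN conjunct2, THEN conjunct1] that] by - (elim conjE, assumption)+
  have 3: "expectation (\<lambda>\<omega>. (\<beta> t \<omega> $ i - \<beta> s \<omega> $ i) * (\<beta> t' \<omega> $ j - \<beta> s' \<omega> $ j)) = Q $$ (i,j) * max 0 (min t t' - max s s')"
    if "i < k" "j < k" "a \<le> s \<and> s \<le> t \<and> a \<le> s' \<and> s' \<le> t'" for i j s t s' t'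
    using W[THEN conjunct2, THEN conjunct2] that by blast
  show rv: "random_vector M k (\<beta> t)" if "a \<le> t" for t
    using 1(1)[OF that] unfolding square_integrable_def by (elim conjE)
  show "\<beta> a \<omega> = 0\<^sub>v k" if "\<omega> \<in> space M" for \<omega> by (rule 2(1)[OF that])
  show "centered_vector_process a k \<beta>"
    unfolding centered_vector_process_def centered_process_def
  proof (intro conjI allI impI ballI)
    fix t \<omega> assume "a \<le> t" "\<omega> \<in> space M"
    then show "\<beta> t \<omega> \<in> carrier_vec k" by (intro random_vector_carrier[OF rv])
  next
    fix i t assume i: "i < k" and t: "a \<le> t"
    show "(\<lambda>\<omega>. \<beta> t \<omega> $ i) \<in> borel_measurable M" by (rule random_vector_measurable[OF rv[OF t] i])
    show "integrable M (\<lambda>\<omega>. (\<beta> t \<omega> $ i)\<^sup>2)" using 1(1)[OF t] i unfolding square_integrable_def by blast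
    have "mean_vec M k (\<beta> t) $ i = 0" using 1(2)[OF t] i by simp
    then show "expectation (\<lambda>\<omega>. \<beta> t \<omega> $ i) = 0" using i by (simp add: mean_vec_def)
  next
    fix i \<omega> assume "i < k" "\<omega> \<in> space M"
    then show "continuous_on {a..} (\<lambda>t. \<beta> t \<omega> $ i)" using 2(2) by blast
  next
    fix i T assume i: "i < k"
    have "expectation (\<lambda>\<omega>. (\<beta> t \<omega> $ i)\<^sup>2) \<le> \<bar>Q $$ (i,i)\<bar> * \<bar>T - a\<bar>" if t: "t \<in> {a..T}" for t
    proof -
      have "expectation (\<lambda>\<omega>. (\<beta> t \<omega> $ i)\<^sup>2) = expectation (\<lambda>\<omega>. (\<beta> t \<omega> $ i - \<beta> a \<omega> $ i) * (\<beta> t \<omega> $ i - \<beta> a \<omega> $ i))"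
        using 2(1) i by (intro Bochner_Integration.integral_cong) (auto simp: power2_eq_square)
      also have "\<dots> = Q $$ (i,i) * max 0 (min t t - max a a)" using t by (intro 3[OF i i]) auto
      also have "\<dots> = Q $$ (i,i) * (t - a)" using t by simp
      also have "\<dots> \<le> \<bar>Q $$ (i,i)\<bar> * \<bar>T - a\<bar>" using t by (intro mult_mono) auto
      finally show ?thesis .
    qed
    then show "\<exists>B. \<forall>t\<in>{a..T}. expectation (\<lambda>\<omega>. (\<beta> t \<omega> $ i)\<^sup>2) \<le> B" by blast
  qed
qed

end

section \<open>The bias of the state estimate\<close>

locale alise_process = prob_space M + alise_filter Z for M :: "'w measure" and Z :: alise +
  fixes x w v vd \<beta>w \<beta>v \<theta> :: "real \<Rightarrow> 'w \<Rightarrow> rvec" and xhat0 :: "'w \<Rightarrow> rvec"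
  assumes noise_model: "noise_model Z"
    and noise: "noise_processes M Z w v vd \<beta>w \<beta>v"
    and state: "state_process M Z x w v"
    and filt: "filter_process M Z x v xhat0 \<theta>"
begin

lemma noise_carrier:
  "Aw Z \<in> carrier_mat (nw Z) (nw Z)" "Av Z \<in> carrier_mat l l" "Avd Z \<in> carrier_mat l l"
  "Bw Z \<in> carrier_mat (nw Z) (nwG Z)" "Bv Z \<in> carrier_mat l (nvG Z)"
  using noise_model unfolding noise_model_def pos_semidef_def by - (elim conjE, assumption)+

lemma noise_random:
  assumes "t0 \<le> t"
  shows "random_vector M (nw Z) (w t)" "random_vector M l (v t)" "random_vector M l (vd t)"
proof -
  have "vector_process M t0 (nw Z) w" "vector_process M t0 l v" "vector_process M t0 l vd"
    using noise unfolding noise_processes_def by - (elim conjE, assumption)+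
  then show "random_vector M (nw Z) (w t)" "random_vector M l (v t)" "random_vector M l (vd t)"
    using assms unfolding vector_process_def by simp_all
qed

lemma noise_ode:
  assumes "\<omega> \<in> space M" "t0 \<le> t"
  shows "has_vderiv t0 (\<lambda>s. w s \<omega> - Bw Z *\<^sub>v \<beta>w s \<omega>) (- (Aw Z *\<^sub>v w t \<omega>)) t"
    "has_vderiv t0 (\<lambda>s. v s \<omega>) (vd t \<omega>) t"
    "has_vderiv t0 (\<lambda>s. vd s \<omega> - Bv Z *\<^sub>v \<beta>v s \<omega>) (- (Avd Z *\<^sub>v vd t \<omega>) - Av Z *\<^sub>v v t \<omega>) t"
proof -
  note N = noise[unfolded noise_processes_def, THEN conjunct2, THEN conjunct2, THEN conjunct2, THEN conjunct2,
      THEN conjunct2, THEN conjunct2, THEN conjunct1]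
  note E = bspec[OF N assms(1), THEN spec, THEN mp, OF assms(2)]
  show "has_vderiv t0 (\<lambda>s. w s \<omega> - Bw Z *\<^sub>v \<beta>w s \<omega>) (- (Aw Z *\<^sub>v w t \<omega>)) t"
    "has_vderiv t0 (\<lambda>s. v s \<omega>) (vd t \<omega>) t"
    "has_vderiv t0 (\<lambda>s. vd s \<omega> - Bv Z *\<^sub>v \<beta>v s \<omega>) (- (Avd Z *\<^sub>v vd t \<omega>) - Av Z *\<^sub>v v t \<omega>) t"
    using E by - (elim conjE, assumption)+
qed

lemma noise_white:
  "integrated_white_noise M t0 (nwG Z) (QG Z) \<beta>w" "integrated_white_noise M t0 (nvG Z) (RG Z) \<beta>v"
  using noise unfolding noise_processes_def by - (elim conjE, assumption)+

lemma noise_initial: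
  "square_integrable M (nw Z) (w t0)" "mean_vec M (nw Z) (w t0) = 0\<^sub>v (nw Z)"
  "square_integrable M (2 * l) (\<lambda>\<omega>. v t0 \<omega> @\<^sub>v vd t0 \<omega>)"
  "mean_vec M (2 * l) (\<lambda>\<omega>. v t0 \<omega> @\<^sub>v vd t0 \<omega>) = 0\<^sub>v (2 * l)"
  using noise unfolding noise_processes_def by - (elim conjE, assumption)+

text \<open>
  The process \<open>w - B\<^sub>w \<beta>w\<close> has differentiable paths and solves the linear system with matrix \<open>- A\<^sub>w\<close>, forced
  by \<open>- A\<^sub>w B\<^sub>w \<beta>w\<close>.
\<close>

lemma centered_w: "centered_vector_process t0 (nw Z) w"
proof -
  note W = centered_white_noise[OF noise_white(1)]
  note c = noise_carrier
  define b where "b = (\<lambda>t \<omega>. Bw Z *\<^sub>v \<beta>w t \<omega>)"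
  define q where "q = (\<lambda>t \<omega>. w t \<omega> - b t \<omega>)"
  have b: "centered_vector_process t0 (nw Z) b"
    unfolding b_def by (rule centered_vector_process_mult[OF continuous_mat_const[OF c(4)] W(1)])
  have q_random: "random_vector M (nw Z) (q t)" if "t0 \<le> t" for t
    unfolding q_def b_def by (intro random_vector_diff noise_random(1) that random_vector_mult[OF c(4)] W(2))
  have q0: "q t0 \<omega> = w t0 \<omega>" if "\<omega> \<in> space M" for \<omega>
  proof -
    have "w t0 \<omega> \<in> carrier_vec (nw Z)" by (rule random_vector_carrier[OF noise_random(1)[OF order_refl] that])
    then show ?thesis
      using W(3)[OF that] c(4) unfolding q_def b_def by (intro eq_vecI) (auto simp: mult_mat_vec_zero_dim)
  qed
  have nA: "- Aw Z \<in> carrier_mat (nw Z) (nw Z)" using c(1) by simp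
  have "centered_vector_process t0 (nw Z) q"
  proof (rule centered_vector_solution[where A = "\<lambda>t. - Aw Z" and f = "\<lambda>t \<omega>. (- Aw Z) *\<^sub>v b t \<omega>" and K = "fnorm (- Aw Z)"])
    show "\<bar>(- Aw Z) $$ (i,j)\<bar> \<le> fnorm (- Aw Z)" if "i < nw Z" "j < nw Z" for i j
      by (rule entry_le_fnorm[OF nA that])
    show "centered_vector_process t0 (nw Z) (\<lambda>t \<omega>. (- Aw Z) *\<^sub>v b t \<omega>)"
      by (rule centered_vector_process_mult[OF continuous_mat_const[OF nA] b])
    fix t \<omega> assume t: "t0 \<le> t" and w: "\<omega> \<in> space M"
    have d: "dim_row (Aw Z) = nw Z" "dim_col (Aw Z) = nw Z" "dim_row (Bw Z) = nw Z" "dim_vec (w t \<omega>) = nw Z" "dim_vec (b t \<omega>) = nw Z"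
      using c(1,4) random_vector_carrier[OF noise_random(1)[OF t] w] centered_vector_processD(1)[OF b t w] by auto
    have q: "q t \<omega> = w t \<omega> - b t \<omega>" unfolding q_def ..
    have "- (Aw Z *\<^sub>v w t \<omega>) = (- Aw Z) *\<^sub>v q t \<omega> + (- Aw Z) *\<^sub>v b t \<omega>"
      unfolding q by (rule eq_vecI) (simp_all add: mat_vec_expand d del: index_mult_mat_vec)
    then show "has_vderiv t0 (\<lambda>s. q s \<omega>) ((- Aw Z) *\<^sub>v q t \<omega> + (- Aw Z) *\<^sub>v b t \<omega>) t"
      using noise_ode(1)[OF w t] unfolding q_def b_def by simp
  next
    fix i assume i: "i < nw Z"
    have "integrable M (\<lambda>\<omega>. (w t0 \<omega> $ i)\<^sup>2)" using noise_initial(1) i unfolding square_integrable_def by blast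
    then show "integrable M (\<lambda>\<omega>. (q t0 \<omega> $ i)\<^sup>2)"
      by (subst Bochner_Integration.integrable_cong[OF refl, where g = "\<lambda>\<omega>. (w t0 \<omega> $ i)\<^sup>2"]) (simp_all add: q0)
    have "expectation (\<lambda>\<omega>. q t0 \<omega> $ i) = expectation (\<lambda>\<omega>. w t0 \<omega> $ i)"
      by (rule Bochner_Integration.integral_cong[OF refl]) (simp add: q0)
    then show "expectation (\<lambda>\<omega>. q t0 \<omega> $ i) = 0" using mean_vec_zeroD[OF noise_initial(2) i] by simp
  qed (use nA q_random in auto)
  then have s: "centered_vector_process t0 (nw Z) (\<lambda>t \<omega>. q t \<omega> + b t \<omega>)" using b by (rule centered_vector_process_add)
  show ?thesis
  proof (rule centered_vector_processI[OF _ centered_vector_processD(2)[OF s]])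
    fix t \<omega> assume t: "t0 \<le> t" and w: "\<omega> \<in> space M"
    show wc: "w t \<omega> \<in> carrier_vec (nw Z)" by (rule random_vector_carrier[OF noise_random(1)[OF t] w])
    fix i assume "i < nw Z"
    then show "(q t \<omega> + b t \<omega>) $ i = w t \<omega> $ i"
      using wc centered_vector_processD(1)[OF b t w] unfolding q_def by simp
  qed
qed

text \<open>
  As for \<open>w\<close>, with the stacked process of \<open>v\<close> and \<open>v' - B\<^sub>v \<beta>v\<close> and the companion matrix \<open>Av_stack\<close>.
\<close>

lemma centered_v: "centered_vector_process t0 l v" "centered_vector_process t0 l vd"
proof -
  note W = centered_white_noise[OF noise_white(2)]
  note c = noise_carrier
  define b where "b = (\<lambda>t \<omega>. Bv Z *\<^sub>v \<beta>v t \<omega>)"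
  have b: "centered_vector_process t0 l b"
    unfolding b_def by (rule centered_vector_process_mult[OF continuous_mat_const[OF c(5)] W(1)])
  define q where "q = (\<lambda>t \<omega>. vd t \<omega> - b t \<omega>)"
  define X where "X = (\<lambda>t \<omega>. v t \<omega> @\<^sub>v q t \<omega>)"
  define f where "f = (\<lambda>t \<omega>. b t \<omega> @\<^sub>v ((- Avd Z) *\<^sub>v b t \<omega>))"
  have nA: "- Avd Z \<in> carrier_mat l l" "- Av Z \<in> carrier_mat l l" using c by auto
  have As: "Av_stack Z \<in> carrier_mat (l + l) (l + l)" unfolding Av_stack_def using nA by auto
  have q_random: "random_vector M l (q t)" if "t0 \<le> t" for t
    unfolding q_def b_def by (intro random_vector_diff noise_random(3) that random_vector_mult[OF c(5)] W(2))
  have X_random: "random_vector M (l + l) (X t)" if "t0 \<le> t" for t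
    unfolding X_def by (intro random_vector_append noise_random(2) q_random that)
  have X0: "X t0 \<omega> = v t0 \<omega> @\<^sub>v vd t0 \<omega>" if w: "\<omega> \<in> space M" for \<omega>
  proof -
    have "vd t0 \<omega> \<in> carrier_vec l" by (rule random_vector_carrier[OF noise_random(3)[OF order_refl] w])
    then have "q t0 \<omega> = vd t0 \<omega>"
      using W(3)[OF w] c(5) unfolding q_def b_def by (intro eq_vecI) (auto simp: mult_mat_vec_zero_dim)
    then show ?thesis by (simp add: X_def)
  qed
  have f: "centered_vector_process t0 (l + l) f"
    unfolding f_def by (intro centered_vector_process_append b centered_vector_process_mult[OF continuous_mat_const[OF nA(1)] b])
  have X: "centered_vector_process t0 (l + l) X"
  proof (rule centered_vector_solution[where A = "\<lambda>t. Av_stack Z" and f = f and K = "fnorm (Av_stack Z)"])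
    show "\<bar>Av_stack Z $$ (i,j)\<bar> \<le> fnorm (Av_stack Z)" if "i < l + l" "j < l + l" for i j
      by (rule entry_le_fnorm[OF As that])
    fix t \<omega> assume t: "t0 \<le> t" and w: "\<omega> \<in> space M"
    have vc: "v t \<omega> \<in> carrier_vec l" "vd t \<omega> \<in> carrier_vec l" "b t \<omega> \<in> carrier_vec l" "q t \<omega> \<in> carrier_vec l"
      using random_vector_carrier[OF noise_random(2)[OF t] w] random_vector_carrier[OF noise_random(3)[OF t] w]
        centered_vector_processD(1)[OF b t w] random_vector_carrier[OF q_random[OF t] w] by auto
    have d: "dim_row (Av Z) = l" "dim_col (Av Z) = l" "dim_row (Avd Z) = l" "dim_col (Avd Z) = l"
      "dim_vec (v t \<omega>) = l" "dim_vec (vd t \<omega>) = l" "dim_vec (b t \<omega>) = l" "dim_vec (q t \<omega>) = l"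
      using c vc by auto
    have "Av_stack Z *\<^sub>v X t \<omega> = (0\<^sub>m l l *\<^sub>v v t \<omega> + 1\<^sub>m l *\<^sub>v q t \<omega>) @\<^sub>v ((- Av Z) *\<^sub>v v t \<omega> + (- Avd Z) *\<^sub>v q t \<omega>)"
      unfolding Av_stack_def X_def
      by (rule four_block_mat_mult_vec[OF zero_carrier_mat one_carrier_mat nA(2,1) vc(1,4)])
    also have "0\<^sub>m l l *\<^sub>v v t \<omega> + 1\<^sub>m l *\<^sub>v q t \<omega> = q t \<omega>"
      by (rule eq_vecI) (simp_all add: zero_mult_mat_vec_dim one_mult_mat_vec_dim d del: index_mult_mat_vec)
    finally have AX: "Av_stack Z *\<^sub>v X t \<omega> = q t \<omega> @\<^sub>v ((- Av Z) *\<^sub>v v t \<omega> + (- Avd Z) *\<^sub>v q t \<omega>)" .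
    have "Av_stack Z *\<^sub>v X t \<omega> + f t \<omega> = vd t \<omega> @\<^sub>v (- (Avd Z *\<^sub>v vd t \<omega>) - Av Z *\<^sub>v v t \<omega>)"
      unfolding AX f_def q_def
      by (rule eq_vecI) (auto simp: mat_vec_expand d simp del: index_mult_mat_vec)
    moreover have "has_vderiv t0 (\<lambda>s. X s \<omega>) (vd t \<omega> @\<^sub>v (- (Avd Z *\<^sub>v vd t \<omega>) - Av Z *\<^sub>v v t \<omega>)) t"
      unfolding X_def
    proof (rule has_vderiv_append[OF noise_ode(2)[OF w t] _ _ _ t])
      show "has_vderiv t0 (\<lambda>s. q s \<omega>) (- (Avd Z *\<^sub>v vd t \<omega>) - Av Z *\<^sub>v v t \<omega>) t"
        unfolding q_def b_def by (rule noise_ode(3)[OF w t])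
      show "v s \<omega> \<in> carrier_vec l" if "t0 \<le> s" for s by (rule random_vector_carrier[OF noise_random(2)[OF that] w])
      show "q s \<omega> \<in> carrier_vec l" if "t0 \<le> s" for s by (rule random_vector_carrier[OF q_random[OF that] w])
    qed
    ultimately show "has_vderiv t0 (\<lambda>s. X s \<omega>) (Av_stack Z *\<^sub>v X t \<omega> + f t \<omega>) t" by simp
  next
    fix i assume i: "i < l + l"
    have "integrable M (\<lambda>\<omega>. ((v t0 \<omega> @\<^sub>v vd t0 \<omega>) $ i)\<^sup>2)"
      using noise_initial(3) i unfolding square_integrable_def mult_2 by blast
    then show "integrable M (\<lambda>\<omega>. (X t0 \<omega> $ i)\<^sup>2)"
      by (subst Bochner_Integration.integrable_cong[OF refl, where g = "\<lambda>\<omega>. ((v t0 \<omega> @\<^sub>v vd t0 \<omega>) $ i)\<^sup>2"]) (simp_all only: X0)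
    have "expectation (\<lambda>\<omega>. X t0 \<omega> $ i) = expectation (\<lambda>\<omega>. (v t0 \<omega> @\<^sub>v vd t0 \<omega>) $ i)"
      by (rule Bochner_Integration.integral_cong[OF refl]) (simp only: X0)
    then show "expectation (\<lambda>\<omega>. X t0 \<omega> $ i) = 0"
      using mean_vec_zeroD[OF noise_initial(4), of i] i by (simp add: mult_2)
  qed (use As X_random f in auto)
  note car = random_vector_carrier[OF noise_random(2)] random_vector_carrier[OF q_random]
  show "centered_vector_process t0 l v"
  proof (rule centered_vector_processI[where f = "\<lambda>i t \<omega>. X t \<omega> $ i"])
    fix t \<omega> i assume "t0 \<le> t" "\<omega> \<in> space M" "i < l"
    then show "X t \<omega> $ i = v t \<omega> $ i" using car(1)[of t \<omega>] car(2)[of t \<omega>] by (simp add: X_def)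
  qed (use car centered_vector_processD(2)[OF X] in auto)
  have q: "centered_vector_process t0 l q"
  proof (rule centered_vector_processI[where f = "\<lambda>i t \<omega>. X t \<omega> $ (l + i)"])
    fix t \<omega> i assume "t0 \<le> t" "\<omega> \<in> space M" "i < l"
    then show "X t \<omega> $ (l + i) = q t \<omega> $ i" using car(1)[of t \<omega>] car(2)[of t \<omega>] by (simp add: X_def)
  qed (use car centered_vector_processD(2)[OF X] in auto)
  have s: "centered_vector_process t0 l (\<lambda>t \<omega>. q t \<omega> + b t \<omega>)" using q b by (rule centered_vector_process_add)
  show "centered_vector_process t0 l vd"
  proof (rule centered_vector_processI[OF _ centered_vector_processD(2)[OF s]])
    fix t \<omega> assume t: "t0 \<le> t" and w: "\<omega> \<in> space M"
    show vc: "vd t \<omega> \<in> carrier_vec l" by (rule random_vector_carrier[OF noise_random(3)[OF t] w])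
    fix i assume "i < l"
    then show "(q t \<omega> + b t \<omega>) $ i = vd t \<omega> $ i"
      using vc centered_vector_processD(1)[OF b t w] unfolding q_def by simp
  qed
qed

lemma state_facts:
  assumes "t0 \<le> t"
  shows "square_integrable M n (x t)" "random_vector M n (x t)" "random_vector M n (\<theta> t)"
proof -
  show S: "square_integrable M n (x t)"
    using state[unfolded state_process_def, THEN conjunct1] assms by blast
  then show "random_vector M n (x t)" unfolding square_integrable_def by (elim conjE)
  have "vector_process M t0 n \<theta>" using filt unfolding filter_process_def by (elim conjE)
  then show "random_vector M n (\<theta> t)" using assms unfolding vector_process_def by blast
qed

lemma filter_facts:
  "square_integrable M n xhat0" "random_vector M n xhat0"
  "\<omega> \<in> space M \<Longrightarrow> filter_path Z (\<lambda>t. measurement Z x v t \<omega>) (xhat0 \<omega>) (\<lambda>t. \<theta> t \<omega>)"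
proof -
  show S: "square_integrable M n xhat0" using filt unfolding filter_process_def by (elim conjE)
  then show "random_vector M n xhat0" unfolding square_integrable_def by (elim conjE)
  assume "\<omega> \<in> space M"
  then show "filter_path Z (\<lambda>t. measurement Z x v t \<omega>) (xhat0 \<omega>) (\<lambda>t. \<theta> t \<omega>)"
    using filt[unfolded filter_process_def, THEN conjunct2, THEN conjunct2, THEN conjunct2] by blast
qed

lemma measurement_random: assumes t: "t0 \<le> t" shows "random_vector M l (measurement Z x v t)"
  unfolding measurement_def[abs_def]
  by (intro random_vector_add random_vector_mult[OF plant_carrier(4)[OF t] state_facts(2)[OF t]] noise_random(2)[OF t]
      random_vector_const mult_mat_vec_carrier[OF plant_carrier(5)[OF t] plant_carrier(8)[OF t]]
      mult_mat_vec_carrier[OF plant_carrier(7)[OF t] plant_carrier(9)[OF t]])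

lemma error_random: assumes t: "t0 \<le> t" shows "random_vector M n (estimation_error Z x v \<theta> t)"
proof -
  note c = gain_carrier[OF t] T2_carrier[OF t]
  have D2c: "D2 Z t \<in> carrier_mat k m" unfolding D2_def by (rule mult_carrier_mat[OF T2_carrier[OF t] plant_carrier(5)[OF t]])
  have y: "random_vector M l (\<lambda>\<omega>. measurement Z x v t \<omega>)" using measurement_random[OF t] .
  show ?thesis
    unfolding estimation_error_def[abs_def] state_estimate_def
    by (intro random_vector_diff random_vector_add state_facts(2,3)[OF t]
        random_vector_mult[OF c(3) random_vector_mult[OF c(8) random_vector_mult[OF T2_carrier[OF t] y]]]
        random_vector_const mult_mat_vec_carrier[OF c(3) mult_mat_vec_carrier[OF c(8) mult_mat_vec_carrier[OF D2c plant_carrier(8)[OF t]]]])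
qed

lemma error_initial: assumes w: "\<omega> \<in> space M" shows "estimation_error Z x v \<theta> t0 \<omega> = x t0 \<omega> - xhat0 \<omega>"
  unfolding estimation_error_def
  using initial_estimate[OF filter_facts(3)[OF w] random_vector_carrier[OF filter_facts(2) w]
      random_vector_carrier[OF measurement_random[OF order_refl] w]] by simp

lemma error_path_ode:
  assumes w: "\<omega> \<in> space M" and t: "t0 \<le> t"
  shows "has_vderiv t0 (\<lambda>s. estimation_error Z x v \<theta> s \<omega>)
    (A_breve Z t *\<^sub>v estimation_error Z x v \<theta> t \<omega>
      + ((Proj Z t * mW Z t) *\<^sub>v w t \<omega> - v_coeff t *\<^sub>v v t \<omega> - Phi1 Z t *\<^sub>v vd t \<omega>)) t"
  unfolding estimation_error_def
proof (rule error_ode[OF _ _ _ _ _ _ _ _ _ filter_facts(3)[OF w] t])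
  note S = state[unfolded state_process_def, THEN conjunct2, THEN conjunct2]
  show "vdifferentiable t0 (\<lambda>t. measurement Z x v t \<omega>)"
    using bspec[OF S[THEN conjunct2, THEN conjunct1] w] .
  fix t assume t: "t0 \<le> t"
  show "has_vderiv t0 (\<lambda>t. x t \<omega>) (mA Z t *\<^sub>v x t \<omega> + mB Z t *\<^sub>v inp Z t + mG Z t *\<^sub>v unk Z t + mW Z t *\<^sub>v w t \<omega>) t"
    using bspec[OF S[THEN conjunct1] w, THEN spec, THEN mp, OF t] .
  show "has_vderiv t0 (\<lambda>t. v t \<omega>) (vd t \<omega>) t" by (rule noise_ode(2)[OF w t])
  show "x t \<omega> \<in> carrier_vec n" by (rule random_vector_carrier[OF state_facts(2)[OF t] w])
  show "v t \<omega> \<in> carrier_vec l" by (rule random_vector_carrier[OF noise_random(2)[OF t] w])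
  show "vd t \<omega> \<in> carrier_vec l" by (rule random_vector_carrier[OF noise_random(3)[OF t] w])
  show "w t \<omega> \<in> carrier_vec (nw Z)" by (rule random_vector_carrier[OF noise_random(1)[OF t] w])
  show "\<theta> t \<omega> \<in> carrier_vec n" by (rule random_vector_carrier[OF state_facts(3)[OF t] w])
qed (simp add: measurement_def)

lemma error_initial_square_integrable:
  assumes i: "i < n" shows "integrable M (\<lambda>\<omega>. (estimation_error Z x v \<theta> t0 \<omega> $ i - c)\<^sup>2)"
proof -
  have X: "integrable M (\<lambda>\<omega>. (x t0 \<omega> $ i)\<^sup>2)" "integrable M (\<lambda>\<omega>. (xhat0 \<omega> $ i)\<^sup>2)"
    using state_facts(1)[OF order_refl] filter_facts(1) i unfolding square_integrable_def by blast+
  have m: "(\<lambda>\<omega>. estimation_error Z x v \<theta> t0 \<omega> $ i) \<in> borel_measurable M"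
    by (rule random_vector_measurable[OF error_random[OF order_refl] i])
  show ?thesis
  proof (rule Bochner_Integration.integrable_bound)
    show "integrable M (\<lambda>\<omega>. 3 * (x t0 \<omega> $ i)\<^sup>2 + 3 * (xhat0 \<omega> $ i)\<^sup>2 + 3 * c\<^sup>2)"
      using X by simp
    show "(\<lambda>\<omega>. (estimation_error Z x v \<theta> t0 \<omega> $ i - c)\<^sup>2) \<in> borel_measurable M" using m by measurable
    show "AE \<omega> in M. norm ((estimation_error Z x v \<theta> t0 \<omega> $ i - c)\<^sup>2)
        \<le> norm (3 * (x t0 \<omega> $ i)\<^sup>2 + 3 * (xhat0 \<omega> $ i)\<^sup>2 + 3 * c\<^sup>2)"
    proof (rule AE_I2)
      fix \<omega> assume w: "\<omega> \<in> space M"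
      have e: "estimation_error Z x v \<theta> t0 \<omega> $ i = x t0 \<omega> $ i - xhat0 \<omega> $ i"
        using random_vector_carrier[OF filter_facts(2) w] i by (simp add: error_initial[OF w])
      have le: "(p - q - c)\<^sup>2 \<le> 3 * p\<^sup>2 + 3 * q\<^sup>2 + 3 * c\<^sup>2" for p q :: real
        using zero_le_power2[of "p + q"] zero_le_power2[of "p + c"] zero_le_power2[of "q - c"]
        by (simp add: power2_eq_square algebra_simps)
      show "norm ((estimation_error Z x v \<theta> t0 \<omega> $ i - c)\<^sup>2)
          \<le> norm (3 * (x t0 \<omega> $ i)\<^sup>2 + 3 * (xhat0 \<omega> $ i)\<^sup>2 + 3 * c\<^sup>2)"
        unfolding e using le[of "x t0 \<omega> $ i" "xhat0 \<omega> $ i"] by simp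
    qed
  qed
qed

text \<open>
  The error minus \<open>\<xi>\<close> solves a linear system with centred forcing and has mean zero initially, hence at
  all times.
\<close>

lemma bias_solution:
  assumes K: "mbounded t0 (A_breve Z)" and \<xi>: "homogeneous_solution n (A_breve Z) t0 \<xi>"
    and init: "\<xi> t0 = bias M Z x v \<theta> t0" and t: "t0 \<le> t"
  shows "bias M Z x v \<theta> t = \<xi> t"
    and "\<And>i. i < n \<Longrightarrow> integrable M (\<lambda>\<omega>. estimation_error Z x v \<theta> t \<omega> $ i)"
proof -
  obtain B where B: "\<And>t. t0 \<le> t \<Longrightarrow> fnorm (A_breve Z t) \<le> B" using K unfolding mbounded_def by blast
  note Ac = gain_carrier(11)
  define err where "err = (\<lambda>t \<omega>. estimation_error Z x v \<theta> t \<omega>)"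
  define f where "f = (\<lambda>t \<omega>. (Proj Z t * mW Z t) *\<^sub>v w t \<omega> - v_coeff t *\<^sub>v v t \<omega> - Phi1 Z t *\<^sub>v vd t \<omega>)"
  have f: "centered_vector_process t0 n f"
    unfolding f_def
    by (intro centered_vector_process_diff centered_vector_process_mult[OF coefficients_continuous(1) centered_w]
        centered_vector_process_mult[OF coefficients_continuous(2) centered_v(1)]
        centered_vector_process_mult[OF coefficients_continuous(3) centered_v(2)])
  have \<xi>c: "\<xi> s \<in> carrier_vec n" if "t0 \<le> s" for s using \<xi> that unfolding homogeneous_solution_def by blast
  have \<xi>d: "has_vderiv t0 \<xi> (A_breve Z s *\<^sub>v \<xi> s) s" if "t0 \<le> s" for s
    using \<xi> that unfolding homogeneous_solution_def by blast
  have err_random: "random_vector M n (err s)" if "t0 \<le> s" for s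
    using error_random[OF that] unfolding err_def .
  define X where "X = (\<lambda>t \<omega>. err t \<omega> - \<xi> t)"
  have X_entry: "X s \<omega> $ i = err s \<omega> $ i - \<xi> s $ i" if "t0 \<le> s" "i < n" for s \<omega> i
    using \<xi>c[OF that(1)] that(2) by (simp add: X_def)
  have err0: "integrable M (\<lambda>\<omega>. err t0 \<omega> $ i)" if "i < n" for i
  proof (rule square_integrable_imp_integrable)
    show "(\<lambda>\<omega>. err t0 \<omega> $ i) \<in> borel_measurable M"
      by (rule random_vector_measurable[OF err_random[OF order_refl] that])
    show "integrable M (\<lambda>\<omega>. (err t0 \<omega> $ i)\<^sup>2)"
      using error_initial_square_integrable[OF that, of 0] by (simp add: err_def)
  qed
  have X: "centered_vector_process t0 n X"
  proof (rule centered_vector_solution[where A = "A_breve Z" and f = f and K = B])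
    show "\<bar>A_breve Z s $$ (i,j)\<bar> \<le> B" if "t0 \<le> s" "i < n" "j < n" for s i j
      using entry_le_fnorm[OF Ac[OF that(1)] that(2,3)] B[OF that(1)] by linarith
    show "random_vector M n (X s)" if "t0 \<le> s" for s
      unfolding X_def by (intro random_vector_diff err_random random_vector_const \<xi>c that)
    fix s \<omega> assume s: "t0 \<le> s" and w: "\<omega> \<in> space M"
    note c = random_vector_carrier[OF err_random w] \<xi>c
    have "has_vderiv t0 (\<lambda>s. X s \<omega>) ((A_breve Z s *\<^sub>v err s \<omega> + f s \<omega>) - A_breve Z s *\<^sub>v \<xi> s) s"
      unfolding X_def f_def
      by (rule has_vderiv_diff[OF error_path_ode[OF w s, folded err_def] c(1) \<xi>d[OF s] c(2) s])
    moreover have "(A_breve Z s *\<^sub>v err s \<omega> + f s \<omega>) - A_breve Z s *\<^sub>v \<xi> s = A_breve Z s *\<^sub>v X s \<omega> + f s \<omega>"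
    proof -
      have d: "dim_row (A_breve Z s) = n" "dim_col (A_breve Z s) = n" "dim_vec (err s \<omega>) = n" "dim_vec (\<xi> s) = n" "dim_vec (f s \<omega>) = n"
        using Ac[OF s] c(1)[OF s] c(2)[OF s] centered_vector_processD(1)[OF f s w] by auto
      show ?thesis unfolding X_def by (rule eq_vecI) (simp_all add: d mat_vec_expand del: index_mult_mat_vec)
    qed
    ultimately show "has_vderiv t0 (\<lambda>s. X s \<omega>) (A_breve Z s *\<^sub>v X s \<omega> + f s \<omega>) s" by simp
  next
    fix i assume i: "i < n"
    show "integrable M (\<lambda>\<omega>. (X t0 \<omega> $ i)\<^sup>2)"
      unfolding X_entry[OF order_refl i] err_def by (rule error_initial_square_integrable[OF i])
    have "\<xi> t0 $ i = expectation (\<lambda>\<omega>. err t0 \<omega> $ i)"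
      unfolding init bias_def mean_vec_def err_def using i by simp
    then show "expectation (\<lambda>\<omega>. X t0 \<omega> $ i) = 0"
      unfolding X_entry[OF order_refl i] using err0[OF i] by (simp add: prob_space)
  qed (use Ac f in auto)
  have int: "integrable M (\<lambda>\<omega>. err t \<omega> $ i)" and mean: "expectation (\<lambda>\<omega>. err t \<omega> $ i) = \<xi> t $ i" if i: "i < n" for i
  proof -
    note C = centered_processD[OF centered_vector_processD(2)[OF X i] t]
    have "integrable M (\<lambda>\<omega>. X t \<omega> $ i + \<xi> t $ i)" using C(3) by simp
    then show I: "integrable M (\<lambda>\<omega>. err t \<omega> $ i)" by (simp add: X_entry[OF t i])
    have "expectation (\<lambda>\<omega>. err t \<omega> $ i - \<xi> t $ i) = 0" using C(4) by (simp add: X_entry[OF t i])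
    then show "expectation (\<lambda>\<omega>. err t \<omega> $ i) = \<xi> t $ i" using I by (simp add: prob_space)
  qed
  show "bias M Z x v \<theta> t = \<xi> t"
    using mean \<xi>c[OF t] unfolding bias_def mean_vec_def err_def by (intro eq_vecI) auto
  show "\<And>i. i < n \<Longrightarrow> integrable M (\<lambda>\<omega>. estimation_error Z x v \<theta> t \<omega> $ i)"
    using int unfolding err_def .
qed

end

theorem lemma3:
  fixes M :: "'w measure" and Z :: alise
    and x w v vd \<beta>w \<beta>v \<theta> :: "real \<Rightarrow> 'w \<Rightarrow> rvec"
    and xhat0 :: "'w \<Rightarrow> rvec"
    and \<Psi> :: "real \<Rightarrow> real \<Rightarrow> rmat"
  defines "S \<equiv> gramian (nx Z) \<Psi>"
    and "e \<equiv> bias M Z x v \<theta>"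
  defines "\<beta> \<equiv> sqrt (scalar_prod (e (ti Z)) (S (ti Z) *\<^sub>v e (ti Z)) / inf_lam_min (ti Z) S)"
    and "\<gamma> \<equiv> 1 / (2 * sup_lam_max (ti Z) S)"
  assumes "prob_space M"
    and "plant Z"
    and "decoupling Z"
    and "noise_model Z"
    and "noise_covariances Z"
    and "filter_gains Z"
    and "noise_processes M Z w v vd \<beta>w \<beta>v"
    and "state_process M Z x w v"
    and "filter_process M Z x v xhat0 \<theta>"
    and "uniformly_asymptotically_stable (ti Z) (nx Z) (A_breve Z)"
    and "mbounded (ti Z) (A_breve Z)"
    and "transition_matrix (ti Z) (nx Z) (A_breve Z) \<Psi>"
  shows "(\<forall>t\<ge>ti Z. \<forall>i<nx Z. \<forall>j<nx Z.
            (\<forall>T\<ge>t. (\<lambda>s. gramian_integrand \<Psi> t s $$ (i,j)) integrable_on {t..T}) \<and>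
            ((\<lambda>T. gramian_upto (nx Z) \<Psi> t T $$ (i,j)) \<longlongrightarrow> S t $$ (i,j)) at_top)
       \<and> (\<forall>t\<ge>ti Z. pos_def (nx Z) (S t))
       \<and> bdd_above ((\<lambda>t. lam_max (S t)) ` {ti Z..}) \<and> bdd_below ((\<lambda>t. lam_min (S t)) ` {ti Z..})
       \<and> 0 < sup_lam_max (ti Z) S \<and> 0 < inf_lam_min (ti Z) S
       \<and> (\<forall>t\<ge>ti Z. \<forall>i<nx Z. integrable M (\<lambda>\<omega>. estimation_error Z x v \<theta> t \<omega> $ i))
       \<and> (\<forall>t\<ge>ti Z. vnorm (e t) \<le> \<beta> * exp (- \<gamma> * (t - ti Z)))"
proof -
  interpret alise_process M Z x w v vd \<beta>w \<beta>v \<theta> xhat0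
    using assms unfolding alise_process_def alise_filter_def alise_process_axioms_def by blast
  obtain B where B: "\<forall>t\<ge>ti Z. fnorm (A_breve Z t) \<le> B"
    using \<open>mbounded (ti Z) (A_breve Z)\<close> unfolding mbounded_def by blast
  interpret G: stable_system "ti Z" "nx Z" "A_breve Z" B \<Psi>
  proof unfold_locales
    fix t i j assume "ti Z \<le> t" "i < nx Z" "j < nx Z"
    then show "\<bar>A_breve Z t $$ (i,j)\<bar> \<le> B"
      using entry_le_fnorm[OF gain_carrier(11)] B by (meson order_trans)
  qed (use n_pos gain_carrier(11) assms in auto)
  have ec: "e (ti Z) \<in> carrier_vec (nx Z)" by (simp add: e_def bias_def mean_vec_def)
  define \<xi> where "\<xi> = (\<lambda>t. \<Psi> t (ti Z) *\<^sub>v e (ti Z))"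
  have \<xi>: "homogeneous_solution (nx Z) (A_breve Z) (ti Z) \<xi>"
    unfolding \<xi>_def by (rule G.hsol_Psi[OF order_refl ec])
  have "\<Psi> (ti Z) (ti Z) = 1\<^sub>m (nx Z)"
    using \<open>transition_matrix (ti Z) (nx Z) (A_breve Z) \<Psi>\<close> unfolding transition_matrix_def by blast
  then have \<xi>0: "\<xi> (ti Z) = e (ti Z)" using ec by (simp add: \<xi>_def)
  note bias = bias_solution[OF \<open>mbounded (ti Z) (A_breve Z)\<close> \<xi> \<xi>0[unfolded e_def]]
  have decay: "vnorm (e t) \<le> \<beta> * exp (- \<gamma> * (t - ti Z))" if t: "ti Z \<le> t" for t
    using G.solution_decay[OF \<xi> t] bias(1)[OF t] unfolding \<xi>0 \<beta>_def \<gamma>_def S_def e_def by simp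
  show ?thesis
    unfolding S_def
    using G.gramian_exists(1,3) G.gramian_pos_def G.gramian_spectrum(1-4) bias(2) decay by blast
qed

end
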